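(* For $n\ge1$ let $T_n$ be the number of strict-binary bilabelled increasing trees with $2n$ labels, i.e. $T_n=\sum_{T}\ell(T)$ where $T$ ranges over ordered trees with $n$ nodes in which every node has $0$ or $2$ children and $\ell(T)$ is the number of increasing bilabellings of $T$ with label set $\{1,\dots,2n\}$; let $T(z)=\sum_{n\ge1}T_n\frac{z^{2n}}{(2n)!}$. Then \[T(z)=\frac{6}{\sqrt3}\,\wp\big(3^{-1/4}z+\varpi;\,-1,\,0\big)=\sqrt3\,i\,\mathrm{sl}^2\!\Big(\frac{z}{3^{1/4}(1+i)}\Big).\] The numbers $T_n$ satisfy $T_n=\sum_{k=1}^{n-2}\binom{2n-2}{2k}T_kT_{n-1-k}$ for $n\ge2$, with $T_1=1$, and \[T_n=\frac{(2n+1)!\,2^{3n+4}\pi^{n+1}}{3^{\frac{n-1}{2}}\Gamma^{4n+4}(\frac14)}\sum_{n_1,n_2\in\mathbb{Z}}\frac{1}{(1+n_1+n_2+i(n_1-n_2))^{2n+2}}.\]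
   Context: An increasing bilabelling of a tree with $n$ nodes assigns to each node a set of exactly two integers from $\{1,\dots,2n\}$, these sets partitioning $\{1,\dots,2n\}$, such that every label of a child is larger than both labels of its parent. $\wp(z;g_2,g_3)$ denotes the Weierstrass $\wp$-function $\wp(z)=\frac1{z^2}+\sum_{0\ne\omega\in\Omega}\big(\frac{1}{(z-\omega)^2}-\frac1{\omega^2}\big)$ of the lattice $\Omega$ whose invariants $g_2=60\sum_{0\neq\omega\in\Omega}\omega^{-4}$, $g_3=140\sum_{0\ne\omega\in\Omega}\omega^{-6}$ are the given values. The lemniscate sine $\mathrm{sl}(z)$ is the inverse of $s\mapsto\int_0^s\frac{dt}{\sqrt{1-t^4}}$, and $\varpi=2\int_0^1\frac{dt}{\sqrt{1-t^4}}=\frac{\Gamma(1/4)^2}{2\sqrt{2\pi}}$ is the lemniscate constant. *)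

theory Defs
  imports "HOL-Complex_Analysis.Complex_Analysis" "HOL-Library.Disjoint_Sets"
begin

text \<open>Ordered trees with a label at every node; \<open>unit otree\<close> is the type of plain ordered trees.\<close>

datatype 'a otree = Node (label: 'a) (subtrees: "'a otree list")

fun node_labels :: "'a otree \<Rightarrow> 'a list" where
  "node_labels (Node a ts) = a # concat (map node_labels ts)"

definition num_nodes :: "'a otree \<Rightarrow> nat" where
  "num_nodes t = length (node_labels t)"

definition shape :: "'a otree \<Rightarrow> unit otree" where
  "shape t = map_otree (\<lambda>_. ()) t"

fun strict_binary :: "'a otree \<Rightarrow> bool" where
  "strict_binary (Node a ts) \<longleftrightarrow> length ts \<in> {0, 2} \<and> (\<forall>t\<in>set ts. strict_binary t)"

fun increasing :: "nat set otree \<Rightarrow> bool" where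
  "increasing (Node A ts) \<longleftrightarrow>
     (\<forall>t\<in>set ts. (\<forall>a\<in>A. \<forall>b\<in>label t. a < b) \<and> increasing t)"

text \<open>The label sets of distinct nodes must be distinct, hence (being blocks of a partition)
  disjoint.\<close>

definition increasing_bilabelled :: "nat set otree \<Rightarrow> bool" where
  "increasing_bilabelled L \<longleftrightarrow>
     (\<forall>A\<in>set (node_labels L). card A = 2) \<and>
     distinct (node_labels L) \<and>
     partition_on {1..2 * num_nodes L} (set (node_labels L)) \<and>
     increasing L"

definition num_bilabellings :: "unit otree \<Rightarrow> nat" where
  "num_bilabellings t = card {L. shape L = t \<and> increasing_bilabelled L}"

definition T_num :: "nat \<Rightarrow> nat" where
  "T_num n = (\<Sum>t | strict_binary t \<and> num_nodes t = n. num_bilabellings t)"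

definition T_gf :: "complex fps" where
  "T_gf = Abs_fps (\<lambda>m. if even m \<and> m > 0 then of_nat (T_num (m div 2)) / fact m else 0)"

definition is_lattice :: "complex set \<Rightarrow> bool" where
  "is_lattice \<Omega> \<longleftrightarrow>
     (\<exists>\<omega>1 \<omega>2. \<omega>1 \<noteq> 0 \<and> \<omega>2 / \<omega>1 \<notin> \<real> \<and>
        \<Omega> = {of_int m * \<omega>1 + of_int n * \<omega>2 | m n. True})"

definition invariant_g2 :: "complex set \<Rightarrow> complex" where
  "invariant_g2 \<Omega> = 60 * (\<Sum>\<^sub>\<infinity>\<omega>\<in>\<Omega> - {0}. 1 / \<omega> ^ 4)"

definition invariant_g3 :: "complex set \<Rightarrow> complex" where
  "invariant_g3 \<Omega> = 140 * (\<Sum>\<^sub>\<infinity>\<omega>\<in>\<Omega> - {0}. 1 / \<omega> ^ 6)"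

definition lattice_wp :: "complex set \<Rightarrow> complex \<Rightarrow> complex" where
  "lattice_wp \<Omega> z = 1 / z ^ 2 + (\<Sum>\<^sub>\<infinity>\<omega>\<in>\<Omega> - {0}. 1 / (z - \<omega>) ^ 2 - 1 / \<omega> ^ 2)"

definition lattice_of_invariants :: "complex \<Rightarrow> complex \<Rightarrow> complex set" where
  "lattice_of_invariants g2 g3 =
     (THE \<Omega>. is_lattice \<Omega> \<and> invariant_g2 \<Omega> = g2 \<and> invariant_g3 \<Omega> = g3)"

definition weierstrass_wp :: "complex \<Rightarrow> complex \<Rightarrow> complex \<Rightarrow> complex" where
  "weierstrass_wp z g2 g3 = lattice_wp (lattice_of_invariants g2 g3) z"

definition lemniscate_const :: real where
  "lemniscate_const = 2 * integral {0..1} (\<lambda>t. 1 / sqrt (1 - t ^ 4))"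

text \<open>On the open unit disc \<open>1 - t ^ 4\<close> has positive real part, so the principal branch is
  holomorphic there.\<close>

definition arc_sl :: "complex \<Rightarrow> complex" where
  "arc_sl s = contour_integral (linepath 0 s) (\<lambda>t. 1 / csqrt (1 - t ^ 4))"

text \<open>The image of the unit disc under \<open>arc_sl\<close> is only a square around the origin;
  the lemniscate sine is the meromorphic continuation of the inverse to the whole plane.
  Nice meromorphy fixes the values at poles (to 0) and at removable singularities, so the
  function is unique.\<close>

definition sl :: "complex \<Rightarrow> complex" where
  "sl = (THE f. f nicely_meromorphic_on UNIV \<and> (\<forall>s\<in>ball 0 1. f (arc_sl s) = s))"

end

theory Submission
  imports Defs
begin

text \<open>
  Removing the root of a tree, whose label consists of the two smallest integers, shows that the
  generating function solves \<open>T'' = 1 + T\<^sup>2\<close> with \<open>T(0) = T'(0) = 0\<close>, and a formal power series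
  is determined by this equation. So it suffices to solve the equation by the two right-hand sides
  near \<open>0\<close>; the identity theorem for meromorphic functions does the rest.

  For the square lattice \<open>\<Omega>\<close> spanned by \<open>w(1 \<plusminus> \<i>)\<close>, Liouville's theorem gives
  \<open>\<wp>'' = 6\<wp>\<^sup>2 - g\<^sub>2/2\<close>, and the symmetry \<open>\<wp>(\<i>z) = -\<wp>(z)\<close> gives \<open>g\<^sub>3 = 0\<close> and
  \<open>\<wp>(w) = \<wp>'(w) = 0\<close>. The quotient \<open>f = -2\<wp>/\<wp>'\<close> then satisfies \<open>f'\<^sup>2 = 1 + g\<^sub>2 f\<^sup>4\<close> and \<open>f(0) = 0\<close>,
  \<open>f'(0) = 1\<close>. Following \<open>f\<close> on the real interval \<open>[0, w/2]\<close> up to its maximum evaluates the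
  lemniscate integral and shows \<open>g\<^sub>2 = -1\<close> for \<open>w = \<varpi>\<close>; for this \<open>w\<close>, \<open>f\<close> is the lemniscate sine. The
  lattice is determined by its invariants because the differential equation is a recursion for the
  Laurent coefficients of \<open>\<wp>\<close> at \<open>0\<close>. The lattice sum for the coefficients is the Taylor
  expansion of \<open>\<wp>\<close> at the half-period \<open>\<varpi>\<close>.
\<close>

subsection \<open>Counting bilabelled trees\<close>

text \<open>Two notions of the statement are given by \<open>THE\<close>, so existence and
  uniqueness both have to be shown: the lattice with invariants -1 and 0, and the nicely meromorphic
  function that inverts \<open>arc_sl\<close>. For the lattice, existence is explicit. The square
  lattice carries a free scale \<open>w\<close>, and for every \<open>w\<close> there is a \<kappa>
  > 0 with g2 = -\<kappa>^4 and \<open>lemniscate_const\<close> = \<kappa> w, so w =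
  \<open>lemniscate_const\<close> forces \<kappa> = 1. That g2 is negative is hard to see on its
  series. It follows from wp(w/2)^2 = -g2/4, the square of a nonzero real number, and this is the
  reason for proving that wp(z) wp(z + w) is constant. The point w is the centre of expansion
  because wp and wp' both vanish there, which are the initial values T(0) = T'(0) = 0; the same two
  zeros fix the constant of integration in wp'^2 = 4 wp^3 - g2 wp. Values at poles are mere
  conventions, so global identities are first obtained on punctured neighbourhoods. They become
  pointwise because one side, a convergent power series or the identity function, has a finite
  limit.\<close>

fun bitree_count :: "nat \<Rightarrow> nat" where
  "bitree_count 0 = 0"
| "bitree_count (Suc 0) = 0"
| "bitree_count (Suc (Suc m)) =
     (if m = 0 then 1 else 0) +
     (\<Sum>j\<le>m. (m choose j) * bitree_count j * bitree_count (m - j))"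

text \<open>The labels come from an arbitrary set rather than from {1..2n}, since the two subtrees
  of a root carry arbitrary complementary subsets of the remaining labels.\<close>

definition bitrees :: "nat set \<Rightarrow> nat set otree set" where
  "bitrees S = {L. strict_binary L \<and> (\<forall>A\<in>set (node_labels L). card A = 2) \<and>
     distinct (node_labels L) \<and> partition_on S (set (node_labels L)) \<and> increasing L}"

lemma node_labels_nonempty [simp]: "node_labels t \<noteq> []"
  by (cases t) auto

lemma label_in_node_labels: "label t \<in> set (node_labels t)"
  by (cases t) auto

text \<open>\<open>increasing\<close> compares a node only with its children. Going down a path by
  transitivity requires an element in every intermediate block, whence the nonemptiness
  hypothesis.\<close>

lemma less_root_imp_less_labels:
  assumes "increasing t" "\<forall>A\<in>set (node_labels t). A \<noteq> {}" "\<forall>b\<in>label t. a < b"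
    and "x \<in> \<Union>(set (node_labels t))"
  shows "a < x"
  using assms
proof (induction t arbitrary: a)
  case (Node A ts)
  show ?case
  proof (cases "x \<in> A")
    case True
    then show ?thesis using Node.prems by auto
  next
    case False
    then obtain t where t: "t \<in> set ts" "x \<in> \<Union>(set (node_labels t))"
      using Node.prems(4) by auto
    obtain c where c: "c \<in> A" using Node.prems(2) by auto
    have "c < x"
      using Node.prems t c by (intro Node.IH[OF t(1)]) auto
    moreover have "a < c" using c Node.prems(3) by auto
    ultimately show ?thesis by simp
  qed
qed

lemma bitrees_leaf: "Node A [] \<in> bitrees S \<longleftrightarrow> A = S \<and> card S = 2"
  by (auto simp: bitrees_def partition_on_def)

lemma partition_on_Un:
  assumes "partition_on A P" "partition_on B Q" "A \<inter> B = {}"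
  shows "partition_on (A \<union> B) (P \<union> Q)"
  using assms disjoint_union[of P Q] by (simp add: partition_on_def)

text \<open>The root block lies below all other labels, so it is the pair of smallest elements of
  \<open>S\<close>. The rest is split freely: \<open>S1\<close> is the union of the blocks of
  \<open>t1\<close>.\<close>

lemma bitrees_node:
  "Node A [t1, t2] \<in> bitrees S \<longleftrightarrow>
     A \<subseteq> S \<and> card A = 2 \<and> (\<forall>a\<in>A. \<forall>s\<in>S - A. a < s) \<and>
     (\<exists>S1\<subseteq>S - A. t1 \<in> bitrees S1 \<and> t2 \<in> bitrees (S - A - S1))" (is "?L \<longleftrightarrow> ?R")
proof
  assume L: ?L
  define N1 N2 where "N1 = set (node_labels t1)" and "N2 = set (node_labels t2)"
  from L have props: "strict_binary t1" "strict_binary t2" "card A = 2"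
    "\<forall>B\<in>N1. card B = 2" "\<forall>B\<in>N2. card B = 2" "distinct (node_labels t1)" "distinct (node_labels t2)"
    "A \<notin> N1" "A \<notin> N2" "N1 \<inter> N2 = {}" "increasing t1" "increasing t2"
    "\<forall>a\<in>A. \<forall>b\<in>label t1. a < b" "\<forall>a\<in>A. \<forall>b\<in>label t2. a < b"
    and part: "partition_on S (insert A (N1 \<union> N2))"
    by (auto simp: bitrees_def N1_def N2_def)
  have ne: "B \<noteq> {}" if "B \<in> N1 \<union> N2" for B
    using part that by (auto simp: partition_on_def)
  have dj: "B \<inter> C = {}" if "B \<in> insert A (N1 \<union> N2)" "C \<in> insert A (N1 \<union> N2)" "B \<noteq> C" for B C
    using disjointD[OF partition_onD2[OF part] that] .
  have S: "S = A \<union> \<Union>N1 \<union> \<Union>N2"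
    using partition_onD1[OF part] by (simp add: Un_assoc)
  have "A \<inter> B = {}" if "B \<in> N1 \<union> N2" for B
    by (rule dj) (use that props(8,9) in auto)
  moreover have "B \<inter> C = {}" if "B \<in> N1" "C \<in> N2" for B C
    by (rule dj) (use that props(10) in auto)
  ultimately have "A \<inter> \<Union>N1 = {}" "A \<inter> \<Union>N2 = {}" "\<Union>N1 \<inter> \<Union>N2 = {}"
    by (simp_all add: Int_Union Int_Union2)
  hence S2: "S - A - \<Union>N1 = \<Union>N2" "\<Union>N1 \<subseteq> S - A" and SA: "S - A = \<Union>N1 \<union> \<Union>N2" using S by blast+
  have p1: "partition_on (\<Union>N1) N1" and p2: "partition_on (\<Union>N2) N2"
    using dj ne unfolding partition_on_def disjoint_def by (metis UnCI insertCI)+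
  have "t1 \<in> bitrees (\<Union>N1)" "t2 \<in> bitrees (\<Union>N2)"
    using props p1 p2 by (auto simp: bitrees_def N1_def N2_def)
  moreover have "a < s" if "a \<in> A" "s \<in> S - A" for a s
    using less_root_imp_less_labels[of t1 a s] less_root_imp_less_labels[of t2 a s]
      that SA props ne by (auto simp: N1_def N2_def)
  ultimately show ?R
    using S props(3) S2 by (metis Un_upper1 Un_assoc)
next
  assume ?R
  then obtain S1 where A: "A \<subseteq> S" "card A = 2" "\<forall>a\<in>A. \<forall>s\<in>S - A. a < s" "S1 \<subseteq> S - A"
    and t: "t1 \<in> bitrees S1" "t2 \<in> bitrees (S - A - S1)" by auto
  define N1 N2 where "N1 = set (node_labels t1)" and "N2 = set (node_labels t2)"
  have p1: "partition_on S1 N1" and p2: "partition_on (S - A - S1) N2"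
    using t by (auto simp: bitrees_def N1_def N2_def)
  have N12: "N1 \<inter> N2 = {}"
  proof -
    have "B = {}" if "B \<in> N1" "B \<in> N2" for B
      using p1 p2 that by (auto simp: partition_on_def)
    moreover have "{} \<notin> N1" using p1 by (auto simp: partition_on_def)
    ultimately show ?thesis by blast
  qed
  have "A \<noteq> {}" using A by auto
  hence AN: "A \<notin> N1" "A \<notin> N2"
    using p1 p2 A unfolding partition_on_def by blast+
  have "partition_on (S1 \<union> (S - A - S1)) (N1 \<union> N2)"
    by (rule partition_on_Un[OF p1 p2]) auto
  hence "partition_on (A \<union> (S1 \<union> (S - A - S1))) ({A} \<union> (N1 \<union> N2))"
    by (rule partition_on_Un[OF partition_on_space[OF \<open>A \<noteq> {}\<close>]]) (use A in auto)
  moreover have "A \<union> (S1 \<union> (S - A - S1)) = S" using A(1,4) by blast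
  ultimately have pS: "partition_on S (insert A (N1 \<union> N2))" by simp
  moreover have "label t1 \<subseteq> S - A" "label t2 \<subseteq> S - A"
    using label_in_node_labels[of t1] label_in_node_labels[of t2] p1 p2 A(4)
    unfolding partition_on_def N1_def N2_def by blast+
  ultimately show ?L
    using A t N12 AN pS unfolding bitrees_def N1_def N2_def by auto
qed

lemma bitree_cases:
  assumes "L \<in> bitrees S"
  obtains A where "L = Node A []" | A t1 t2 where "L = Node A [t1, t2]"
proof -
  obtain A ts where L: "L = Node A ts" by (cases L)
  have "length ts = 0 \<or> length ts = 2"
    using assms L by (auto simp: bitrees_def)
  thus ?thesis
    using that L by (auto simp: numeral_2_eq_2 length_Suc_conv)
qed

lemma ex_two_smallest:
  assumes "finite (S :: nat set)" "card S \<ge> 2"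
  obtains A where "A \<subseteq> S" "card A = 2" "\<forall>a\<in>A. \<forall>s\<in>S - A. a < s"
proof -
  define a where "a = Min S"
  define S' where "S' = S - {a}"
  define b where "b = Min S'"
  have ne: "S \<noteq> {}" using assms by auto
  hence a: "a \<in> S" "\<And>s. s \<in> S \<Longrightarrow> a \<le> s" using assms by (auto simp: a_def)
  hence "card S' \<ge> 1" using assms by (simp add: S'_def)
  hence ne': "S' \<noteq> {}" by auto
  hence b: "b \<in> S'" "\<And>s. s \<in> S' \<Longrightarrow> b \<le> s" using assms Min_in[OF _ ne'] by (auto simp: b_def S'_def)
  show ?thesis
  proof (rule that[of "{a, b}"])
    show "{a, b} \<subseteq> S" "card {a, b} = 2" using a b by (auto simp: S'_def)
    show "\<forall>x\<in>{a, b}. \<forall>s\<in>S - {a, b}. x < s"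
    proof (intro ballI)
      fix x s assume "x \<in> {a, b}" "s \<in> S - {a, b}"
      then show "x < s"
        using a(2)[of s] b(2)[of s] by (auto simp: S'_def)
    qed
  qed
qed

lemma two_smallest_unique:
  assumes "A \<subseteq> S" "card A = 2" "\<forall>a\<in>A. \<forall>s\<in>S - A. a < (s::nat)"
    and "B \<subseteq> S" "card B = 2" "\<forall>a\<in>B. \<forall>s\<in>S - B. a < s"
  shows "A = B"
proof (rule ccontr)
  assume "A \<noteq> B"
  have fin: "finite A" "finite B" using assms by (auto intro: card_ge_0_finite)
  have "\<not> A \<subseteq> B" "\<not> B \<subseteq> A"
    using card_subset_eq[OF fin(2), of A] card_subset_eq[OF fin(1), of B] assms \<open>A \<noteq> B\<close> by auto
  then obtain a b where "a \<in> A - B" "b \<in> B - A" by blast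
  hence "a < b" "b < a" using assms by blast+
  thus False by simp
qed

lemma sum_Pow_card:
  assumes "finite R"
  shows "(\<Sum>X\<in>Pow R. g (card X)) = (\<Sum>j\<le>card R. (card R choose j) * (g j :: nat))"
proof -
  have "(\<Sum>X\<in>Pow R. g (card X)) = (\<Sum>j\<le>card R. \<Sum>X | X \<in> Pow R \<and> card X = j. g (card X))"
    by (rule sum.group[symmetric]) (use assms card_mono in auto)
  also have "\<dots> = (\<Sum>j\<le>card R. (card R choose j) * g j)"
  proof (rule sum.cong)
    fix j
    have "(\<Sum>X | X \<in> Pow R \<and> card X = j. g (card X)) = (\<Sum>X | X \<subseteq> R \<and> card X = j. g j)"
      by (rule sum.cong) auto
    thus "(\<Sum>X | X \<in> Pow R \<and> card X = j. g (card X)) = (card R choose j) * g j"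
      using n_subsets[OF assms, of j] by simp
  qed auto
  finally show ?thesis .
qed

text \<open>The root block is forced, so a tree that is not a leaf amounts to a subset
  \<open>S1\<close> of the remaining labels with a tree on \<open>S1\<close> and one on its
  complement. The number depends on cardinalities only. Finiteness is carried along because the
  cardinality of the dependent sum needs it.\<close>

lemma card_bitrees:
  assumes "finite S"
  shows "finite (bitrees S) \<and> card (bitrees S) = bitree_count (card S)"
  using assms
proof (induction "card S" arbitrary: S rule: less_induct)
  case less
  show ?case
  proof (cases "card S \<ge> 2")
    case False
    have "bitrees S = {}"
    proof (rule ccontr)
      assume "bitrees S \<noteq> {}"
      then obtain L where L: "L \<in> bitrees S" by auto
      have "card S \<ge> 2"
        using L
      proof (cases rule: bitree_cases)
        case (1 A)
        then show ?thesis using L bitrees_leaf by auto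
      next
        case (2 A t1 t2)
        hence "A \<subseteq> S" "card A = 2" using L bitrees_node by auto
        then show ?thesis using card_mono[OF less.prems, of A] by simp
      qed
      thus False using False by simp
    qed
    moreover have "card S = 0 \<or> card S = Suc 0" using False by linarith
    ultimately show ?thesis by (elim disjE; simp)
  next
    case True
    then obtain A where A: "A \<subseteq> S" "card A = 2" "\<forall>a\<in>A. \<forall>s\<in>S - A. a < s"
      using ex_two_smallest less.prems by blast
    define R where "R = S - A"
    define m where "m = card S - 2"
    have m: "card S = Suc (Suc m)" using True by (simp add: m_def)
    have R: "finite R" "card R = m" using less.prems A
      by (auto simp: R_def m_def card_Diff_subset finite_subset)
    define X where "X = (SIGMA S1:Pow R. bitrees S1 \<times> bitrees (R - S1))"
    define leafs where "leafs = (if m = 0 then {Node S []} else {})"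
    define nd where "nd = (\<lambda>(S1 :: nat set, t1, t2). Node A [t1, t2])"
    have IH: "finite (bitrees S1)" "card (bitrees S1) = bitree_count (card S1)"
      if "S1 \<subseteq> R" for S1
    proof -
      have "card S1 \<le> card R" by (rule card_mono[OF R(1) that])
      hence "card S1 < card S" using R m by simp
      moreover have "finite S1" using that R finite_subset by auto
      ultimately show "finite (bitrees S1)" "card (bitrees S1) = bitree_count (card S1)"
        using less.hyps by blast+
    qed
    have finX: "finite X" unfolding X_def
      by (intro finite_SigmaI) (use R IH in auto)
    have eq: "bitrees S = leafs \<union> nd ` X"
    proof (intro equalityI subsetI)
      fix L assume L: "L \<in> bitrees S"
      thus "L \<in> leafs \<union> nd ` X"
      proof (cases rule: bitree_cases)
        case (1 A')
        then show ?thesis using L bitrees_leaf m by (auto simp: leafs_def)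
      next
        case (2 A' t1 t2)
        with L obtain S1 where *: "A' \<subseteq> S" "card A' = 2" "\<forall>a\<in>A'. \<forall>s\<in>S - A'. a < s"
          "S1 \<subseteq> S - A'" "t1 \<in> bitrees S1" "t2 \<in> bitrees (S - A' - S1)"
          by (auto simp: bitrees_node)
        have "A' = A" by (rule two_smallest_unique[OF *(1-3) A])
        hence "(S1, t1, t2) \<in> X" "L = nd (S1, t1, t2)"
          using * 2 by (auto simp: X_def R_def nd_def)
        thus ?thesis by blast
      qed
    next
      fix L assume "L \<in> leafs \<union> nd ` X"
      thus "L \<in> bitrees S"
      proof
        assume "L \<in> leafs"
        thus ?thesis using m by (auto simp: leafs_def bitrees_leaf split: if_splits)
      next
        assume "L \<in> nd ` X"
        then obtain S1 t1 t2 where "S1 \<subseteq> R" "t1 \<in> bitrees S1" "t2 \<in> bitrees (R - S1)"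
          "L = Node A [t1, t2]" by (auto simp: X_def nd_def)
        thus ?thesis using A unfolding R_def by (metis bitrees_node)
      qed
    qed
    \<comment> \<open>The component \<open>S1\<close> is not stored in the node; it is recovered as
      the union of the labels of \<open>t1\<close>.\<close>
    have "inj_on nd X"
    proof (rule inj_onI)
      fix x y assume xy: "x \<in> X" "y \<in> X" "nd x = nd y"
      obtain S1 t1 t2 S1' where x: "x = (S1, t1, t2)" "y = (S1', t1, t2)"
        using xy(3) by (cases x; cases y) (auto simp: nd_def)
      have "t1 \<in> bitrees S1" "t1 \<in> bitrees S1'" using xy x by (auto simp: X_def)
      hence "S1 = S1'" by (simp add: bitrees_def partition_on_def)
      thus "x = y" using x by simp
    qed
    hence "card (nd ` X) = card X" by (rule card_image)
    also have "card X = (\<Sum>S1\<in>Pow R. card (bitrees S1 \<times> bitrees (R - S1)))"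
      unfolding X_def by (rule card_SigmaI) (use R IH in auto)
    also have "\<dots> = (\<Sum>S1\<in>Pow R. bitree_count (card S1) * bitree_count (m - card S1))"
    proof (rule sum.cong)
      fix S1 assume "S1 \<in> Pow R"
      hence S1: "S1 \<subseteq> R" by simp
      have "card (R - S1) = m - card S1"
        using S1 R by (simp add: card_Diff_subset finite_subset)
      thus "card (bitrees S1 \<times> bitrees (R - S1)) = bitree_count (card S1) * bitree_count (m - card S1)"
        using IH(2)[OF S1] IH(2)[of "R - S1"] by (simp add: card_cartesian_product)
    qed simp
    also have "\<dots> = (\<Sum>j\<le>m. (m choose j) * bitree_count j * bitree_count (m - j))"
      using sum_Pow_card[OF R(1), of "\<lambda>j. bitree_count j * bitree_count (m - j)"] R(2)
      by (simp add: mult.assoc)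
    finally have c: "card (nd ` X) = \<dots>" .
    have "leafs \<inter> nd ` X = {}" by (auto simp: leafs_def nd_def)
    hence "card (bitrees S) = card leafs + card (nd ` X)"
      unfolding eq by (intro card_Un_disjoint) (use finX in \<open>auto simp: leafs_def\<close>)
    also have "card leafs = (if m = 0 then 1 else 0)" by (simp add: leafs_def)
    finally have "card (bitrees S) = bitree_count (card S)" using c m by simp
    moreover have "finite (bitrees S)" unfolding eq using finX by (auto simp: leafs_def)
    ultimately show ?thesis by simp
  qed
qed

text \<open>If \<open>m\<close> is odd, then one of \<open>j\<close> and \<open>m - j\<close> is
  odd, so every summand has a vanishing factor.\<close>

lemma bitree_count_odd: "odd m \<Longrightarrow> bitree_count m = 0"
proof (induction m rule: bitree_count.induct)
  case (3 m)
  have "(m choose j) * bitree_count j * bitree_count (m - j) = 0" if "j \<le> m" for j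
  proof (cases "odd j")
    case True
    then show ?thesis using 3 that by simp
  next
    case False
    hence "odd (m - j)" using 3(3) that by auto
    then show ?thesis using 3(2)[of j] that by simp
  qed
  moreover have "m \<noteq> 0" using 3(3) by (intro notI) simp
  ultimately show ?case by simp
qed auto

text \<open>\<open>T_num\<close> is a sum over all shapes with n nodes, and a sum over an infinite
  set would be 0 by convention.\<close>

lemma finite_strict_binary:
  "finite {t :: unit otree. strict_binary t \<and> num_nodes t \<le> n}"
proof (induction n)
  case 0
  have "{t :: unit otree. strict_binary t \<and> num_nodes t \<le> 0} = {}" by (auto simp: num_nodes_def)
  then show ?case by (metis finite.emptyI)
next
  case (Suc n)
  let ?F = "{t :: unit otree. strict_binary t \<and> num_nodes t \<le> n}"
  have "{t :: unit otree. strict_binary t \<and> num_nodes t \<le> Suc n} \<subseteq>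
          insert (Node () []) ((\<lambda>(t1, t2). Node () [t1, t2]) ` (?F \<times> ?F))"
  proof
    fix t :: "unit otree" assume t: "t \<in> {t. strict_binary t \<and> num_nodes t \<le> Suc n}"
    obtain ts where ts: "t = Node () ts" by (cases t) auto
    have "length ts = 0 \<or> length ts = 2" using t ts by auto
    then consider "ts = []" | t1 t2 where "ts = [t1, t2]"
      by (auto simp: numeral_2_eq_2 length_Suc_conv)
    thus "t \<in> insert (Node () []) ((\<lambda>(t1, t2). Node () [t1, t2]) ` (?F \<times> ?F))"
    proof cases
      case 1
      then show ?thesis using ts by simp
    next
      case (2 t1 t2)
      hence "(t1, t2) \<in> ?F \<times> ?F" using t ts by (auto simp: num_nodes_def)
      then show ?thesis using ts 2 by auto
    qed
  qed
  thus ?case by (rule finite_subset) (use Suc in auto)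
qed

lemma node_labels_map: "node_labels (map_otree f t) = map f (node_labels t)"
  by (induction t) (auto simp: map_concat intro!: arg_cong[of _ _ concat])

lemma num_nodes_shape [simp]: "num_nodes (shape t) = num_nodes t"
  by (simp add: num_nodes_def shape_def node_labels_map)

lemma strict_binary_shape [simp]: "strict_binary (shape t) \<longleftrightarrow> strict_binary t"
  unfolding shape_def by (induction t) auto

text \<open>Bilabelled trees on {1..2n} are grouped by shape. The number of nodes need not be
  prescribed: blocks of size two partitioning 2n labels are n in number.\<close>

lemma T_num_eq_bitree_count: "T_num n = bitree_count (2 * n)"
proof -
  let ?I = "{t :: unit otree. strict_binary t \<and> num_nodes t = n}"
  let ?A = "\<lambda>t. {L. shape L = t \<and> increasing_bilabelled L}"
  have fI: "finite ?I" by (rule finite_subset[OF _ finite_strict_binary[of n]]) auto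
  have "num_nodes L = n" if L: "L \<in> bitrees {1..2 * n}" for L
  proof -
    have p: "partition_on {1..2*n} (set (node_labels L))" and
         c: "\<forall>A\<in>set (node_labels L). card A = 2" and d: "distinct (node_labels L)"
      using L by (auto simp: bitrees_def)
    have "card (\<Union>(set (node_labels L))) = (\<Sum>A\<in>set (node_labels L). card A)"
      by (rule card_Union_disjoint)
         (use p c in \<open>auto simp: partition_on_def disjoint_def disjnt_def pairwise_def intro: card_ge_0_finite\<close>)
    also have "\<dots> = 2 * length (node_labels L)"
      using c distinct_card[OF d] by simp
    also have "\<Union>(set (node_labels L)) = {1..2*n}"
      using p by (auto simp: partition_on_def)
    finally show ?thesis by (simp add: num_nodes_def)
  qed
  hence "L \<in> bitrees {1..2 * n} \<longleftrightarrow> strict_binary L \<and> num_nodes L = n \<and> increasing_bilabelled L" for L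
    by (simp add: bitrees_def increasing_bilabelled_def) metis
  hence U: "bitrees {1..2 * n} = (\<Union>t\<in>?I. ?A t)"
    by (simp add: set_eq_iff)
  have fin: "finite (bitrees {1..2 * n})" using card_bitrees[of "{1..2 * n}"] by simp
  have "card (\<Union>t\<in>?I. ?A t) = (\<Sum>t\<in>?I. card (?A t))"
  proof (rule card_UN_disjoint)
    show "\<forall>t\<in>?I. finite (?A t)" using fin unfolding U by (simp add: finite_UN[OF fI])
  qed (use fI in auto)
  thus ?thesis
    using card_bitrees[of "{1..2*n}"] unfolding U
    by (simp add: T_num_def num_bilabellings_def)
qed

lemma T_num_1: "T_num 1 = 1"
  by (simp add: T_num_eq_bitree_count numeral_2_eq_2)

lemma T_num_rec:
  assumes "n \<ge> 2"
  shows "T_num n = (\<Sum>k = 1..n - 2. ((2 * n - 2) choose (2 * k)) * T_num k * T_num (n - 1 - k))"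
proof -
  define m where "m = n - 1"
  have n: "n = Suc m" "m \<ge> 1" using assms by (auto simp: m_def)
  let ?f = "\<lambda>j. ((2 * m) choose j) * bitree_count j * bitree_count (2 * m - j)"
  have "T_num n = (\<Sum>j\<le>2 * m. ?f j)"
    using n by (simp add: T_num_eq_bitree_count)
  \<comment> \<open>Odd indices vanish by parity, and j = 0 and j = 2m vanish because
    \<open>bitree_count 0 = 0\<close>; this leaves j = 2k with k from 1 to m - 1 = n - 2.\<close>
  also have "\<dots> = (\<Sum>j\<in>(*) 2 ` {1..m - 1}. ?f j)"
  proof (rule sum.mono_neutral_right)
    show "\<forall>j\<in>{..2 * m} - (*) 2 ` {1..m - 1}. ?f j = 0"
    proof
      fix j assume j: "j \<in> {..2 * m} - (*) 2 ` {1..m - 1}"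
      show "?f j = 0"
      proof (cases "even j")
        case True
        then obtain k where k: "j = 2 * k" by auto
        have "k = 0 \<or> k = m" using j k by force
        then show ?thesis using k by auto
      qed (simp add: bitree_count_odd)
    qed
  qed auto
  also have "\<dots> = (\<Sum>k = 1..m - 1. ?f (2 * k))"
    by (subst sum.reindex) (auto intro: inj_onI)
  also have "\<dots> = (\<Sum>k = 1..n - 2. ((2 * n - 2) choose (2 * k)) * T_num k * T_num (n - 1 - k))"
    using n by (intro sum.cong) (auto simp: T_num_eq_bitree_count diff_mult_distrib2)
  finally show ?thesis .
qed

section \<open>The generating function as a formal power series\<close>

lemma T_gf_nth: "fps_nth T_gf m = of_nat (bitree_count m) / fact m"
proof (cases "even m")
  case True
  then show ?thesis by (auto simp: T_gf_def T_num_eq_bitree_count)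
next
  case False
  then show ?thesis by (simp add: T_gf_def bitree_count_odd)
qed

text \<open>Dividing the recursion by m! splits the binomial coefficient into 1/j! and 1/(m-j)!, so
  the sum is a Cauchy product. The leaf gives the constant 1.\<close>

lemma T_gf_ode: "fps_deriv (fps_deriv T_gf) = 1 + T_gf ^ 2"
proof (rule fps_ext)
  fix m
  have *: "of_nat ((m choose j) * bitree_count j * bitree_count (m - j)) / fact m =
      fps_nth T_gf j * fps_nth T_gf (m - j)" if "j \<le> m" for j
    using that by (simp add: T_gf_nth binomial_fact field_simps)
  have "fps_nth (fps_deriv (fps_deriv T_gf)) m = of_nat (bitree_count (Suc (Suc m))) / fact m"
    by (simp add: T_gf_nth field_simps del: of_nat_Suc bitree_count.simps)
  also have "\<dots> = (if m = 0 then 1 else 0) +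
     (\<Sum>j\<le>m. of_nat ((m choose j) * bitree_count j * bitree_count (m - j)) / fact m)"
    by (simp add: sum_divide_distrib)
  also have "(\<Sum>j\<le>m. of_nat ((m choose j) * bitree_count j * bitree_count (m - j)) / (fact m::complex)) =
      (\<Sum>j\<le>m. fps_nth T_gf j * fps_nth T_gf (m - j))"
    using * by (intro sum.cong) auto
  finally show "fps_nth (fps_deriv (fps_deriv T_gf)) m = fps_nth (1 + T_gf ^ 2) m"
    by (simp add: power2_eq_square fps_mult_nth atLeast0AtMost)
qed

lemma fps_ode_unique:
  fixes F :: "complex fps"
  assumes "fps_deriv (fps_deriv F) = 1 + F ^ 2" "fps_nth F 0 = 0" "fps_nth F 1 = 0"
  shows "F = T_gf"
proof (rule fps_ext)
  fix n show "fps_nth F n = fps_nth T_gf n"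
  \<comment> \<open>This rule has the shape of the equation: two initial coefficients, and index m +
    2 determined by all indices up to m.\<close>
  proof (induction n rule: bitree_count.induct)
    case (3 m)
    have eq: "of_nat (Suc (Suc m)) * of_nat (Suc m) * fps_nth G (Suc (Suc m)) =
          (if m = 0 then 1 else 0) + (\<Sum>j\<le>m. fps_nth G j * fps_nth G (m - j))"
      if "fps_deriv (fps_deriv G) = 1 + G ^ 2" for G :: "complex fps"
    proof -
      have "fps_nth (fps_deriv (fps_deriv G)) m = fps_nth (1 + G ^ 2) m" using that by simp
      thus ?thesis by (simp add: power2_eq_square fps_mult_nth atLeast0AtMost algebra_simps)
    qed
    have "(\<Sum>j\<le>m. fps_nth F j * fps_nth F (m - j)) = (\<Sum>j\<le>m. fps_nth T_gf j * fps_nth T_gf (m - j))"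
      using 3 by (intro sum.cong) auto
    hence "of_nat (Suc (Suc m)) * of_nat (Suc m) * fps_nth F (Suc (Suc m)) =
           of_nat (Suc (Suc m)) * of_nat (Suc m) * fps_nth T_gf (Suc (Suc m))"
      using eq[OF assms(1)] eq[OF T_gf_ode] by metis
    thus ?case by (simp del: of_nat_Suc)
  qed (use assms in \<open>auto simp: T_gf_nth\<close>)
qed

subsection \<open>Lattice sums\<close>

text \<open>The majorant makes the finite partial sums converge uniformly on the disc, and for
  holomorphic functions uniform convergence passes to the derivatives. A bound on \<open>f i\<close>
  itself is therefore what is asked for.\<close>

lemma has_field_derivative_infsum:
  fixes f :: "'i \<Rightarrow> complex \<Rightarrow> complex"
  assumes r: "r > 0"
    and deriv: "\<And>i w. i \<in> A \<Longrightarrow> w \<in> cball z r \<Longrightarrow> (f i has_field_derivative f' i w) (at w)"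
    and le: "\<And>i w. i \<in> A \<Longrightarrow> w \<in> cball z r \<Longrightarrow> norm (f i w) \<le> M i"
    and M: "M summable_on A"
  shows "((\<lambda>w. \<Sum>\<^sub>\<infinity>i\<in>A. f i w) has_field_derivative (\<Sum>\<^sub>\<infinity>i\<in>A. f' i z)) (at z)"
proof -
  let ?F = "finite_subsets_at_top A"
  have ul: "uniform_limit (cball z r) (\<lambda>X w. \<Sum>i\<in>X. f i w) (\<lambda>w. \<Sum>\<^sub>\<infinity>i\<in>A. f i w) ?F"
    by (rule Weierstrass_m_test_general[OF le M])
  have ev: "eventually (\<lambda>X. continuous_on (cball z r) (\<lambda>w. \<Sum>i\<in>X. f i w) \<and>
      (\<forall>w\<in>ball z r. ((\<lambda>w. \<Sum>i\<in>X. f i w) has_field_derivative (\<Sum>i\<in>X. f' i w)) (at w))) ?F"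
  proof (rule eventually_finite_subsets_at_top_weakI)
    fix X assume X: "finite X" "X \<subseteq> A"
    have D: "((\<lambda>w. \<Sum>i\<in>X. f i w) has_field_derivative (\<Sum>i\<in>X. f' i w)) (at w)"
      if "w \<in> cball z r" for w
      by (rule DERIV_sum) (use deriv X that in auto)
    have "continuous_on (cball z r) (\<lambda>w. \<Sum>i\<in>X. f i w)"
      by (rule DERIV_continuous_on) (use D in \<open>blast intro: has_field_derivative_at_within\<close>)
    with D show "continuous_on (cball z r) (\<lambda>w. \<Sum>i\<in>X. f i w) \<and>
      (\<forall>w\<in>ball z r. ((\<lambda>w. \<Sum>i\<in>X. f i w) has_field_derivative (\<Sum>i\<in>X. f' i w)) (at w))"
      by auto
  qed
  obtain g' where g': "\<And>w. w \<in> ball z r \<Longrightarrow> ((\<lambda>w. \<Sum>\<^sub>\<infinity>i\<in>A. f i w) has_field_derivative g' w) (at w) \<and>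
      ((\<lambda>X. \<Sum>i\<in>X. f' i w) \<longlongrightarrow> g' w) ?F"
    by (rule has_complex_derivative_uniform_limit[OF ev ul]) (use r in auto)
  have "z \<in> ball z r" using r by simp
  note g'[OF this]
  moreover from this have "(\<Sum>\<^sub>\<infinity>i\<in>A. f' i z) = g' z"
    by (intro infsumI) (simp add: has_sum_def)
  ultimately show ?thesis by simp
qed

lemma has_field_derivative_inverse_power:
  assumes "w \<noteq> (a :: complex)"
  shows "((\<lambda>w. 1 / (w - a) ^ k) has_field_derivative - of_nat k * (1 / (w - a) ^ Suc k)) (at w)"
proof -
  have "((\<lambda>y. 1 / y ^ k) has_field_derivative - of_nat k * (1 / y ^ Suc k)) (at y)"
    if "y \<noteq> 0" for y :: complex
  proof (cases k)
    case (Suc j)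
    then show ?thesis
      using that by (auto intro!: derivative_eq_intros simp: field_simps) (cases j; simp)
  qed auto
  from this[of "w - a"] have "((\<lambda>y. 1 / y ^ k) has_field_derivative - of_nat k * (1 / (w - a) ^ Suc k)) (at (w - a))"
    using assms by simp
  moreover have "((\<lambda>w. w - a) has_field_derivative 1) (at w)" by (auto intro!: derivative_eq_intros)
  ultimately show ?thesis using DERIV_chain2[of "\<lambda>y. 1 / y ^ k" _ "\<lambda>w. w - a" w 1 UNIV] by simp
qed

text \<open>The exponent is half of the cubic decay of the lattice sums: by max(M, N) >= sqrt(M N) a
  cubic bound factorises into two one-dimensional sums of exponent 3/2 > 1.\<close>

lemma summable_on_int_powr:
  "(\<lambda>m::int. (1 + \<bar>real_of_int m\<bar>) powr (-3/2)) summable_on UNIV"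
proof -
  let ?g = "\<lambda>m::int. (1 + \<bar>real_of_int m\<bar>) powr (-3/2)"
  have "summable (\<lambda>n. real (n + 1) powr (-3/2))"
    by (subst summable_iff_shift) (simp add: summable_real_powr_iff)
  hence s: "(\<lambda>n::nat. real (n + 1) powr (-3/2)) summable_on UNIV"
    by (subst summable_on_UNIV_nonneg_real_iff) auto
  have "summable (\<lambda>n. real (n + 2) powr (-3/2))"
    by (subst summable_iff_shift) (simp add: summable_real_powr_iff)
  hence s2: "(\<lambda>n::nat. real (n + 2) powr (-3/2)) summable_on UNIV"
    by (subst summable_on_UNIV_nonneg_real_iff) auto
  have "?g summable_on (int ` UNIV)"
    by (subst summable_on_reindex) (use s in \<open>auto simp: o_def add_ac\<close>)
  moreover have "?g summable_on ((\<lambda>n. - int (Suc n)) ` UNIV)"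
    by (subst summable_on_reindex) (use s2 in \<open>auto simp: o_def add_ac inj_def\<close>)
  ultimately have "?g summable_on (int ` UNIV \<union> (\<lambda>n. - int (Suc n)) ` UNIV)"
    by (rule summable_on_Un_disjoint) auto
  moreover have "m \<in> int ` UNIV \<union> (\<lambda>n. - int (Suc n)) ` UNIV" for m :: int
    by (cases m) auto
  hence "int ` UNIV \<union> (\<lambda>n. - int (Suc n)) ` UNIV = UNIV" by blast
  ultimately show ?thesis by simp
qed

lemma summable_on_int_pair_powr:
  "(\<lambda>(m::int, n::int). (1 + \<bar>real_of_int m\<bar>) powr (-3/2) * (1 + \<bar>real_of_int n\<bar>) powr (-3/2))
     summable_on UNIV"
proof -
  let ?g = "\<lambda>m::int. (1 + \<bar>real_of_int m\<bar>) powr (-3/2)"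
  have "(\<lambda>(m, n). ?g m * ?g n) summable_on (UNIV \<times> UNIV)"
  proof (rule summable_on_SigmaI[where g = "\<lambda>m. ?g m * infsum ?g UNIV"])
    show "((\<lambda>y. case (x, y) of (m, n) \<Rightarrow> ?g m * ?g n) has_sum ?g x * infsum ?g UNIV) UNIV" for x
      using summable_on_int_powr by (auto intro!: has_sum_cmult_right)
    show "(\<lambda>m. ?g m * infsum ?g UNIV) summable_on UNIV"
      by (intro summable_on_cmult_left summable_on_int_powr)
  qed auto
  thus ?thesis by simp
qed

section \<open>Geometry of a lattice and majorants for sums over it\<close>

locale complex_lattice =
  fixes \<omega>1 \<omega>2 :: complex and \<Omega> :: "complex set"
  assumes nz1: "\<omega>1 \<noteq> 0" and indep: "\<omega>2 / \<omega>1 \<notin> \<real>"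
    and \<Omega>_eq: "\<Omega> = {of_int m * \<omega>1 + of_int n * \<omega>2 | m n. True}"
begin

definition pt :: "int \<times> int \<Rightarrow> complex" where
  "pt = (\<lambda>(m, n). of_int m * \<omega>1 + of_int n * \<omega>2)"

lemma \<Omega>_range: "\<Omega> = range pt"
  unfolding \<Omega>_eq pt_def by auto

lemma pt_in [simp]: "pt x \<in> \<Omega>" by (simp add: \<Omega>_range)

text \<open>With \<tau> = \<omega>2/\<omega>1, the imaginary part of m + n\<tau> controls n because
  Im \<tau> is nonzero, and then m is controlled after subtracting n\<tau>. The constant
  \<open>K\<close> adds up the two bounds.\<close>

lemma pt_bound:
  obtains c where "c > 0" "\<And>m n. norm (pt (m, n)) \<ge> c * max \<bar>real_of_int m\<bar> \<bar>real_of_int n\<bar>"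
proof -
  define \<tau> where "\<tau> = \<omega>2 / \<omega>1"
  have Im: "Im \<tau> \<noteq> 0" using indep by (simp add: \<tau>_def complex_is_Real_iff)
  define K where "K = 1 + norm \<tau> / \<bar>Im \<tau>\<bar> + 1 / \<bar>Im \<tau>\<bar>"
  have K: "K > 0" unfolding K_def by (intro add_pos_nonneg) auto
  show ?thesis
  proof (rule that[of "norm \<omega>1 / K"])
    show "norm \<omega>1 / K > 0" using nz1 K by simp
    fix m n :: int
    define N where "N = norm (of_int m + of_int n * \<tau>)"
    have "pt (m, n) = \<omega>1 * (of_int m + of_int n * \<tau>)"
      using nz1 by (simp add: pt_def \<tau>_def field_simps)
    hence pt: "norm (pt (m, n)) = norm \<omega>1 * N" by (simp add: norm_mult N_def)
    have "\<bar>real_of_int n\<bar> * \<bar>Im \<tau>\<bar> = \<bar>Im (of_int m + of_int n * \<tau>)\<bar>" by (simp add: abs_mult)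
    also have "\<dots> \<le> N" unfolding N_def by (rule abs_Im_le_cmod)
    finally have n: "\<bar>real_of_int n\<bar> \<le> N / \<bar>Im \<tau>\<bar>" using Im by (simp add: field_simps)
    have "\<bar>real_of_int m\<bar> = norm ((of_int m + of_int n * \<tau>) - of_int n * \<tau>)" by simp
    also have "\<dots> \<le> N + norm (of_int n * \<tau>)" unfolding N_def by (rule norm_triangle_ineq4)
    also have "\<dots> = N + \<bar>real_of_int n\<bar> * norm \<tau>" by (simp add: norm_mult)
    also have "\<dots> \<le> N + N / \<bar>Im \<tau>\<bar> * norm \<tau>" using n by (intro add_left_mono mult_right_mono) auto
    finally have m: "\<bar>real_of_int m\<bar> \<le> N + N / \<bar>Im \<tau>\<bar> * norm \<tau>" .
    have N0: "N \<ge> 0" by (simp add: N_def)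
    have "max \<bar>real_of_int m\<bar> \<bar>real_of_int n\<bar> \<le> N * K"
      using m n N0 by (auto simp: K_def algebra_simps intro: add_increasing add_increasing2)
    hence "max \<bar>real_of_int m\<bar> \<bar>real_of_int n\<bar> / K \<le> N" using K by (simp add: field_simps)
    hence "norm \<omega>1 * (max \<bar>real_of_int m\<bar> \<bar>real_of_int n\<bar> / K) \<le> norm \<omega>1 * N"
      by (intro mult_left_mono) auto
    thus "norm \<omega>1 / K * max \<bar>real_of_int m\<bar> \<bar>real_of_int n\<bar> \<le> norm (pt (m, n))"
      by (simp add: pt)
  qed
qed

lemma inj_pt: "inj pt"
proof (rule injI)
  fix x y assume eq: "pt x = pt y"
  obtain c where c: "c > 0" "\<And>m n. norm (pt (m, n)) \<ge> c * max \<bar>real_of_int m\<bar> \<bar>real_of_int n\<bar>"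
    by (rule pt_bound) blast
  have "pt (fst x - fst y, snd x - snd y) = pt x - pt y"
    by (simp add: pt_def case_prod_beta algebra_simps)
  hence "c * max \<bar>real_of_int (fst x - fst y)\<bar> \<bar>real_of_int (snd x - snd y)\<bar> \<le> 0"
    using c(2)[of "fst x - fst y" "snd x - snd y"] eq by simp
  hence "max \<bar>real_of_int (fst x - fst y)\<bar> \<bar>real_of_int (snd x - snd y)\<bar> \<le> 0"
    using c(1) by (simp add: mult_le_0_iff)
  thus "x = y" by (simp add: prod_eq_iff)
qed

lemma zero_in [simp, intro]: "0 \<in> \<Omega>"
  using pt_in[of "(0, 0)"] by (simp add: pt_def)

lemma basis_in [simp, intro]: "\<omega>1 \<in> \<Omega>" "\<omega>2 \<in> \<Omega>"
  using pt_in[of "(1, 0)"] pt_in[of "(0, 1)"] by (simp_all add: pt_def)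

lemma add_in [intro]: "a \<in> \<Omega> \<Longrightarrow> b \<in> \<Omega> \<Longrightarrow> a + b \<in> \<Omega>"
proof -
  assume "a \<in> \<Omega>" "b \<in> \<Omega>"
  then obtain x y where "a = pt x" "b = pt y" by (auto simp: \<Omega>_range)
  hence "a + b = pt (fst x + fst y, snd x + snd y)"
    by (simp add: pt_def case_prod_beta algebra_simps)
  thus ?thesis by simp
qed

lemma uminus_in [intro]: "a \<in> \<Omega> \<Longrightarrow> - a \<in> \<Omega>"
proof -
  assume "a \<in> \<Omega>"
  then obtain x where "a = pt x" by (auto simp: \<Omega>_range)
  hence "- a = pt (- fst x, - snd x)"
    by (simp add: pt_def case_prod_beta algebra_simps)
  thus ?thesis by simp
qed

lemma uminus_in_iff [simp]: "- a \<in> \<Omega> \<longleftrightarrow> a \<in> \<Omega>"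
  using uminus_in[of a] uminus_in[of "-a"] by auto

lemma diff_in [intro]: "a \<in> \<Omega> \<Longrightarrow> b \<in> \<Omega> \<Longrightarrow> a - b \<in> \<Omega>"
  using add_in[of a "-b"] by auto

lemma add_in_iff: "b \<in> \<Omega> \<Longrightarrow> a + b \<in> \<Omega> \<longleftrightarrow> a \<in> \<Omega>"
  using diff_in[of "a + b" b] by auto

lemma countable_\<Omega>: "countable \<Omega>"
  unfolding \<Omega>_range by simp

lemma finite_bounded: "finite {\<omega>\<in>\<Omega>. norm \<omega> \<le> B}"
proof -
  obtain c where c: "c > 0" "\<And>m n. norm (pt (m, n)) \<ge> c * max \<bar>real_of_int m\<bar> \<bar>real_of_int n\<bar>"
    by (rule pt_bound) blast
  define N where "N = \<lceil>B / c\<rceil>"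
  have "{\<omega>\<in>\<Omega>. norm \<omega> \<le> B} \<subseteq> pt ` ({-N..N} \<times> {-N..N})"
  proof
    fix \<omega> assume "\<omega> \<in> {\<omega>\<in>\<Omega>. norm \<omega> \<le> B}"
    then obtain m n where mn: "\<omega> = pt (m, n)" "norm (pt (m, n)) \<le> B" by (auto simp: \<Omega>_range)
    have "c * max \<bar>real_of_int m\<bar> \<bar>real_of_int n\<bar> \<le> B" using c(2)[of m n] mn(2) by simp
    hence "max \<bar>real_of_int m\<bar> \<bar>real_of_int n\<bar> \<le> B / c"
      using c(1) by (simp add: pos_le_divide_eq mult.commute del: max.bounded_iff)
    hence "\<bar>real_of_int m\<bar> \<le> real_of_int N" "\<bar>real_of_int n\<bar> \<le> real_of_int N"
      unfolding N_def by linarith+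
    hence "\<bar>m\<bar> \<le> N" "\<bar>n\<bar> \<le> N" by linarith+
    thus "\<omega> \<in> pt ` ({-N..N} \<times> {-N..N})"
      using mn by (intro image_eqI[of _ _ "(m, n)"]) auto
  qed
  thus ?thesis by (rule finite_subset) auto
qed

text \<open>The finitely many points of \<open>A\<close> near \<open>z\<close> stay at a positive
  distance; for far points the distance grows like the norm. A bound proportional to 1 + |\<omega>|,
  uniform in \<open>w\<close>, is what yields the majorants of all the series below.\<close>

lemma dist_lower_bound:
  assumes "A \<subseteq> \<Omega>" "z \<notin> A"
  obtains r C where "r > 0" "r \<le> 1" "C > 0"
    "\<And>w \<omega>. w \<in> cball z r \<Longrightarrow> \<omega> \<in> A \<Longrightarrow> norm (w - \<omega>) \<ge> C * (1 + norm \<omega>)"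
proof -
  \<comment> \<open>Chosen so that |\<omega>| > B and |w| <= |z| + 1 give |\<omega>| - |w| >= (1 +
    |\<omega>|)/2.\<close>
  define B where "B = 2 * norm z + 3"
  have "finite {\<omega>\<in>A. norm \<omega> \<le> B}" by (rule finite_subset[OF _ finite_bounded[of B]]) (use assms in auto)
  from finite_set_avoid[OF this, of z] obtain \<delta> where
    \<delta>: "\<delta> > 0" "\<And>\<omega>. \<omega> \<in> A \<Longrightarrow> norm \<omega> \<le> B \<Longrightarrow> \<delta> \<le> dist z \<omega>"
    using assms(2) by fastforce
  have B: "B \<ge> 3" by (simp add: B_def)
  show ?thesis
  proof (rule that[of "min 1 (\<delta> / 2)" "min (1 / 2) (\<delta> / (2 * (1 + B)))"])
    show "min 1 (\<delta> / 2) > 0" "min 1 (\<delta> / 2) \<le> 1" using \<delta> by auto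
    show "min (1 / 2) (\<delta> / (2 * (1 + B))) > 0" using \<delta> B by simp
    fix w \<omega> assume w: "w \<in> cball z (min 1 (\<delta> / 2))" and \<omega>: "\<omega> \<in> A"
    have wz: "norm (z - w) \<le> 1" "norm (z - w) \<le> \<delta> / 2" using w by (auto simp: dist_norm)
    show "min (1 / 2) (\<delta> / (2 * (1 + B))) * (1 + norm \<omega>) \<le> norm (w - \<omega>)"
    proof (cases "norm \<omega> \<le> B")
      case True
      have "norm (z - \<omega>) \<le> norm (z - w) + norm (w - \<omega>)"
        using norm_triangle_ineq[of "z - w" "w - \<omega>"] by simp
      hence "norm (w - \<omega>) \<ge> \<delta> / 2" using \<delta>(2)[OF \<omega> True] wz by (simp add: dist_norm)
      moreover have "min (1 / 2) (\<delta> / (2 * (1 + B))) * (1 + norm \<omega>) \<le> \<delta> / (2 * (1 + B)) * (1 + B)"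
        using True \<delta>(1) B by (intro mult_mono) auto
      moreover have "\<delta> / (2 * (1 + B)) * (1 + B) = \<delta> / 2" using B by (simp add: field_simps)
      ultimately show ?thesis by linarith
    next
      case False
      have "norm \<omega> \<le> norm (w - \<omega>) + norm w" using norm_triangle_ineq3[of w \<omega>] by (simp add: norm_minus_commute)
      moreover have "norm w \<le> norm z + 1"
        using norm_triangle_ineq4[of z "z - w"] wz by simp
      ultimately have "norm (w - \<omega>) \<ge> 1 / 2 * (1 + norm \<omega>)" using False by (simp add: B_def)
      moreover have "min (1 / 2) (\<delta> / (2 * (1 + B))) * (1 + norm \<omega>) \<le> 1 / 2 * (1 + norm \<omega>)"
        by (intro mult_right_mono min.cobounded1) auto
      ultimately show ?thesis by linarith
    qed
  qed
qed

text \<open>A point of \<open>A\<close> inside the disc would have distance 0 from itself, against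
  the positive lower bound. All subsets are treated at once because \<Omega> with one point removed
  is needed as well.\<close>

lemma closed_subset:
  assumes "A \<subseteq> \<Omega>" shows "closed A"
proof -
  have "\<exists>r>0. ball z r \<subseteq> -A" if z: "z \<in> -A" for z
  proof -
    obtain r C where rC: "r > 0" "C > 0"
      "\<And>w \<omega>. w \<in> cball z r \<Longrightarrow> \<omega> \<in> A \<Longrightarrow> norm (w - \<omega>) \<ge> C * (1 + norm \<omega>)"
      using dist_lower_bound[of A z] assms z by (metis ComplD)
    have "w \<notin> A" if "w \<in> ball z r" for w
    proof
      assume "w \<in> A"
      hence "norm (w - w) \<ge> C * (1 + norm w)" using that by (intro rC) auto
      moreover have "C * (1 + norm w) > 0" using rC by (intro mult_pos_pos add_pos_nonneg) auto
      ultimately show False by simp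
    qed
    thus ?thesis using rC(1) by blast
  qed
  thus ?thesis unfolding closed_def open_contains_ball by blast
qed

lemma closed_\<Omega>: "closed \<Omega>" by (rule closed_subset) simp

lemma open_compl_nz: "open (- (\<Omega> - {0}))"
  using closed_subset[of "\<Omega> - {0}"] open_Compl by blast

lemma summable_lattice:
  assumes "k \<ge> 3"
  shows "(\<lambda>\<omega>. 1 / (1 + norm \<omega>) ^ k) summable_on \<Omega>"
proof -
  obtain c where c: "c > 0" "\<And>m n. norm (pt (m, n)) \<ge> c * max \<bar>real_of_int m\<bar> \<bar>real_of_int n\<bar>"
    by (rule pt_bound) blast
  define d where "d = min c 1 / 2"
  have d: "d > 0" using c by (simp add: d_def)
  let ?g = "\<lambda>m::int. (1 + \<bar>real_of_int m\<bar>) powr (-3/2)"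
  have le: "1 / (1 + norm (pt (m, n))) ^ k \<le> (1 / d) ^ 3 * (?g m * ?g n)" for m n
  proof -
    define M N where "M = 1 + \<bar>real_of_int m\<bar>" and "N = 1 + \<bar>real_of_int n\<bar>"
    have MN: "M \<ge> 1" "N \<ge> 1" by (auto simp: M_def N_def)
    have c1: "min c 1 * max \<bar>real_of_int m\<bar> \<bar>real_of_int n\<bar> \<le> c * max \<bar>real_of_int m\<bar> \<bar>real_of_int n\<bar>"
      by (intro mult_right_mono) auto
    have "d * max M N = d + d * max \<bar>real_of_int m\<bar> \<bar>real_of_int n\<bar>"
      unfolding M_def N_def max_add_distrib_right[symmetric] by (simp add: algebra_simps)
    also have "\<dots> \<le> 1 + min c 1 * max \<bar>real_of_int m\<bar> \<bar>real_of_int n\<bar>"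
      using c(1) by (intro add_mono mult_right_mono) (auto simp: d_def)
    also have "\<dots> \<le> 1 + norm (pt (m, n))" using c(2)[of m n] c1 by linarith
    finally have a: "d * max M N \<le> 1 + norm (pt (m, n))" .
    \<comment> \<open>The geometric mean replaces the maximum, since it factorises over the two
      coordinates.\<close>
    have "sqrt (M * N) \<le> max M N"
      using MN by (intro real_le_lsqrt) (auto simp: power2_eq_square intro: mult_mono)
    hence b: "d * sqrt (M * N) \<le> 1 + norm (pt (m, n))"
      using a d by (meson mult_left_mono less_imp_le order.trans)
    have pos: "d * sqrt (M * N) > 0" using MN d by simp
    have "(1 + norm (pt (m, n))) ^ 3 \<le> (1 + norm (pt (m, n))) ^ k"
      using assms by (intro power_increasing) auto
    hence "(d * sqrt (M * N)) ^ 3 \<le> (1 + norm (pt (m, n))) ^ k"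
      using b pos by (meson less_imp_le order.trans power_mono)
    hence "1 / (1 + norm (pt (m, n))) ^ k \<le> 1 / (d * sqrt (M * N)) ^ 3"
      using pos by (intro frac_le zero_less_power) auto
    also have "sqrt x ^ 3 = x powr (3/2)" if "x > 0" for x
      using that by (simp add: powr_half_sqrt[symmetric] powr_realpow[symmetric] powr_powr)
    hence "1 / (d * sqrt (M * N)) ^ 3 = (1 / d) ^ 3 * (M powr (-3/2) * N powr (-3/2))"
      using MN by (simp add: power_mult_distrib real_sqrt_mult powr_minus field_simps)
    finally show ?thesis by (simp add: M_def N_def)
  qed
  have "(\<lambda>x. (1 / d) ^ 3 * (case x of (m, n) \<Rightarrow> ?g m * ?g n)) summable_on UNIV"
    by (intro summable_on_cmult_right summable_on_int_pair_powr)
  hence "(\<lambda>x. 1 / (1 + norm (pt x)) ^ k) summable_on UNIV"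
    by (rule summable_on_comparison_test) (use le in auto)
  thus ?thesis
    unfolding \<Omega>_range by (subst summable_on_reindex) (auto simp: o_def inj_pt)
qed

lemma E_bound:
  assumes "A \<subseteq> \<Omega>" "z \<notin> A" "k \<ge> 3"
  obtains r M where "r > 0" "M summable_on A" "\<And>w \<omega>. w \<in> cball z r \<Longrightarrow> \<omega> \<in> A \<Longrightarrow> w \<noteq> \<omega>"
    "\<And>w \<omega>. w \<in> cball z r \<Longrightarrow> \<omega> \<in> A \<Longrightarrow> norm (1 / (w - \<omega>) ^ k) \<le> M \<omega>"
proof -
  obtain r C where rC: "r > 0" "C > 0"
      "\<And>w \<omega>. w \<in> cball z r \<Longrightarrow> \<omega> \<in> A \<Longrightarrow> norm (w - \<omega>) \<ge> C * (1 + norm \<omega>)"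
    using dist_lower_bound[OF assms(1,2)] by metis
  have pos: "C * (1 + norm \<omega>) > 0" for \<omega> :: complex
    using rC by (intro mult_pos_pos add_pos_nonneg) auto
  show ?thesis
  proof (rule that[OF rC(1), of "\<lambda>\<omega>. (1 / C) ^ k * (1 / (1 + norm \<omega>) ^ k)"])
    show "(\<lambda>\<omega>. (1 / C) ^ k * (1 / (1 + norm \<omega>) ^ k)) summable_on A"
      using summable_on_subset_banach[OF summable_lattice[OF assms(3)] assms(1)]
      by (rule summable_on_cmult_right)
    fix w \<omega> assume w: "w \<in> cball z r" "\<omega> \<in> A"
    show "w \<noteq> \<omega>" using rC(3)[OF w] pos[of \<omega>] by auto
    have "norm (1 / (w - \<omega>) ^ k) = 1 / norm (w - \<omega>) ^ k" by (simp add: norm_divide norm_power)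
    also have "\<dots> \<le> 1 / (C * (1 + norm \<omega>)) ^ k"
      using rC(3)[OF w] pos[of \<omega>]
      by (intro frac_le power_mono zero_less_power) auto
    finally show "norm (1 / (w - \<omega>) ^ k) \<le> (1 / C) ^ k * (1 / (1 + norm \<omega>) ^ k)"
      by (simp add: power_mult_distrib power_divide)
  qed
qed

text \<open>The index set is a parameter so that \<Omega> and \<Omega> without 0 share summability
  and differentiation. Over \<Omega> these Eisenstein series are multiples of the derivatives of wp:
  wp' = -2 E_3 and wp'' = 6 E_4.\<close>

definition E_on :: "complex set \<Rightarrow> nat \<Rightarrow> complex \<Rightarrow> complex" where
  "E_on A k z = (\<Sum>\<^sub>\<infinity>\<omega>\<in>A. 1 / (z - \<omega>) ^ k)"

lemma E_on_summable:
  assumes "A \<subseteq> \<Omega>" "z \<notin> A" "k \<ge> 3"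
  shows "(\<lambda>\<omega>. 1 / (z - \<omega>) ^ k) summable_on A"
proof -
  obtain r M where rM: "r > 0" "M summable_on A"
    "\<And>w \<omega>. w \<in> cball z r \<Longrightarrow> \<omega> \<in> A \<Longrightarrow> norm (1 / (w - \<omega>) ^ k) \<le> M \<omega>"
    using E_bound[OF assms] by metis
  have "(\<lambda>\<omega>. norm (1 / (z - \<omega>) ^ k)) summable_on A"
    by (rule summable_on_comparison_test[OF rM(2)]) (use rM(1) in \<open>auto intro!: rM(3)\<close>)
  thus ?thesis by (rule abs_summable_summable)
qed

lemma E_on_deriv:
  assumes "A \<subseteq> \<Omega>" "z \<notin> A" "k \<ge> 3"
  shows "(E_on A k has_field_derivative - of_nat k * E_on A (Suc k) z) (at z)"
proof -
  obtain r M where rM: "r > 0" "M summable_on A" "\<And>w \<omega>. w \<in> cball z r \<Longrightarrow> \<omega> \<in> A \<Longrightarrow> w \<noteq> \<omega>"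
    "\<And>w \<omega>. w \<in> cball z r \<Longrightarrow> \<omega> \<in> A \<Longrightarrow> norm (1 / (w - \<omega>) ^ k) \<le> M \<omega>"
    using E_bound[OF assms] by metis
  have "((\<lambda>w. \<Sum>\<^sub>\<infinity>\<omega>\<in>A. 1 / (w - \<omega>) ^ k) has_field_derivative
          (\<Sum>\<^sub>\<infinity>\<omega>\<in>A. - of_nat k * (1 / (z - \<omega>) ^ Suc k))) (at z)"
  proof (rule has_field_derivative_infsum[OF rM(1) _ _ rM(2), where f' = "\<lambda>\<omega> w. - of_nat k * (1 / (w - \<omega>) ^ Suc k)"])
    fix \<omega> w assume "\<omega> \<in> A" "w \<in> cball z r"
    hence w: "w - \<omega> \<noteq> 0" using rM(3) by auto
    show "((\<lambda>w. 1 / (w - \<omega>) ^ k) has_field_derivative - of_nat k * (1 / (w - \<omega>) ^ Suc k)) (at w)"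
      using w by (intro has_field_derivative_inverse_power) auto
  qed (use rM in auto)
  also have "(\<Sum>\<^sub>\<infinity>\<omega>\<in>A. - of_nat k * (1 / (z - \<omega>) ^ Suc k)) = - of_nat k * E_on A (Suc k) z"
    unfolding E_on_def by (rule infsum_cmult_right') 
  finally show ?thesis by (simp add: E_on_def[abs_def])
qed

text \<open>This is wp(z) - 1/z^2, the part of wp that is regular at 0.\<close>

definition wp_reg :: "complex \<Rightarrow> complex" where
  "wp_reg z = (\<Sum>\<^sub>\<infinity>\<omega>\<in>\<Omega> - {0}. 1 / (z - \<omega>) ^ 2 - 1 / \<omega> ^ 2)"

text \<open>Exponent 2 is below the range of \<open>E_bound\<close>. The subtracted term
  1/\<omega>^2 rescues convergence: the difference equals w(2\<omega> - w)/((w - \<omega>)^2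
  \<omega>^2), which decays like |\<omega>|^(-3).\<close>

lemma wp_reg_deriv:
  assumes "z \<notin> \<Omega> - {0}"
  shows "(wp_reg has_field_derivative - 2 * E_on (\<Omega> - {0}) 3 z) (at z)"
proof -
  define A where "A = \<Omega> - {0}"
  have A: "A \<subseteq> \<Omega>" "z \<notin> A" "0 \<notin> A" using assms by (auto simp: A_def)
  obtain r C where rC: "r > 0" "r \<le> 1" "C > 0"
      "\<And>w \<omega>. w \<in> cball z r \<Longrightarrow> \<omega> \<in> A \<Longrightarrow> norm (w - \<omega>) \<ge> C * (1 + norm \<omega>)"
    using dist_lower_bound[OF A(1,2)] by metis
  \<comment> \<open>The same estimate centred at 0 bounds |\<omega>|, the other factor of the
    denominator, from below.\<close>
  obtain r0 C0 where r0: "r0 > 0" "C0 > 0"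
      "\<And>w \<omega>. w \<in> cball 0 r0 \<Longrightarrow> \<omega> \<in> A \<Longrightarrow> norm (w - \<omega>) \<ge> C0 * (1 + norm \<omega>)"
    using dist_lower_bound[OF A(1,3)] by metis
  have C0: "norm \<omega> \<ge> C0 * (1 + norm \<omega>)" if "\<omega> \<in> A" for \<omega>
    using r0(3)[of 0 \<omega>] r0(1) that by simp
  define R where "R = norm z + 1"
  have R: "R > 0" by (simp add: R_def add_nonneg_pos)
  define K where "K = R * (2 + R) / (C ^ 2 * C0 ^ 2)"
  have "((\<lambda>w. \<Sum>\<^sub>\<infinity>\<omega>\<in>A. 1 / (w - \<omega>) ^ 2 - 1 / \<omega> ^ 2) has_field_derivative
          (\<Sum>\<^sub>\<infinity>\<omega>\<in>A. - 2 * (1 / (z - \<omega>) ^ 3))) (at z)"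
  proof (rule has_field_derivative_infsum[OF rC(1), where f' = "\<lambda>\<omega> w. - 2 * (1 / (w - \<omega>) ^ 3)"
          and M = "\<lambda>\<omega>. K * (1 / (1 + norm \<omega>) ^ 3)"])
    show "(\<lambda>\<omega>. K * (1 / (1 + norm \<omega>) ^ 3)) summable_on A"
      using summable_on_subset_banach[OF summable_lattice[of 3] A(1)]
      by (intro summable_on_cmult_right) auto
    fix \<omega> w assume \<omega>: "\<omega> \<in> A" and w: "w \<in> cball z r"
    define L where "L = 1 + norm \<omega>"
    have L: "L \<ge> 1" by (simp add: L_def)
    have wn: "norm (w - \<omega>) \<ge> C * L" unfolding L_def by (rule rC(4)[OF w \<omega>])
    have \<omega>n: "norm \<omega> \<ge> C0 * L" unfolding L_def by (rule C0[OF \<omega>])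
    have CL: "C * L > 0" "C0 * L > 0" using rC r0 L by auto
    have nz: "w - \<omega> \<noteq> 0" "\<omega> \<noteq> 0" using wn \<omega>n CL by auto
    show "((\<lambda>w. 1 / (w - \<omega>) ^ 2 - 1 / \<omega> ^ 2) has_field_derivative - 2 * (1 / (w - \<omega>) ^ 3)) (at w)"
      using DERIV_diff[OF has_field_derivative_inverse_power[of w \<omega> 2] DERIV_const] nz
      by (simp add: numeral_3_eq_3 numeral_2_eq_2)
    have "norm w \<le> norm z + norm (w - z)" using norm_triangle_ineq[of z "w - z"] by simp
    hence wR: "norm w \<le> R" using w rC(2) by (simp add: R_def dist_norm norm_minus_commute)
    have "1 / (w - \<omega>) ^ 2 - 1 / \<omega> ^ 2 = w * (2 * \<omega> - w) / ((w - \<omega>) ^ 2 * \<omega> ^ 2)"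
      using nz by (simp add: divide_simps) (simp add: algebra_simps power2_eq_square)
    hence "norm (1 / (w - \<omega>) ^ 2 - 1 / \<omega> ^ 2) = norm w * norm (2 * \<omega> - w) / (norm (w - \<omega>) ^ 2 * norm \<omega> ^ 2)"
      by (simp add: norm_divide norm_mult norm_power)
    also have "\<dots> \<le> R * ((2 + R) * L) / ((C * L) ^ 2 * (C0 * L) ^ 2)"
    proof (rule frac_le)
      have "norm (2 * \<omega> - w) \<le> 2 * norm \<omega> + R"
        using norm_triangle_ineq4[of "2 * \<omega>" w] wR by (simp add: norm_mult)
      also have "\<dots> \<le> (2 + R) * L" using R by (simp add: L_def algebra_simps)
      finally show "norm w * norm (2 * \<omega> - w) \<le> R * ((2 + R) * L)"
        using wR R by (intro mult_mono) auto
      show "(C * L)\<^sup>2 * (C0 * L)\<^sup>2 \<le> (cmod (w - \<omega>))\<^sup>2 * (cmod \<omega>)\<^sup>2"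
        using wn \<omega>n CL by (intro mult_mono power_mono) auto
    qed (use R L CL in \<open>auto intro!: mult_pos_pos zero_less_power\<close>)
    also have "\<dots> = K * (1 / L ^ 3)"
      using L rC r0 by (simp add: K_def field_simps power2_eq_square power3_eq_cube)
    finally show "norm (1 / (w - \<omega>) ^ 2 - 1 / \<omega> ^ 2) \<le> K * (1 / (1 + norm \<omega>) ^ 3)"
      by (simp add: L_def)
  qed
  also have "(\<Sum>\<^sub>\<infinity>\<omega>\<in>A. - 2 * (1 / (z - \<omega>) ^ 3)) = - 2 * E_on A 3 z"
    unfolding E_on_def by (rule infsum_cmult_right')
  finally show ?thesis by (simp add: wp_reg_def[abs_def] A_def)
qed

end

subsection \<open>The Weierstrass function and its differential equation\<close>

text \<open>The difference is meromorphic, hence either zero or nonzero off a sparse set; the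
  hypothesis at \<open>a\<close> excludes the second case. Only punctured neighbourhoods occur, as
  values at poles are arbitrary.\<close>

lemma meromorphic_identity:
  assumes "f meromorphic_on D" "g meromorphic_on D" "open D" "connected D" "a \<in> D"
    and "eventually (\<lambda>z. f z = g z) (at a)" "z \<in> D"
  shows "eventually (\<lambda>z. f z = g z) (at z)"
proof -
  have "(\<lambda>z. f z - g z) meromorphic_on D" using assms by (intro meromorphic_intros)
  hence "eventually (\<lambda>z. f z - g z = 0) (cosparse D) \<or> eventually (\<lambda>z. f z - g z \<noteq> 0) (cosparse D)"
    by (rule meromorphic_imp_constant_or_avoid) (use assms in auto)
  moreover have "\<not> eventually (\<lambda>z. f z - g z \<noteq> 0) (cosparse D)"
  proof
    assume "eventually (\<lambda>z. f z - g z \<noteq> 0) (cosparse D)"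
    hence "eventually (\<lambda>z. f z - g z \<noteq> 0) (at a)"
      using assms by (simp add: eventually_cosparse_open_eq)
    with assms(6) have "eventually (\<lambda>z. False) (at a)" by eventually_elim auto
    thus False by simp
  qed
  ultimately have "eventually (\<lambda>z. f z - g z = 0) (cosparse D)" by blast
  thus ?thesis using assms by (simp add: eventually_cosparse_open_eq)
qed

lemma inverse_power_uminus: "1 / (- b) ^ k = (- 1) ^ k * (1 / b ^ k)" for b :: complex
  by (cases "even k") auto

text \<open>The removable singularity theorem is applied twice to divide by z. The cofactor
  \<open>v\<close> is what remains after a double zero has cancelled a factor 1/z^2, and
  \<open>v 0\<close> is the value to be filled in at the cancelled pole.\<close>

lemma holomorphic_factor_square:
  assumes f: "f holomorphic_on S" "open S" "0 \<in> S" "f 0 = 0" "deriv f 0 = 0"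
  obtains v where "v holomorphic_on S" "\<And>z. z \<in> S \<Longrightarrow> f z = z ^ 2 * v z"
    "deriv (deriv f) 0 = 2 * v 0"
proof -
  define f1 where "f1 = (\<lambda>z. if z = 0 then deriv f 0 else (f z - f 0) / (z - 0))"
  define v where "v = (\<lambda>z. if z = 0 then deriv f1 0 else (f1 z - f1 0) / (z - 0))"
  have f1: "f1 holomorphic_on S" unfolding f1_def by (rule pole_lemma_open) (use f in auto)
  have v: "v holomorphic_on S" unfolding v_def by (rule pole_lemma_open) (use f f1 in auto)
  have eq: "f z = z ^ 2 * v z" for z
    using f by (simp add: v_def f1_def power2_eq_square)
  have v': "(v has_field_derivative deriv v z) (at z)" if "z \<in> S" for z
    using v f(2) that holomorphic_derivI by blast
  have D: "deriv f z = 2 * z * v z + z ^ 2 * deriv v z" if "z \<in> S" for z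
    unfolding eq[abs_def] by (rule DERIV_imp_deriv) (use v'[OF that] in \<open>auto intro!: derivative_eq_intros\<close>)
  have v'': "(deriv v has_field_derivative deriv (deriv v) 0) (at 0)"
    using holomorphic_deriv[OF v f(2)] f(2,3) holomorphic_derivI by blast
  have "((\<lambda>z. 2 * z * v z + z ^ 2 * deriv v z) has_field_derivative 2 * v 0) (at 0)"
    using v'[OF f(3)] v'' by (auto intro!: derivative_eq_intros)
  hence "(deriv f has_field_derivative 2 * v 0) (at 0)"
    by (rule has_field_derivative_transform_within_open[OF _ f(2,3)]) (use D in auto)
  hence "deriv (deriv f) 0 = 2 * v 0" by (rule DERIV_imp_deriv)
  with v eq show ?thesis by (intro that) auto
qed

context complex_lattice
begin

abbreviation wp :: "complex \<Rightarrow> complex" where "wp \<equiv> lattice_wp \<Omega>"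
abbreviation E :: "nat \<Rightarrow> complex \<Rightarrow> complex" where "E \<equiv> E_on \<Omega>"
abbreviation E' :: "nat \<Rightarrow> complex \<Rightarrow> complex" where "E' \<equiv> E_on (\<Omega> - {0})"

lemma wp_eq: "wp z = 1 / z ^ 2 + wp_reg z"
  by (simp add: lattice_wp_def wp_reg_def)

lemma E_eq:
  assumes "z \<notin> \<Omega>" "k \<ge> 3"
  shows "E k z = 1 / z ^ k + E' k z"
proof -
  have "infsum (\<lambda>\<omega>. 1 / (z - \<omega>) ^ k) (insert 0 (\<Omega> - {0})) = 1 / (z - 0) ^ k + E' k z"
    unfolding E_on_def by (intro infsum_insert E_on_summable) (use assms in auto)
  thus ?thesis by (simp add: E_on_def insert_absorb)
qed

lemma wp_deriv:
  assumes "z \<notin> \<Omega>"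
  shows "(wp has_field_derivative - 2 * E 3 z) (at z)"
proof -
  have z: "z \<noteq> 0" using assms by auto
  have "((\<lambda>z. 1 / (z - 0) ^ 2 + wp_reg z) has_field_derivative
      - of_nat 2 * (1 / (z - 0) ^ Suc 2) + - 2 * E' 3 z) (at z)"
    by (intro DERIV_add has_field_derivative_inverse_power wp_reg_deriv) (use z assms in auto)
  thus ?thesis using E_eq[OF assms, of 3] by (simp add: wp_eq[abs_def] algebra_simps)
qed

lemma E_deriv:
  assumes "z \<notin> \<Omega>" "k \<ge> 3"
  shows "(E k has_field_derivative - of_nat k * E (Suc k) z) (at z)"
  using E_on_deriv[of \<Omega> z k] assms by simp

lemma E'_deriv:
  assumes "z \<notin> \<Omega> - {0}" "k \<ge> 3"
  shows "(E' k has_field_derivative - of_nat k * E' (Suc k) z) (at z)"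
  using E_on_deriv[of "\<Omega> - {0}" z k] assms by simp

lemma open_compl: "open (- \<Omega>)" using closed_\<Omega> by (rule open_Compl)

lemma E_periodic: "p \<in> \<Omega> \<Longrightarrow> E k (z + p) = E k z"
  unfolding E_on_def
  by (rule infsum_reindex_bij_witness[where i = "\<lambda>\<omega>. \<omega> + p" and j = "\<lambda>\<omega>. \<omega> - p"])
     (auto simp: algebra_simps)

lemma E_uminus: "E k (- z) = (- 1) ^ k * E k z"
proof -
  have *: "1 / (- z - b) ^ k = (- 1) ^ k / (z + b) ^ k" for b :: complex
    using inverse_power_uminus[of "z + b" k] by simp
  have "E k (- z) = (\<Sum>\<^sub>\<infinity>\<omega>\<in>\<Omega>. (- 1) ^ k * (1 / (z - \<omega>) ^ k))"
    unfolding E_on_def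
    by (rule infsum_reindex_bij_witness[where i = uminus and j = uminus]) (auto simp: *)
  also have "\<dots> = (- 1) ^ k * E k z" unfolding E_on_def by (rule infsum_cmult_right')
  finally show ?thesis .
qed

lemma wp_uminus: "wp (- z) = wp z"
proof -
  have "wp_reg (- z) = wp_reg z"
    unfolding wp_reg_def
    by (rule infsum_reindex_bij_witness[where i = uminus and j = uminus])
       (auto simp: power2_eq_square algebra_simps)
  thus ?thesis by (simp add: wp_eq)
qed

section \<open>Periodicity of wp\<close>

lemma connected_compl: "connected (- \<Omega>)"
  using connected_open_diff_countable[of "UNIV :: complex set" \<Omega>] countable_\<Omega> connected_UNIV
  by (simp add: Compl_eq_Diff_UNIV)

text \<open>The derivative is periodic by reindexing, so wp(z + p) - wp(z) is constant on the
  connected complement of \<Omega>. At z = -p/2 evenness makes it 0, which is why p/2 must avoid the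
  poles.\<close>

lemma wp_periodic_aux:
  assumes p: "p \<in> \<Omega>" "p / 2 \<notin> \<Omega>" and z: "z \<notin> \<Omega>"
  shows "wp (z + p) = wp z"
proof -
  have D: "((\<lambda>z. wp (z + p) - wp z) has_field_derivative 0) (at x)" if "x \<notin> \<Omega>" for x
  proof -
    have "x + p \<notin> \<Omega>" using that p add_in_iff by auto
    have "((\<lambda>z. wp (z + p)) has_field_derivative (- 2 * E 3 (x + p)) * 1) (at x)"
      by (rule DERIV_chain2[OF wp_deriv]) (use \<open>x + p \<notin> \<Omega>\<close> in \<open>auto intro!: derivative_eq_intros\<close>)
    from DERIV_diff[OF this wp_deriv[OF that]] show ?thesis
      using E_periodic[OF p(1)] by simp
  qed
  obtain c where c: "\<And>x. x \<in> - \<Omega> \<Longrightarrow> wp (x + p) - wp x = c"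
  proof (rule DERIV_zero_connected_constant[OF connected_compl open_compl finite.emptyI])
    show "continuous_on (- \<Omega>) (\<lambda>x. wp (x + p) - wp x)"
      by (rule DERIV_continuous_on) (use D in \<open>blast intro: has_field_derivative_at_within\<close>)
  qed (use D in auto)
  have "- (p / 2) \<in> - \<Omega>" using p(2) by auto
  from c[OF this] have "c = 0" using wp_uminus[of "p / 2"] by simp
  thus ?thesis using c[of z] z by simp
qed

lemma half_basis: "\<omega>1 / 2 \<notin> \<Omega>" "\<omega>2 / 2 \<notin> \<Omega>"
proof -
  have *: "\<exists>m n. pt (2 * m, 2 * n) = x" if "x / 2 \<in> \<Omega>" for x
  proof -
    obtain m n where "x / 2 = pt (m, n)" using \<open>x / 2 \<in> \<Omega>\<close> by (auto simp: \<Omega>_range)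
    hence "x = pt (2 * m, 2 * n)" by (simp add: pt_def field_simps)
    thus ?thesis by blast
  qed
  have "pt (2 * m, 2 * n) \<noteq> pt (1, 0)" "pt (2 * m, 2 * n) \<noteq> pt (0, 1)" for m n
    using inj_pt by (auto dest!: injD) presburger+
  with *[of \<omega>1] *[of \<omega>2] show "\<omega>1 / 2 \<notin> \<Omega>" "\<omega>2 / 2 \<notin> \<Omega>" by (auto simp: pt_def)
qed

lemma of_int_mult_in: "q \<in> \<Omega> \<Longrightarrow> of_int m * q \<in> \<Omega>"
proof -
  assume "q \<in> \<Omega>"
  then obtain a b where "q = pt (a, b)" by (auto simp: \<Omega>_range)
  hence "of_int m * q = pt (m * a, m * b)" by (simp add: pt_def algebra_simps)
  thus ?thesis by simp
qed

lemma periodic_of_int: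
  assumes q: "q \<in> \<Omega>" "\<And>z. z \<notin> \<Omega> \<Longrightarrow> f (z + q) = f z" and z: "z \<notin> \<Omega>"
  shows "f (z + of_int m * q) = f z"
proof (induction m rule: int_induct[where k = 0])
  case (step1 i)
  have "z + of_int i * q \<notin> \<Omega>" using z of_int_mult_in[OF q(1)] add_in_iff by blast
  from q(2)[OF this] step1 show ?case by (simp add: algebra_simps)
next
  case (step2 i)
  have "z + of_int (i - 1) * q \<notin> \<Omega>" using z of_int_mult_in[OF q(1)] add_in_iff by blast
  from q(2)[OF this] step2 show ?case by (simp add: algebra_simps)
qed auto

text \<open>The half-period argument covers \<omega>1 and \<omega>2; integer combinations of them
  reach every period, including those whose half lies in \<Omega>.\<close>

lemma wp_periodic:
  assumes "p \<in> \<Omega>" "z \<notin> \<Omega>"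
  shows "wp (z + p) = wp z"
proof -
  obtain m n where p: "p = of_int m * \<omega>1 + of_int n * \<omega>2" using assms(1) by (auto simp: \<Omega>_eq)
  have z': "z + of_int m * \<omega>1 \<notin> \<Omega>" using assms(2) of_int_mult_in add_in_iff by blast
  have "wp (z + p) = wp (z + of_int m * \<omega>1 + of_int n * \<omega>2)" by (simp add: p algebra_simps)
  also have "\<dots> = wp (z + of_int m * \<omega>1)"
    by (rule periodic_of_int) (use z' half_basis wp_periodic_aux in auto)
  also have "\<dots> = wp z"
    by (rule periodic_of_int) (use assms half_basis wp_periodic_aux in auto)
  finally show ?thesis .
qed

text \<open>Every point is congruent to one in a fixed disc containing the period parallelogram, so
  \<open>H\<close> is bounded and Liouville's theorem applies.\<close>

lemma periodic_entire_const:
  assumes H: "H holomorphic_on UNIV" and per: "\<And>z p. p \<in> \<Omega> \<Longrightarrow> H (z + p) = H z"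
  shows "H z = H w"
proof -
  define \<tau> where "\<tau> = \<omega>2 / \<omega>1"
  have Im: "Im \<tau> \<noteq> 0" using indep by (simp add: \<tau>_def complex_is_Real_iff)
  define R where "R = norm \<omega>1 + norm \<omega>2"
  have red: "\<exists>y\<in>cball 0 R. H z = H y" for z
  proof -
    \<comment> \<open>\<open>a\<close> and \<open>b\<close> are the real coordinates of
      \<open>z\<close> in the basis \<omega>1, \<omega>2; their integer parts are translated
      away.\<close>
    define b where "b = Im (z / \<omega>1) / Im \<tau>"
    define a where "a = Re (z / \<omega>1) - b * Re \<tau>"
    have "z / \<omega>1 = of_real a + of_real b * \<tau>"
      using Im by (simp add: complex_eq_iff a_def b_def del: Re_divide Im_divide)
    hence z: "z = of_real a * \<omega>1 + of_real b * \<omega>2"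
      using nz1 by (simp add: \<tau>_def field_simps)
    define y where "y = of_real (frac a) * \<omega>1 + of_real (frac b) * \<omega>2"
    have "z = y + pt (\<lfloor>a\<rfloor>, \<lfloor>b\<rfloor>)"
      unfolding z y_def pt_def frac_def by (simp add: algebra_simps)
    hence eq: "H z = H y" using per by simp
    have "norm y \<le> norm (of_real (frac a) * \<omega>1) + norm (of_real (frac b) * \<omega>2)"
      unfolding y_def by (rule norm_triangle_ineq)
    hence "norm y \<le> frac a * norm \<omega>1 + frac b * norm \<omega>2" by (simp add: norm_mult)
    also have "\<dots> \<le> 1 * norm \<omega>1 + 1 * norm \<omega>2"
      by (intro add_mono mult_right_mono less_imp_le[OF frac_lt_1]) auto
    finally have "y \<in> cball 0 R" by (simp add: R_def)
    with eq show ?thesis by blast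
  qed
  have "compact (H ` cball 0 R)"
    by (intro compact_continuous_image holomorphic_on_imp_continuous_on holomorphic_on_subset[OF H]) auto
  moreover have "range H \<subseteq> H ` cball 0 R" using red by blast
  ultimately have "bounded (range H)" using bounded_subset compact_imp_bounded by blast
  from Liouville_theorem[OF H this] show ?thesis by (auto simp: constant_on_def)
qed

lemma wp_reg_0 [simp]: "wp_reg 0 = 0"
  by (simp add: wp_reg_def)

lemma E'_at_0: "E' k 0 = (- 1) ^ k * (\<Sum>\<^sub>\<infinity>\<omega>\<in>\<Omega> - {0}. 1 / \<omega> ^ k)"
proof -
  have "E' k 0 = (\<Sum>\<^sub>\<infinity>\<omega>\<in>\<Omega> - {0}. (- 1) ^ k * (1 / \<omega> ^ k))"
    unfolding E_on_def by (simp add: inverse_power_uminus)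
  also have "\<dots> = (- 1) ^ k * (\<Sum>\<^sub>\<infinity>\<omega>\<in>\<Omega> - {0}. 1 / \<omega> ^ k)" by (rule infsum_cmult_right')
  finally show ?thesis .
qed

lemma E'_odd_0: "E' 3 0 = 0"
proof -
  have "E' 3 0 = (\<Sum>\<^sub>\<infinity>\<omega>\<in>\<Omega> - {0}. (- 1) * (1 / (0 - \<omega>) ^ 3))"
    unfolding E_on_def
    by (rule infsum_reindex_bij_witness[where i = uminus and j = uminus]) auto
  also have "\<dots> = - 1 * E' 3 0" unfolding E_on_def by (rule infsum_cmult_right')
  finally show ?thesis by simp
qed

lemma wp_reg_holomorphic: "wp_reg holomorphic_on - (\<Omega> - {0})"
  unfolding holomorphic_on_open[OF open_compl_nz] using wp_reg_deriv by blast

lemma E'_holomorphic: "k \<ge> 3 \<Longrightarrow> E' k holomorphic_on - (\<Omega> - {0})"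
  unfolding holomorphic_on_open[OF open_compl_nz] using E'_deriv by blast

lemma deriv_wp_reg: "z \<notin> \<Omega> - {0} \<Longrightarrow> deriv wp_reg z = - 2 * E' 3 z"
  using wp_reg_deriv DERIV_imp_deriv by blast

lemma has_derivative_deriv_wp_reg:
  assumes "z \<notin> \<Omega> - {0}"
  shows "(deriv wp_reg has_field_derivative 6 * E' 4 z) (at z)"
proof -
  have "((\<lambda>z. - 2 * E' 3 z) has_field_derivative - 2 * (- of_nat 3 * E' (Suc 3) z)) (at z)"
    by (intro DERIV_cmult E'_deriv) (use assms in auto)
  hence "(deriv wp_reg has_field_derivative - 2 * (- of_nat 3 * E' (Suc 3) z)) (at z)"
    by (rule has_field_derivative_transform_within_open[OF _ open_compl_nz]) (use assms deriv_wp_reg in auto)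
  thus ?thesis by simp
qed

text \<open>The left-hand side is the value at 0 of wp'' - 6 wp^2 after cancelling poles. Since v(0)
  = 3 E'_4(0), it equals -30 E'_4(0), and 60 E'_4(0) is g2.\<close>

lemma wp_reg_ode_aux:
  obtains v where "v holomorphic_on - (\<Omega> - {0})" "\<And>z. z \<notin> \<Omega> - {0} \<Longrightarrow> wp_reg z = z ^ 2 * v z"
    "6 * E' 4 0 - 12 * v 0 = - invariant_g2 \<Omega> / 2"
proof -
  obtain v where v: "v holomorphic_on - (\<Omega> - {0})" "\<And>z. z \<in> - (\<Omega> - {0}) \<Longrightarrow> wp_reg z = z ^ 2 * v z"
    "deriv (deriv wp_reg) 0 = 2 * v 0"
    by (rule holomorphic_factor_square[OF wp_reg_holomorphic open_compl_nz])
       (auto simp: deriv_wp_reg E'_odd_0)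
  have "deriv (deriv wp_reg) 0 = 6 * E' 4 0"
    by (rule DERIV_imp_deriv, rule has_derivative_deriv_wp_reg) auto
  hence v0: "v 0 = 3 * E' 4 0" using v(3) by simp
  have "E' 4 0 = invariant_g2 \<Omega> / 60"
    by (simp add: E'_at_0 invariant_g2_def)
  hence "6 * E' 4 0 - 12 * v 0 = - invariant_g2 \<Omega> / 2" unfolding v0 by (simp add: mult.commute)
  with v show ?thesis by (intro that) auto
qed

text \<open>In 6 E_4 - 6 wp^2 the terms 6/z^4 cancel; the cross term 12 \<open>wp_reg\<close>/z^2 =
  12 v is regular because \<open>wp_reg\<close> has a double zero at 0.\<close>

lemma wp_ode:
  assumes "z \<notin> \<Omega>"
  shows "6 * E 4 z = 6 * wp z ^ 2 - invariant_g2 \<Omega> / 2"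
proof -
  obtain v where v: "v holomorphic_on - (\<Omega> - {0})" "\<And>z. z \<notin> \<Omega> - {0} \<Longrightarrow> wp_reg z = z ^ 2 * v z"
    "6 * E' 4 0 - 12 * v 0 = - invariant_g2 \<Omega> / 2"
    by (rule wp_reg_ode_aux) blast
  define h0 where "h0 = (\<lambda>z. 6 * E' 4 z - 12 * v z - 6 * wp_reg z ^ 2)"
  \<comment> \<open>The value on \<Omega> is the limit at 0, so \<open>H\<close> agrees with the
    holomorphic \<open>h0\<close> near 0; periodicity transports differentiability to the other
    lattice points.\<close>
  define H where "H = (\<lambda>z. if z \<in> \<Omega> then - invariant_g2 \<Omega> / 2 else 6 * E 4 z - 6 * wp z ^ 2)"
  have h0: "h0 holomorphic_on - (\<Omega> - {0})"
    unfolding h0_def by (intro holomorphic_intros v wp_reg_holomorphic E'_holomorphic) auto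
  have H_h0: "H z = h0 z" if "z \<notin> \<Omega> - {0}" for z
  proof (cases "z = 0")
    case True
    then show ?thesis using v(3) by (simp add: H_def h0_def)
  next
    case False
    hence z: "z \<notin> \<Omega>" using that by auto
    have "v z = wp_reg z / z ^ 2" using False v(2)[OF that] by simp
    moreover have "1 / z ^ 4 = (1 / z ^ 2) ^ 2" by (simp add: power_divide flip: power_mult)
    ultimately show ?thesis
      using z E_eq[OF z, of 4]
      by (simp add: H_def h0_def wp_eq power2_sum mult.assoc)
  qed
  have per: "H (z + p) = H z" if "p \<in> \<Omega>" for z p
    using that by (auto simp: H_def add_in_iff E_periodic wp_periodic)
  have "H field_differentiable at z" for z
  proof (cases "z \<in> \<Omega>")
    case False
    have "(\<lambda>z. 6 * E 4 z - 6 * wp z ^ 2) field_differentiable at z"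
      using wp_deriv[OF False] E_deriv[OF False, of 4]
      by (intro field_differentiable_diff field_differentiable_mult field_differentiable_power)
         (auto simp: field_differentiable_def)
    then obtain D where "((\<lambda>z. 6 * E 4 z - 6 * wp z ^ 2) has_field_derivative D) (at z)"
      by (auto simp: field_differentiable_def)
    hence "(H has_field_derivative D) (at z)"
      by (rule has_field_derivative_transform_within_open[OF _ open_compl])
         (use False in \<open>auto simp: H_def\<close>)
    thus ?thesis by (auto simp: field_differentiable_def)
  next
    case True
    obtain D where D: "(h0 has_field_derivative D) (at 0)"
      using h0 open_compl_nz unfolding holomorphic_on_open[OF open_compl_nz] by auto
    have "(H has_field_derivative D) (at 0)"
      by (rule has_field_derivative_transform_within_open[OF D open_compl_nz]) (use H_h0 in auto)
    hence "((\<lambda>w. H (w + (- z))) has_field_derivative D) (at z)"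
      using DERIV_shift[of H D z "- z"] by simp
    moreover have "(\<lambda>w. H (w + (- z))) = H" using per[of "- z"] True by (intro ext) auto
    ultimately show ?thesis by (auto simp: field_differentiable_def)
  qed
  hence "H holomorphic_on UNIV" by (auto simp: holomorphic_on_def)
  from periodic_entire_const[OF this per, of z 0] show ?thesis
    using assms by (simp add: H_def algebra_simps)
qed

section \<open>Meromorphy and poles of wp\<close>

lemma eventually_not_in_\<Omega>: "eventually (\<lambda>w. w \<notin> \<Omega>) (at z)"
proof -
  have "closed (\<Omega> - {z})" by (rule closed_subset) auto
  hence "eventually (\<lambda>w. w \<in> - (\<Omega> - {z}) - {z}) (at z)"
    by (intro eventually_at_in_open open_Compl) auto
  thus ?thesis by eventually_elim auto
qed

lemma wp_analytic: "z \<notin> \<Omega> \<Longrightarrow> wp analytic_on {z}"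
proof -
  assume "z \<notin> \<Omega>"
  have "wp holomorphic_on - \<Omega>"
    unfolding holomorphic_on_open[OF open_compl] using wp_deriv by blast
  thus ?thesis using open_compl \<open>z \<notin> \<Omega>\<close> by (auto simp: analytic_at)
qed

lemma wp_meromorphic: "wp meromorphic_on UNIV"
proof -
  have "wp meromorphic_on {z}" for z
  proof (cases "z \<in> \<Omega>")
    case False
    thus ?thesis using wp_analytic analytic_on_imp_meromorphic_on by blast
  next
    case True
    have "(\<lambda>w. 1 / (w - z) ^ 2 + wp_reg (w - z)) meromorphic_on {z}"
    proof (intro meromorphic_intros)
      have "wp_reg analytic_on {0}" using wp_reg_holomorphic open_compl_nz by (auto simp: analytic_at)
      hence "(wp_reg \<circ> (\<lambda>w. w - z)) analytic_on {z}"
        by (intro analytic_on_compose analytic_intros) auto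
      thus "(\<lambda>w. wp_reg (w - z)) meromorphic_on {z}"
        unfolding o_def by (rule analytic_on_imp_meromorphic_on)
    qed
    moreover have "eventually (\<lambda>w. 1 / (w - z) ^ 2 + wp_reg (w - z) = wp w) (at z)"
      using eventually_not_in_\<Omega>[of z]
    proof eventually_elim
      case (elim w)
      hence "wp (w + - z) = wp w" using True by (intro wp_periodic) auto
      thus ?case by (simp add: wp_eq)
    qed
    ultimately show ?thesis by (subst (asm) meromorphic_on_cong) auto
  qed
  thus ?thesis by (subst meromorphic_on_meromorphic_at) auto
qed

text \<open>This recovers the lattice from the function, the last link in showing that the
  invariants determine \<Omega>.\<close>

lemma is_pole_wp_iff: "is_pole wp p \<longleftrightarrow> p \<in> \<Omega>"
proof
  assume p: "p \<in> \<Omega>"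
  have "isCont wp_reg 0" by (rule DERIV_isCont[OF wp_reg_deriv]) auto
  hence "wp_reg \<midarrow>0\<rightarrow> 0" by (simp add: isCont_def)
  moreover have "filterlim (\<lambda>z::complex. 1 / z ^ 2) at_infinity (at 0)"
    using is_pole_inverse_power[of 2 "0::complex"] by (simp add: is_pole_def)
  ultimately have "filterlim (\<lambda>z. wp_reg z + 1 / z ^ 2) at_infinity (at 0)"
    by (rule tendsto_add_filterlim_at_infinity)
  moreover have "eventually (\<lambda>z. wp_reg z + 1 / z ^ 2 = wp (z + p)) (at 0)"
    using eventually_not_in_\<Omega>[of 0] 
  proof eventually_elim
    case (elim z)
    thus ?case using wp_periodic[OF p elim] wp_eq[of z] by simp
  qed
  ultimately have "filterlim (\<lambda>z. wp (z + p)) at_infinity (at 0)"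
    by (subst (asm) filterlim_cong[OF refl refl]) auto
  thus "is_pole wp p" unfolding is_pole_def by (subst filterlim_at_to_0)
next
  assume "is_pole wp p"
  thus "p \<in> \<Omega>" using wp_analytic analytic_at_imp_no_pole by blast
qed

end

subsection \<open>The invariants determine the lattice\<close>

context complex_lattice
begin

text \<open>Each derivative of E_k brings a factor -k, and the leading -2 completes the factorial.
  General \<open>A\<close> and \<open>f\<close> serve both wp, with \<Omega>, and
  \<open>wp_reg\<close>, with the origin removed.\<close>

lemma higher_deriv_E:
  assumes "open S" "A \<subseteq> \<Omega>" "S \<inter> A = {}"
    and f: "\<And>z. z \<in> S \<Longrightarrow> (f has_field_derivative - 2 * E_on A 3 z) (at z)" and "z \<in> S"
  shows "(deriv ^^ Suc k) f z = (- 1) ^ Suc k * fact (k + 2) * E_on A (k + 3) z"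
  using \<open>z \<in> S\<close>
proof (induction k arbitrary: z)
  case 0
  then show ?case using f[of z] by (auto simp: DERIV_imp_deriv fact_numeral)
next
  case (Suc k)
  have "((\<lambda>z. (- 1) ^ Suc k * fact (k + 2) * E_on A (k + 3) z) has_field_derivative
      ((- 1) ^ Suc k * fact (k + 2)) * (- of_nat (k + 3) * E_on A (Suc (k + 3)) z)) (at z)"
    by (intro DERIV_cmult E_on_deriv) (use assms Suc.prems in auto)
  hence "((deriv ^^ Suc k) f has_field_derivative
      ((- 1) ^ Suc k * fact (k + 2)) * (- of_nat (k + 3) * E_on A (Suc (k + 3)) z)) (at z)"
    by (rule has_field_derivative_transform_within_open[OF _ assms(1)])
       (use Suc.prems Suc.IH in auto)
  from DERIV_imp_deriv[OF this] have "(deriv ^^ Suc (Suc k)) f z =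
      ((- 1) ^ Suc k * fact (k + 2)) * (- of_nat (k + 3) * E_on A (Suc (k + 3)) z)" by simp
  also have "\<dots> = (- 1) ^ Suc (Suc k) * (of_nat (k + 3) * fact (k + 2)) * E_on A (Suc k + 3) z"
    by (simp add: algebra_simps)
  also have "of_nat (k + 3) * fact (k + 2) = (fact (Suc k + 2) :: complex)"
    using fact_Suc[of "k + 2", where ?'a = complex] by (simp add: numeral_eq_Suc)
  finally show ?case .
qed

lemma higher_deriv_wp:
  "z \<notin> \<Omega> \<Longrightarrow> (deriv ^^ Suc k) wp z = (- 1) ^ Suc k * fact (k + 2) * E (k + 3) z"
  by (rule higher_deriv_E[OF open_compl]) (use wp_deriv in auto)

lemma higher_deriv_wp_reg:
  "z \<notin> \<Omega> - {0} \<Longrightarrow> (deriv ^^ Suc k) wp_reg z = (- 1) ^ Suc k * fact (k + 2) * E' (k + 3) z"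
  by (rule higher_deriv_E[OF open_compl_nz]) (use wp_reg_deriv in auto)

definition wp_fps :: "complex fps" where "wp_fps = fps_expansion wp_reg 0"

lemma wp_reg_fps: "wp_reg has_fps_expansion wp_fps"
  unfolding wp_fps_def
  by (rule analytic_at_imp_has_fps_expansion_0)
     (use wp_reg_holomorphic open_compl_nz in \<open>auto simp: analytic_at\<close>)

lemma wp_fps_0: "fps_nth wp_fps 0 = 0"
  and wp_fps_1: "fps_nth wp_fps (Suc 0) = 0"
  and wp_fps_4: "fps_nth wp_fps 4 = invariant_g3 \<Omega> / 28"
proof -
  note nth = fps_nth_fps_expansion[OF wp_reg_fps]
  show "fps_nth wp_fps 0 = 0" by (simp add: nth)
  show "fps_nth wp_fps (Suc 0) = 0"
    using higher_deriv_wp_reg[of 0 0] by (simp add: nth E'_odd_0)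
  have "(deriv ^^ Suc 3) wp_reg 0 = 120 * E' 6 0"
    using higher_deriv_wp_reg[of 0 3] by (simp add: fact_numeral)
  moreover have "E' 6 0 = invariant_g3 \<Omega> / 140"
    by (simp add: E'_at_0 invariant_g3_def)
  ultimately have "(deriv ^^ 4) wp_reg 0 = 120 * (invariant_g3 \<Omega> / 140)"
    by (simp add: eval_nat_numeral mult.commute)
  thus "fps_nth wp_fps 4 = invariant_g3 \<Omega> / 28"
    by (simp add: nth fact_numeral mult.commute)
qed

text \<open>Inserting wp = 1/z^2 + r into wp'' = 6 wp^2 - g2/2 cancels 6/z^4 and leaves the term 12
  r/z^2; multiplication by z^2 makes the equation polynomial in z.\<close>

lemma wp_fps_ode:
  "fps_X ^ 2 * fps_deriv (fps_deriv wp_fps) =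
     fps_const 12 * wp_fps + fps_const 6 * (fps_X ^ 2 * (wp_fps * wp_fps)) -
     fps_const (invariant_g2 \<Omega> / 2) * fps_X ^ 2"
proof -
  let ?r = "\<lambda>z. 12 * wp_reg z + 6 * (z ^ 2 * (wp_reg z * wp_reg z)) - invariant_g2 \<Omega> / 2 * z ^ 2"
  have 1: "(\<lambda>z. z ^ 2 * deriv (deriv wp_reg) z) has_fps_expansion fps_X ^ 2 * fps_deriv (fps_deriv wp_fps)"
    by (intro fps_expansion_intros wp_reg_fps)
  have 2: "?r has_fps_expansion fps_const 12 * wp_fps + fps_const 6 * (fps_X ^ 2 * (wp_fps * wp_fps)) -
     fps_const (invariant_g2 \<Omega> / 2) * fps_X ^ 2"
    by (intro fps_expansion_intros wp_reg_fps)
  have "eventually (\<lambda>z. z \<in> - (\<Omega> - {0})) (nhds 0)"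
    by (rule eventually_nhds_in_open[OF open_compl_nz]) auto
  hence "eventually (\<lambda>z. z ^ 2 * deriv (deriv wp_reg) z = ?r z) (nhds 0)"
  proof eventually_elim
    case (elim z)
    show ?case
    proof (cases "z = 0")
      case False
      hence z: "z \<notin> \<Omega>" using elim by auto
      have "deriv (deriv wp_reg) z = 6 * E' 4 z"
        using has_derivative_deriv_wp_reg[of z] elim DERIV_imp_deriv by auto
      also have "\<dots> = 6 * wp z ^ 2 - invariant_g2 \<Omega> / 2 - 6 / z ^ 4"
        using wp_ode[OF z] E_eq[OF z, of 4] by (simp add: algebra_simps)
      finally have "z ^ 2 * deriv (deriv wp_reg) z = z ^ 2 * \<dots>" by simp
      also have "\<dots> = ?r z"
        unfolding wp_eq using False by (simp add: field_simps power2_eq_square power4_eq_xxxx)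
      finally show ?thesis .
    qed auto
  qed
  hence "?r has_fps_expansion fps_X ^ 2 * fps_deriv (fps_deriv wp_fps)"
    using 1 by (subst (asm) has_fps_expansion_cong[OF _ refl]) auto
  thus ?thesis using 2 by (rule fps_expansion_unique_complex)
qed

text \<open>The left-hand factor vanishes only for \<open>m = 2\<close>, that is, at the coefficient carrying \<open>g\<^sub>3\<close>.\<close>

lemma wp_fps_rec:
  "(of_nat ((m + 1) * (m + 2)) - 12) * fps_nth wp_fps (m + 2) =
     6 * (\<Sum>i\<le>m. fps_nth wp_fps i * fps_nth wp_fps (m - i)) -
     (if m = 0 then invariant_g2 \<Omega> / 2 else 0)"
proof -
  have "fps_nth (fps_X ^ 2 * fps_deriv (fps_deriv wp_fps)) (m + 2) =
    fps_nth (fps_const 12 * wp_fps + fps_const 6 * (fps_X ^ 2 * (wp_fps * wp_fps)) -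
     fps_const (invariant_g2 \<Omega> / 2) * fps_X ^ 2) (m + 2)"
    by (simp only: wp_fps_ode)
  hence "fps_nth (fps_deriv (fps_deriv wp_fps)) m = 12 * fps_nth wp_fps (m + 2) +
     6 * fps_nth (wp_fps * wp_fps) m - invariant_g2 \<Omega> / 2 * (if m = 0 then 1 else 0)"
    by (simp add: fps_X_power_mult_nth fps_X_power_nth)
  moreover have "fps_nth (fps_deriv (fps_deriv wp_fps)) m = of_nat ((m + 1) * (m + 2)) * fps_nth wp_fps (m + 2)"
    by (simp add: algebra_simps)
  moreover have "fps_nth (wp_fps * wp_fps) m = (\<Sum>i\<le>m. fps_nth wp_fps i * fps_nth wp_fps (m - i))"
    by (simp add: fps_mult_nth atLeast0AtMost)
  ultimately show ?thesis by (simp only: left_diff_distrib) simp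
qed

end

text \<open>Coefficients 0, 1 and 4 are known, the last one through g3, and the recursion supplies
  the others from g2. Equal expansions at 0 give equal functions and thus equal pole sets.\<close>

lemma lattice_eqI:
  assumes "complex_lattice a b \<Omega>" "complex_lattice c d \<Omega>'"
    and "invariant_g2 \<Omega> = invariant_g2 \<Omega>'" "invariant_g3 \<Omega> = invariant_g3 \<Omega>'"
  shows "\<Omega> = \<Omega>'"
proof -
  interpret A: complex_lattice a b \<Omega> by fact
  interpret B: complex_lattice c d \<Omega>' by fact
  have "fps_nth A.wp_fps n = fps_nth B.wp_fps n" for n
  proof (induction n rule: less_induct)
    case (less n)
    consider "n = 0" | "n = Suc 0" | "n = 4" | m where "n = m + 2" "m \<noteq> 2"
      by (cases n; cases "n - 1"; force)
    thus ?case
    proof cases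
      case (4 m)
      have "(\<Sum>i\<le>m. fps_nth A.wp_fps i * fps_nth A.wp_fps (m - i)) =
            (\<Sum>i\<le>m. fps_nth B.wp_fps i * fps_nth B.wp_fps (m - i))"
        by (intro sum.cong) (use 4 less in auto)
      hence *: "(of_nat ((m + 1) * (m + 2)) - 12) * fps_nth A.wp_fps (m + 2) =
             (of_nat ((m + 1) * (m + 2)) - 12) * fps_nth B.wp_fps (m + 2)"
        unfolding A.wp_fps_rec B.wp_fps_rec using assms(3) by simp
      have "(m + 1) * (m + 2) \<noteq> 12"
      proof
        assume eq: "(m + 1) * (m + 2) = 12"
        have "m < 2 \<or> m > 2" using 4 by auto
        thus False
        proof
          assume "m < 2"
          hence "(m + 1) * (m + 2) < 3 * 4" by (intro mult_strict_mono) auto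
          thus False using eq by simp
        next
          assume "m > 2"
          hence "(m + 1) * (m + 2) > 3 * 4" by (intro mult_strict_mono) auto
          thus False using eq by simp
        qed
      qed
      hence "of_nat ((m + 1) * (m + 2)) \<noteq> (of_nat 12 :: complex)" by (simp only: of_nat_eq_iff not_False_eq_True)
      hence "of_nat ((m + 1) * (m + 2)) - 12 \<noteq> (0 :: complex)" by simp
      with * show ?thesis using 4 by simp
    qed (simp_all add: A.wp_fps_0 B.wp_fps_0 A.wp_fps_1 B.wp_fps_1 A.wp_fps_4 B.wp_fps_4 assms(4))
  qed
  hence U: "A.wp_fps = B.wp_fps" by (simp add: fps_eq_iff)
  have "eventually (\<lambda>z. eval_fps A.wp_fps z = A.wp_reg z) (nhds 0)"
       "eventually (\<lambda>z. eval_fps A.wp_fps z = B.wp_reg z) (nhds 0)"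
    using A.wp_reg_fps B.wp_reg_fps U by (auto simp: has_fps_expansion_def)
  hence "eventually (\<lambda>z. A.wp z = B.wp z) (nhds 0)"
    by eventually_elim (simp add: A.wp_eq B.wp_eq)
  hence ev: "eventually (\<lambda>z. A.wp z = B.wp z) (at 0)"
    by (rule filter_leD[OF at_within_le_nhds])
  \<comment> \<open>Being a pole depends only on a punctured neighbourhood, so the identity theorem
    suffices.\<close>
  have "is_pole A.wp p \<longleftrightarrow> is_pole B.wp p" for p
    by (intro is_pole_cong meromorphic_identity[OF A.wp_meromorphic B.wp_meromorphic _ _ _ ev])
       (auto intro: connected_UNIV)
  thus ?thesis by (auto simp: A.is_pole_wp_iff B.is_pole_wp_iff)
qed

lemma lattice_of_invariants_eq:
  assumes "complex_lattice a b \<Omega>" "invariant_g2 \<Omega> = g2" "invariant_g3 \<Omega> = g3"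
  shows "lattice_of_invariants g2 g3 = \<Omega>"
  unfolding lattice_of_invariants_def
proof (rule the_equality)
  show "is_lattice \<Omega> \<and> invariant_g2 \<Omega> = g2 \<and> invariant_g3 \<Omega> = g3"
    using assms unfolding is_lattice_def complex_lattice_def by blast
next
  fix \<Omega>' assume *: "is_lattice \<Omega>' \<and> invariant_g2 \<Omega>' = g2 \<and> invariant_g3 \<Omega>' = g3"
  then obtain c d where "complex_lattice c d \<Omega>'"
    unfolding is_lattice_def complex_lattice_def by blast
  thus "\<Omega>' = \<Omega>" using lattice_eqI assms * by metis
qed

subsection \<open>Square lattices\<close>

text \<open>The generators are chosen so that the positive real number \<open>w\<close> is half of
  the period 2w and a centre of a square cell, and so that lattice points are w(m + n + \<i>(m -
  n)), as in the denominators of the coefficient formula.\<close>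

locale square_lattice = complex_lattice "of_real w * (1 + \<i>)" "of_real w * (1 - \<i>)" \<Omega>
  for w :: real and \<Omega> :: "complex set" +
  assumes w_pos: "w > 0"
begin

lemma pt_square:
  "pt (m, n) = of_real w * (of_int m + of_int n + \<i> * (of_int m - of_int n))"
  unfolding pt_def by (simp add: algebra_simps)

lemma ii_in: "z \<in> \<Omega> \<Longrightarrow> \<i> * z \<in> \<Omega>"
proof -
  assume "z \<in> \<Omega>"
  then obtain m n where z: "z = pt (m, n)" by (auto simp: \<Omega>_range)
  have "\<i> * z = pt (n, - m)" unfolding z pt_square by (simp add: algebra_simps)
  thus ?thesis by simp
qed

lemma ii_in_iff: "\<i> * z \<in> \<Omega> \<longleftrightarrow> z \<in> \<Omega>"
  using ii_in[of z] ii_in[of "\<i> * z"] by auto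

lemma cnj_in: "z \<in> \<Omega> \<Longrightarrow> cnj z \<in> \<Omega>"
proof -
  assume "z \<in> \<Omega>"
  then obtain m n where z: "z = pt (m, n)" by (auto simp: \<Omega>_range)
  have "cnj z = pt (n, m)" unfolding z pt_square by (simp add: algebra_simps)
  thus ?thesis by simp
qed

lemma real_not_in:
  assumes "0 < t" "t < 2 * w"
  shows "of_real t \<notin> \<Omega>"
proof
  assume "of_real t \<in> \<Omega>"
  then obtain m n where "of_real t = pt (m, n)" by (auto simp: \<Omega>_range)
  hence "t = w * (of_int m + of_int n)" "0 = w * (of_int m - of_int n)"
    unfolding pt_square by (auto simp: complex_eq_iff)
  hence "m = n" "t = 2 * w * of_int m" using w_pos by auto
  hence "0 < w * real_of_int m" "w * real_of_int m < w * 1" using assms by auto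
  hence "0 < real_of_int m" "real_of_int m < 1"
    using w_pos by (simp_all add: zero_less_mult_iff mult_less_cancel_left)
  thus False by simp
qed

lemma w_not_in: "of_real w \<notin> \<Omega>" using real_not_in[of w] w_pos by simp

lemma two_w_in: "2 * of_real w \<in> \<Omega>"
  using pt_in[of "(1, 1)"] unfolding pt_square by (simp add: mult.commute)

lemma wp_ii: "wp (\<i> * z) = - wp z"
proof -
  have "wp_reg (\<i> * z) = (\<Sum>\<^sub>\<infinity>\<omega>\<in>\<Omega> - {0}. - (1 / (z - \<omega>) ^ 2 - 1 / \<omega> ^ 2))"
    unfolding wp_reg_def
  proof (rule infsum_reindex_bij_witness[where j = "\<lambda>\<omega>. - \<i> * \<omega>" and i = "\<lambda>\<omega>. \<i> * \<omega>"])
    fix a :: complex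
    have "(\<i> * z - a) ^ 2 = - ((z - (- \<i> * a)) ^ 2)" "a ^ 2 = - ((- \<i> * a) ^ 2)"
      by (simp_all add: power2_eq_square algebra_simps)
    thus "- (1 / (z - (- \<i> * a))\<^sup>2 - 1 / (- \<i> * a)\<^sup>2) = 1 / (\<i> * z - a)\<^sup>2 - 1 / a\<^sup>2"
      by simp
    show "- \<i> * a \<in> \<Omega> - {0}" if "a \<in> \<Omega> - {0}" using that ii_in_iff by auto
    show "\<i> * a \<in> \<Omega> - {0}" if "a \<in> \<Omega> - {0}" using that ii_in_iff by auto
  qed auto
  also have "\<dots> = - wp_reg z" unfolding wp_reg_def by (rule infsum_uminus)
  finally show ?thesis by (simp add: wp_eq power_mult_distrib)
qed

lemma wp_cnj: "wp (cnj z) = cnj (wp z)"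
proof -
  have "wp_reg (cnj z) = (\<Sum>\<^sub>\<infinity>\<omega>\<in>\<Omega> - {0}. cnj (1 / (z - \<omega>) ^ 2 - 1 / \<omega> ^ 2))"
    unfolding wp_reg_def
    by (rule infsum_reindex_bij_witness[where i = cnj and j = cnj]) (auto simp: cnj_in)
  also have "\<dots> = cnj (wp_reg z)" unfolding wp_reg_def by (rule infsum_cnj)
  finally show ?thesis by (simp add: wp_eq)
qed

lemma E_cnj: "E k (cnj z) = cnj (E k z)"
proof -
  have "E k (cnj z) = (\<Sum>\<^sub>\<infinity>\<omega>\<in>\<Omega>. cnj (1 / (z - \<omega>) ^ k))"
    unfolding E_on_def
    by (rule infsum_reindex_bij_witness[where i = cnj and j = cnj]) (auto simp: cnj_in)
  also have "\<dots> = cnj (E k z)" unfolding E_on_def by (rule infsum_cnj)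
  finally show ?thesis .
qed

text \<open>The points w and \<i>w differ by the period w(1 - \<i>), whereas multiplication by \<i>
  changes the sign of wp.\<close>

lemma wp_w: "wp (of_real w) = 0"
proof -
  have "wp (\<i> * of_real w + of_real w * (1 - \<i>)) = wp (\<i> * of_real w)"
    by (rule wp_periodic) (use w_not_in ii_in_iff in auto)
  hence "wp (of_real w) = - wp (of_real w)" unfolding wp_ii by (simp add: algebra_simps)
  thus ?thesis by simp
qed

text \<open>E_3 is odd, and w and -w differ by the period 2w.\<close>

lemma E3_w: "E 3 (of_real w) = 0"
proof -
  have "E 3 (- of_real w + 2 * of_real w) = E 3 (- of_real w)"
    using two_w_in by (rule E_periodic)
  thus ?thesis by (simp add: E_uminus)
qed

lemma g3_eq_0: "invariant_g3 \<Omega> = 0"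
proof -
  have "(\<Sum>\<^sub>\<infinity>\<omega>\<in>\<Omega> - {0}. 1 / \<omega> ^ 6) = (\<Sum>\<^sub>\<infinity>\<omega>\<in>\<Omega> - {0}. - (1 / \<omega> ^ 6))"
  proof (rule infsum_reindex_bij_witness[where j = "\<lambda>\<omega>. - \<i> * \<omega>" and i = "\<lambda>\<omega>. \<i> * \<omega>"])
    fix a :: complex
    show "- \<i> * a \<in> \<Omega> - {0}" if "a \<in> \<Omega> - {0}" using that ii_in_iff by auto
    show "\<i> * a \<in> \<Omega> - {0}" if "a \<in> \<Omega> - {0}" using that ii_in_iff by auto
    have "(- \<i>) ^ 6 = - 1" by (simp add: eval_nat_numeral)
    thus "- (1 / (- \<i> * a) ^ 6) = 1 / a ^ 6" by (simp only: power_mult_distrib) simp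
  qed auto
  also have "\<dots> = - (\<Sum>\<^sub>\<infinity>\<omega>\<in>\<Omega> - {0}. 1 / \<omega> ^ 6)" by (rule infsum_uminus)
  finally show ?thesis by (simp add: invariant_g3_def)
qed

lemma g2_real: "invariant_g2 \<Omega> = of_real (Re (invariant_g2 \<Omega>))"
proof -
  have "(\<Sum>\<^sub>\<infinity>\<omega>\<in>\<Omega> - {0}. 1 / \<omega> ^ 4) = (\<Sum>\<^sub>\<infinity>\<omega>\<in>\<Omega> - {0}. cnj (1 / \<omega> ^ 4))"
    by (rule infsum_reindex_bij_witness[where i = cnj and j = cnj]) (auto simp: cnj_in)
  also have "\<dots> = cnj (\<Sum>\<^sub>\<infinity>\<omega>\<in>\<Omega> - {0}. 1 / \<omega> ^ 4)" by (rule infsum_cnj)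
  finally have "cnj (invariant_g2 \<Omega>) = invariant_g2 \<Omega>" by (simp add: invariant_g2_def)
  thus ?thesis by (metis Reals_cnj_iff of_real_Re)
qed

text \<open>The derivative of the difference of both sides vanishes by \<open>wp_ode\<close>. The
  constant is read off at w, where wp and wp' are zero.\<close>

lemma wp_first_integral:
  assumes "z \<notin> \<Omega>"
  shows "(- 2 * E 3 z) ^ 2 = 4 * wp z ^ 3 - invariant_g2 \<Omega> * wp z"
proof -
  define q where "q = (\<lambda>z. (- 2 * E 3 z) ^ 2 - (4 * wp z ^ 3 - invariant_g2 \<Omega> * wp z))"
  have D: "(q has_field_derivative 0) (at x)" if x: "x \<notin> \<Omega>" for x
  proof -
    have E3: "(E 3 has_field_derivative - 3 * E 4 x) (at x)" using E_deriv[OF x, of 3] by simp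
    have "(q has_field_derivative (- 4 * E 3 x) * (6 * E 4 x - (6 * wp x ^ 2 - invariant_g2 \<Omega> / 2))) (at x)"
      unfolding q_def
      by (rule derivative_eq_intros wp_deriv[OF x] E3 refl)+
         (simp add: field_simps power2_eq_square)
    thus ?thesis using wp_ode[OF x] by simp
  qed
  obtain c where c: "\<And>x. x \<in> - \<Omega> \<Longrightarrow> q x = c"
  proof (rule DERIV_zero_connected_constant[OF connected_compl open_compl finite.emptyI])
    show "continuous_on (- \<Omega>) q"
      by (rule DERIV_continuous_on) (use D in \<open>blast intro: has_field_derivative_at_within\<close>)
  qed (use D in auto)
  have "q z = q (of_real w)" using c assms w_not_in by auto
  thus ?thesis by (simp add: q_def wp_w E3_w)
qed

text \<open>The double zeros of \<open>\<wp>(z)\<close> at \<open>w + \<Omega>\<close> cancel the double poles of \<open>\<wp>(z + w)\<close> and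
  conversely, so the product below is an entire elliptic function.\<close>

lemma wp_mult_shift:
  assumes z: "z \<notin> \<Omega>" "z + of_real w \<notin> \<Omega>"
  shows "wp z * wp (z + of_real w) = - invariant_g2 \<Omega> / 4"
proof -
  define W :: complex where "W = of_real w"
  define g where "g = (\<lambda>z. wp (z + W))"
  define S where "S = {z. z + W \<notin> \<Omega>} - (\<Omega> - {0})"
  have WW: "x + W + W = x + 2 * of_real w" for x by (simp add: W_def)
  have W2: "x + W + W \<in> \<Omega> \<longleftrightarrow> x \<in> \<Omega>" for x
    unfolding WW by (rule add_in_iff[OF two_w_in])
  have W: "W \<notin> \<Omega>" using w_not_in by (simp add: W_def)
  have S: "open S" "0 \<in> S"
  proof -
    have "{z. z + W \<notin> \<Omega>} = (\<lambda>z. z + W) -` (- \<Omega>)" by auto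
    moreover have "open ((\<lambda>z. z + W) -` (- \<Omega>))"
      by (intro open_vimage open_compl continuous_intros)
    ultimately show "open S"
      using open_compl_nz unfolding S_def by (metis Diff_eq open_Int)
    show "0 \<in> S" using W by (simp add: S_def)
  qed
  have gD: "(g has_field_derivative - 2 * E 3 (z + W)) (at z)" if "z + W \<notin> \<Omega>" for z
  proof -
    have "((\<lambda>z. wp (z + W)) has_field_derivative (- 2 * E 3 (z + W)) * 1) (at z)"
      by (rule DERIV_chain2[OF wp_deriv]) (use that in \<open>auto intro!: derivative_eq_intros\<close>)
    thus ?thesis by (simp add: g_def)
  qed
  have g: "g holomorphic_on S"
    unfolding holomorphic_on_open[OF S(1)] using gD by (auto simp: S_def)
  have "deriv g 0 = 0" using DERIV_imp_deriv[OF gD[of 0]] W E3_w by (simp add: W_def)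
  moreover have "g 0 = 0" by (simp add: g_def W_def wp_w)
  ultimately obtain v where v: "v holomorphic_on S" "\<And>z. z \<in> S \<Longrightarrow> g z = z ^ 2 * v z"
    "deriv (deriv g) 0 = 2 * v 0"
    using holomorphic_factor_square[OF g S] by metis
  have E3D: "((\<lambda>z. - 2 * E 3 (z + W)) has_field_derivative 6 * E 4 W) (at 0)"
  proof -
    have "((\<lambda>z. E 3 (z + W)) has_field_derivative - of_nat 3 * E (Suc 3) (0 + W) * 1) (at 0)"
      by (rule DERIV_chain2[OF E_deriv]) (use W in \<open>auto intro!: derivative_eq_intros\<close>)
    from DERIV_cmult[OF this, of "- 2"] show ?thesis by simp
  qed
  have "(deriv g has_field_derivative 6 * E 4 W) (at 0)"
    by (rule has_field_derivative_transform_within_open[OF E3D S])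
       (use DERIV_imp_deriv[OF gD] in \<open>auto simp: S_def\<close>)
  hence "2 * v 0 = 6 * E 4 W" using v(3) DERIV_imp_deriv by metis
  \<comment> \<open>As wp(w) = 0, the differential equation gives wp''(w) = -g2/2. Hence wp(z + w)
    behaves like -(g2/4) z^2 at 0, and this times 1/z^2 gives the constant.\<close>
  also have "\<dots> = - invariant_g2 \<Omega> / 2" using wp_ode[OF W] wp_w by (simp add: W_def)
  finally have v0: "v 0 = - invariant_g2 \<Omega> / 4" by (simp add: field_simps)
  define h0 where "h0 = (\<lambda>z. v z + z ^ 2 * wp_reg z * v z)"
  define H where "H = (\<lambda>z. if z \<in> \<Omega> \<or> z + W \<in> \<Omega> then - invariant_g2 \<Omega> / 4 else wp z * wp (z + W))"
  have h0: "h0 holomorphic_on S"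
    unfolding h0_def
    by (intro holomorphic_intros v holomorphic_on_subset[OF wp_reg_holomorphic]) (auto simp: S_def)
  have H_h0: "H z = h0 z" if "z \<in> S" for z
  proof (cases "z = 0")
    case True
    then show ?thesis by (simp add: H_def h0_def v0)
  next
    case False
    hence "H z = (1 / z ^ 2 + wp_reg z) * (z ^ 2 * v z)"
      using that v(2)[OF that] by (simp add: H_def S_def wp_eq[of z] g_def)
    thus ?thesis using False by (simp add: h0_def algebra_simps)
  qed
  have shift: "z + p + W \<in> \<Omega> \<longleftrightarrow> z + W \<in> \<Omega>" "wp (z + p + W) = wp (z + W)" if "p \<in> \<Omega>" "z + W \<notin> \<Omega>" for z p
    using that add_in_iff[of p "z + W"] wp_periodic[of p "z + W"] by (simp_all add: add_ac)
  have per: "H (z + p) = H z" if "p \<in> \<Omega>" for z p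
  proof -
    have "z + p + W \<in> \<Omega> \<longleftrightarrow> z + W \<in> \<Omega>" using add_in_iff[OF that, of "z + W"] by (simp add: add_ac)
    thus ?thesis using that shift[OF that, of z] by (auto simp: H_def add_in_iff wp_periodic)
  qed
  \<comment> \<open>Translation by \<open>W\<close> exchanges the two factors because 2w is a
    period. So differentiability at 0 also settles the points z with z + W in \<Omega>.\<close>
  have perW: "H (z + W) = H z" for z
  proof -
    have "wp (z + W + W) = wp z" if "z \<notin> \<Omega>"
      unfolding WW by (rule wp_periodic[OF two_w_in that])
    thus ?thesis using W2[of z] by (auto simp: H_def)
  qed
  have H0: "H field_differentiable at 0"
  proof -
    obtain D where D: "(h0 has_field_derivative D) (at 0)"
      using h0 S(2) unfolding holomorphic_on_open[OF S(1)] by auto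
    have "(H has_field_derivative D) (at 0)"
      by (rule has_field_derivative_transform_within_open[OF D S]) (use H_h0 in auto)
    thus ?thesis by (auto simp: field_differentiable_def)
  qed
  have sh: "H field_differentiable at z" if zp: "\<And>x. H (x + z) = H x" for z
  proof -
    obtain D where "(H has_field_derivative D) (at 0)"
      using H0 by (auto simp: field_differentiable_def)
    hence "((\<lambda>x. H (x + - z)) has_field_derivative D) (at z)"
      using DERIV_shift[of H D z "- z"] by simp
    moreover have "H (x + - z) = H x" for x using zp[of "x - z"] by simp
    ultimately show ?thesis by (auto simp: field_differentiable_def)
  qed
  have "H field_differentiable at z" for z
  proof -
    consider "z \<in> \<Omega>" | "z + W \<in> \<Omega>" | "z \<notin> \<Omega>" "z + W \<notin> \<Omega>" by blast
    thus ?thesis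
    proof cases
      case 1
      thus ?thesis using sh per by blast
    next
      case 2
      have "H (x + z) = H x" for x
        using per[OF 2, of x] perW[of "x + z"] by (simp add: add.assoc)
      thus ?thesis using sh by blast
    next
      case 3
      have op: "open (- \<Omega> \<inter> (\<lambda>z. z + W) -` (- \<Omega>))"
        by (intro open_Int open_vimage open_compl continuous_intros)
      have "(\<lambda>z. wp z * g z) field_differentiable at z"
        using wp_deriv[OF 3(1)] gD[OF 3(2)]
        by (intro field_differentiable_mult) (auto simp: field_differentiable_def)
      then obtain D where "((\<lambda>z. wp z * g z) has_field_derivative D) (at z)"
        by (auto simp: field_differentiable_def)
      hence "(H has_field_derivative D) (at z)"
        by (rule has_field_derivative_transform_within_open[OF _ op])
           (use 3 in \<open>auto simp: H_def g_def\<close>)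
      thus ?thesis by (auto simp: field_differentiable_def)
    qed
  qed
  hence "H holomorphic_on UNIV" by (auto simp: holomorphic_on_def)
  from periodic_entire_const[OF this per, of z 0] show ?thesis
    using z by (simp add: H_def W_def)
qed

text \<open>If g2 were 0, then wp(z - w) wp(z) would vanish near w although the first factor has a
  pole there; wp would be zero near w, hence everywhere, against its pole at 0.\<close>

lemma g2_nz: "invariant_g2 \<Omega> \<noteq> 0"
proof
  assume g2: "invariant_g2 \<Omega> = 0"
  let ?W = "of_real w :: complex"
  have "eventually (\<lambda>z. wp z = 0) (at ?W)"
  proof -
    have "filterlim (\<lambda>z. wp (z - ?W)) at_infinity (at ?W)"
      using is_pole_wp_iff[of 0] by (simp add: is_pole_def filterlim_at_to_0[of _ _ ?W])
    hence "eventually (\<lambda>z. norm (wp (z - ?W)) \<ge> 1) (at ?W)"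
      by (simp add: filterlim_at_infinity[of 0])
    moreover have "eventually (\<lambda>z. z \<notin> \<Omega>) (at ?W)" by (rule eventually_not_in_\<Omega>)
    moreover have "eventually (\<lambda>z. z - ?W \<notin> \<Omega>) (at ?W)"
      using eventually_not_in_\<Omega>[of 0] unfolding at_to_0[of ?W] eventually_filtermap by simp
    ultimately show ?thesis
    proof eventually_elim
      case (elim z)
      hence "wp (z - ?W) * wp z = 0" using wp_mult_shift[of "z - ?W"] g2 by simp
      thus ?case using elim by auto
    qed
  qed
  hence "eventually (\<lambda>z. wp z = 0) (at 0)"
    by (rule meromorphic_identity[OF wp_meromorphic meromorphic_on_const, rotated 3])
       (auto intro: connected_UNIV)
  hence "is_pole wp 0 \<longleftrightarrow> is_pole (\<lambda>_. 0 :: complex) (0 :: complex)" by (intro is_pole_cong) auto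
  thus False using is_pole_wp_iff[of 0] by simp
qed

end

subsection \<open>The lemniscate constant\<close>

lemma integral_has_real_derivative_interior:
  fixes f :: "real \<Rightarrow> real"
  assumes "f integrable_on {a..b}" "x \<in> {a<..<b}" "isCont f x"
  shows "((\<lambda>u. integral {a..u} f) has_real_derivative f x) (at x)"
proof -
  have "((\<lambda>u. integral {a..u} f) has_vector_derivative f x) (at x within ({a..b} - {}))"
    by (rule integral_has_vector_derivative_continuous_at[OF assms(1)])
       (use assms in \<open>auto intro: continuous_at_imp_continuous_within\<close>)
  hence "((\<lambda>u. integral {a..u} f) has_real_derivative f x) (at x within {a..b})"
    by (simp add: has_real_derivative_iff_has_vector_derivative)
  moreover have "at x within {a..b} = at x"
    using assms by (intro at_within_interior) auto
  ultimately show ?thesis by simp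
qed

text \<open>The substitution u = t^4 turns the integrand into a quarter of the Beta integrand. Both
  are singular at endpoints, so derivatives are taken in the interior only, with continuity up to
  the boundary.\<close>

lemma lemniscate_has_integral:
  "((\<lambda>t::real. 1 / sqrt (1 - t ^ 4)) has_integral Beta (1/4) (1/2) / 4) {0..1}"
proof -
  define f :: "real \<Rightarrow> real" where "f = (\<lambda>t. t powr (1/4 - 1) * (1 - t) powr (1/2 - 1))"
  have B: "(f has_integral Beta (1/4) (1/2)) {0..1}"
    unfolding f_def by (rule has_integral_Beta_real) auto
  hence int: "f integrable_on {0..1}" by blast
  define I where "I = (\<lambda>u. integral {0..u} f)"
  have cI: "continuous_on {0..1} I" unfolding I_def by (rule indefinite_integral_continuous_1[OF int])
  have "((\<lambda>t::real. 1 / sqrt (1 - t ^ 4)) has_integral (I (1 ^ 4) / 4 - I (0 ^ 4) / 4)) {0..1}"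
  proof (rule fundamental_theorem_of_calculus_interior)
    show "continuous_on {0..1} (\<lambda>t. I (t ^ 4) / 4)"
      by (intro continuous_intros continuous_on_compose2[OF cI]) (auto simp: power_le_one)
    fix t :: real assume t: "t \<in> {0<..<1}"
    hence t4: "t ^ 4 \<in> {0<..<1}" by (auto simp: power_less_one_iff)
    have "(I has_real_derivative f (t ^ 4)) (at (t ^ 4))"
      unfolding I_def using t4
      by (intro integral_has_real_derivative_interior[OF int])
         (auto simp: f_def intro!: continuous_intros)
    hence "((\<lambda>t. I (t ^ 4)) has_real_derivative f (t ^ 4) * (4 * t ^ 3)) (at t)"
      by (rule DERIV_chain2) (auto intro!: derivative_eq_intros)
    hence "((\<lambda>t. I (t ^ 4) / 4) has_real_derivative f (t ^ 4) * (4 * t ^ 3) / 4) (at t)"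
      by (rule DERIV_cdivide)
    moreover have "f (t ^ 4) * (4 * t ^ 3) / 4 = 1 / sqrt (1 - t ^ 4)"
    proof -
      have "(t ^ 4) powr (1/4 - 1) = (t powr 4) powr (1/4 - 1)" using t by simp
      also have "\<dots> = t powr (4 * (1/4 - 1))" by (rule powr_powr)
      also have "4 * (1/4 - 1) = - (3 :: real)" by simp
      also have "t powr (- 3) = 1 / t ^ 3" using t by (simp add: powr_minus divide_inverse)
      finally have 1: "(t ^ 4) powr (1/4 - 1) = 1 / t ^ 3" .
      define x where "x = 1 - t ^ 4"
      have x: "x > 0" using t4 by (simp add: x_def)
      have "x powr (1/2 - 1) = x powr (1/2) / x powr 1" by (rule powr_diff)
      also have "\<dots> = 1 / sqrt x" using x by (simp add: powr_half_sqrt field_simps)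
      finally have "f (t ^ 4) = 1 / t ^ 3 * (1 / sqrt x)" unfolding f_def 1 x_def by simp
      thus ?thesis using t by (simp add: x_def)
    qed
    ultimately show "((\<lambda>t. I (t ^ 4) / 4) has_vector_derivative 1 / sqrt (1 - t ^ 4)) (at t)"
      by (simp add: has_real_derivative_iff_has_vector_derivative)
  qed auto
  moreover have "I 1 = Beta (1/4) (1/2)" unfolding I_def using B by (rule integral_unique)
  moreover have "I 0 = 0" by (simp add: I_def)
  ultimately show ?thesis by simp
qed

text \<open>The Beta function yields Gamma(1/4)/Gamma(3/4) times a constant; the reflection formula
  at 1/4 eliminates Gamma(3/4).\<close>

lemma lemniscate_const_eq: "lemniscate_const = Gamma (1/4) ^ 2 / (2 * sqrt (2 * pi))"
proof -
  have "Gamma (1/4 :: complex) * Gamma (1 - 1/4) = of_real pi / sin (of_real pi * (1/4))"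
    by (rule Gamma_reflection_complex)
  also have "sin (of_real pi * (1/4) :: complex) = of_real (sin (pi / 4))"
    by (simp flip: sin_of_real)
  also have "of_real pi / of_real (sin (pi / 4)) = (of_real (pi * sqrt 2) :: complex)"
    by (simp add: sin_45 field_simps flip: of_real_divide of_real_mult)
  also have "Gamma (1/4 :: complex) * Gamma (1 - 1/4) = of_real (Gamma (1/4) * Gamma (3/4))"
    using Gamma_complex_of_real[of "1/4"] Gamma_complex_of_real[of "3/4"] by simp
  finally have r: "Gamma (1/4) * Gamma (3/4) = pi * sqrt 2" by (simp only: of_real_eq_iff)
  have p: "Gamma (1/4 :: real) > 0" "Gamma (3/4 :: real) > 0" by (auto intro: Gamma_real_pos)
  have "lemniscate_const = 2 * (Beta (1/4) (1/2) / 4)"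
    unfolding lemniscate_const_def using integral_unique[OF lemniscate_has_integral] by simp
  also have "\<dots> = Gamma (1/4) * sqrt pi / (2 * Gamma (3/4))"
    by (simp add: Beta_def Gamma_one_half_real)
  also have "\<dots> = Gamma (1/4) ^ 2 * sqrt pi / (2 * (Gamma (1/4) * Gamma (3/4)))"
    using p by (simp add: power2_eq_square)
  also have "\<dots> = Gamma (1/4) ^ 2 / (2 * sqrt (2 * pi))"
    unfolding r using p by (simp add: real_sqrt_mult field_simps)
  finally show ?thesis .
qed

lemma lemniscate_const_pos: "lemniscate_const > 0"
proof -
  have "Gamma (1/4 :: real) > 0" by (rule Gamma_real_pos) auto
  thus ?thesis unfolding lemniscate_const_eq by (intro divide_pos_pos zero_less_power) auto
qed

lemma continuous_nonzero_pos:
  fixes g :: "real \<Rightarrow> real"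
  assumes c: "continuous_on {a<..<b} g" and nz: "\<And>x. x \<in> {a<..<b} \<Longrightarrow> g x \<noteq> 0"
    and x: "x0 \<in> {a<..<b}" "g x0 > 0" "x \<in> {a<..<b}"
  shows "g x > 0"
proof (rule ccontr)
  assume "\<not> g x > 0"
  hence "0 \<in> {g x..g x0}" using x by auto
  moreover have "connected (g ` {a<..<b})"
    by (intro connected_continuous_image c) auto
  ultimately have "0 \<in> g ` {a<..<b}"
    using connected_contains_Icc[of "g ` {a<..<b}" "g x" "g x0"] x by blast
  thus False using nz by auto
qed

context square_lattice
begin

text \<open>Equal to \<open>- 2 \<wp> / \<wp>'\<close>, with the removable singularity at \<open>0\<close> already removed.\<close>

definition slc :: "complex \<Rightarrow> complex" where
  "slc z = z * (1 + z ^ 2 * wp_reg z) / (1 + z ^ 3 * E' 3 z)"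

lemma slc_0 [simp]: "slc 0 = 0" by (simp add: slc_def)

lemma slc_eq:
  assumes "z \<notin> \<Omega>"
  shows "slc z = wp z / E 3 z"
proof -
  have z: "z \<noteq> 0" using assms by auto
  have "wp z = (1 + z ^ 2 * wp_reg z) / z ^ 2" using z by (simp add: wp_eq field_simps)
  moreover have "E 3 z = (1 + z ^ 3 * E' 3 z) / z ^ 3"
    using z E_eq[OF assms, of 3] by (simp add: field_simps)
  ultimately have "wp z / E 3 z = (1 + z ^ 2 * wp_reg z) / (1 + z ^ 3 * E' 3 z) * (z ^ 3 / z ^ 2)"
    by simp
  also have "z ^ 3 / z ^ 2 = z" using z by (simp add: power3_eq_cube power2_eq_square)
  finally show ?thesis by (simp add: slc_def)
qed

lemma slc_deriv_0: "(slc has_field_derivative 1) (at 0)"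
proof -
  have "(wp_reg has_field_derivative - 2 * E' 3 0) (at 0)" by (rule wp_reg_deriv) auto
  moreover have "(E' 3 has_field_derivative - of_nat 3 * E' (Suc 3) 0) (at 0)" by (rule E'_deriv) auto
  ultimately show ?thesis
    unfolding slc_def[abs_def] by (auto intro!: derivative_eq_intros)
qed

lemma E3_square:
  assumes "z \<notin> \<Omega>"
  shows "E 3 z ^ 2 = wp z * (wp z ^ 2 - invariant_g2 \<Omega> / 4)"
proof -
  have "4 * E 3 z ^ 2 = 4 * (wp z * (wp z ^ 2 - invariant_g2 \<Omega> / 4))"
    using wp_first_integral[OF assms]
    by (simp add: power_mult_distrib algebra_simps power2_eq_square power3_eq_cube)
  thus ?thesis by simp
qed

text \<open>With wp'^2 = 4 wp (wp^2 - g) the quotient rule simplifies. The last claim is (wp^2 +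
  g)^2 = (wp^2 - g)^2 + 4 g wp^2 divided by (wp^2 - g)^2.\<close>

lemma slc_deriv:
  assumes z: "z \<notin> \<Omega>" "E 3 z \<noteq> 0"
  defines "g \<equiv> invariant_g2 \<Omega> / 4"
  shows "(slc has_field_derivative (wp z ^ 2 + g) / (wp z ^ 2 - g)) (at z)"
    and "slc z ^ 2 = wp z / (wp z ^ 2 - g)"
    and "((wp z ^ 2 + g) / (wp z ^ 2 - g)) ^ 2 = 1 + invariant_g2 \<Omega> * slc z ^ 4"
proof -
  have E3: "E 3 z ^ 2 = wp z * (wp z ^ 2 - g)" using E3_square[OF z(1)] by (simp add: g_def)
  hence nz: "wp z \<noteq> 0" "wp z ^ 2 - g \<noteq> 0" using z(2) by auto
  have "6 * E 4 z = 6 * wp z ^ 2 - 2 * g" using wp_ode[OF z(1)] by (simp add: g_def)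
  hence E4: "3 * E 4 z = 3 * wp z ^ 2 - g" 
  proof -
    have "3 * E 4 z = 6 * E 4 z / 2" by simp
    also have "\<dots> = 3 * wp z ^ 2 - g"
      unfolding \<open>6 * E 4 z = 6 * wp z ^ 2 - 2 * g\<close> by (simp add: diff_divide_distrib)
    finally show ?thesis .
  qed
  have "((\<lambda>z. wp z / E 3 z) has_field_derivative
      (- 2 * E 3 z * E 3 z - wp z * (- of_nat 3 * E (Suc 3) z)) / (E 3 z * E 3 z)) (at z)"
    by (intro DERIV_divide wp_deriv E_deriv) (use z in auto)
  also have "- 2 * E 3 z * E 3 z - wp z * (- of_nat 3 * E (Suc 3) z) = - 2 * E 3 z ^ 2 + wp z * (3 * E 4 z)"
    by (simp add: power2_eq_square algebra_simps)
  also have "\<dots> = wp z * (wp z ^ 2 + g)" unfolding E3 E4 by (simp add: algebra_simps)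
  also have "E 3 z * E 3 z = wp z * (wp z ^ 2 - g)" using E3 by (simp add: power2_eq_square)
  finally have "((\<lambda>z. wp z / E 3 z) has_field_derivative (wp z ^ 2 + g) / (wp z ^ 2 - g)) (at z)"
    using nz by simp
  thus "(slc has_field_derivative (wp z ^ 2 + g) / (wp z ^ 2 - g)) (at z)"
    by (rule has_field_derivative_transform_within_open[OF _ open_compl]) (use z slc_eq in auto)
  have "slc z ^ 2 = wp z ^ 2 / E 3 z ^ 2" using slc_eq[OF z(1)] by (simp add: power_divide)
  also have "\<dots> = wp z / (wp z ^ 2 - g)" unfolding E3 using nz by (simp add: power2_eq_square)
  finally show sq: "slc z ^ 2 = wp z / (wp z ^ 2 - g)" .
  have "slc z ^ 4 = (slc z ^ 2) ^ 2" by (simp flip: power_mult)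
  also have "\<dots> = wp z ^ 2 / (wp z ^ 2 - g) ^ 2" unfolding sq by (simp add: power_divide)
  finally have "1 + invariant_g2 \<Omega> * slc z ^ 4 = ((wp z ^ 2 - g) ^ 2 + 4 * g * wp z ^ 2) / (wp z ^ 2 - g) ^ 2"
    using nz by (simp add: g_def add_divide_distrib)
  also have "(wp z ^ 2 - g) ^ 2 + 4 * g * wp z ^ 2 = (wp z ^ 2 + g) ^ 2"
    by (simp add: power2_eq_square algebra_simps)
  finally show "((wp z ^ 2 + g) / (wp z ^ 2 - g)) ^ 2 = 1 + invariant_g2 \<Omega> * slc z ^ 4"
    by (simp add: power_divide)
qed

text \<open>For \<kappa>^4 = -g2 the function y = \<kappa> \<open>slc\<close> satisfies y'^2 =
  \<kappa>^2 (1 - y^4) and climbs from 0 to 1 on [0, w/2]. Hence the lemniscate integral from 0 to 1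
  equals \<kappa> w/2.\<close>

lemma lemniscate_period:
  obtains \<kappa> where "\<kappa> > 0" "invariant_g2 \<Omega> = - of_real (\<kappa> ^ 4)" "lemniscate_const = \<kappa> * w"
proof -
  define \<phi> where "\<phi> = (\<lambda>x. Re (wp (of_real x)))"
  define e where "e = (\<lambda>x. Re (E 3 (of_real x)))"
  define G where "G = - Re (invariant_g2 \<Omega>)"
  have g2: "invariant_g2 \<Omega> = - of_real G" using g2_real by (simp add: G_def)
  have wp_r: "wp (of_real x) = of_real (\<phi> x)" for x
    using wp_cnj[of "of_real x"] unfolding \<phi>_def by (metis Reals_cnj_iff complex_cnj_complex_of_real of_real_Re)
  have E_r: "E 3 (of_real x) = of_real (e x)" for x
    using E_cnj[of 3 "of_real x"] unfolding e_def by (metis Reals_cnj_iff complex_cnj_complex_of_real of_real_Re)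
  have D\<phi>: "(\<phi> has_real_derivative - 2 * e x) (at x)" if "0 < x" "x < 2 * w" for x
  proof -
    have "((\<lambda>x. wp (of_real x)) has_vector_derivative - 2 * E 3 (of_real x)) (at x)"
      by (intro has_vector_derivative_real_field wp_deriv real_not_in that)
    from has_field_derivative_Re[OF this] show ?thesis by (simp add: \<phi>_def e_def)
  qed
  have ce: "isCont e x" if "0 < x" "x < 2 * w" for x
  proof -
    have "((\<lambda>x. E 3 (of_real x)) has_vector_derivative - of_nat 3 * E (Suc 3) (of_real x)) (at x)"
      by (intro has_vector_derivative_real_field E_deriv real_not_in that) auto
    from DERIV_isCont[OF has_field_derivative_Re[OF this]] show ?thesis by (simp add: e_def)
  qed
  have e2: "e x ^ 2 = \<phi> x * (\<phi> x ^ 2 + G / 4)" if "0 < x" "x < 2 * w" for x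
  proof -
    have "of_real (e x ^ 2) = (of_real (\<phi> x * (\<phi> x ^ 2 + G / 4)) :: complex)"
      using E3_square[OF real_not_in[OF that]] by (simp add: wp_r E_r g2)
    thus ?thesis by (simp only: of_real_eq_iff)
  qed
  \<comment> \<open>At z = w/2 the shifted point 3w/2 is congruent to -w/2, so by evenness the
    constant product is a square. As the value is real, this also gives the sign of
    \<open>G\<close>.\<close>
  have mid: "\<phi> (w / 2) ^ 2 = G / 4"
  proof -
    have h: "of_real (w / 2) \<notin> \<Omega>" by (rule real_not_in) (use w_pos in auto)
    have "of_real (w / 2) + of_real w = (of_real (3 * w / 2) :: complex)" by simp
    moreover have "of_real (3 * w / 2) \<notin> \<Omega>" by (rule real_not_in) (use w_pos in auto)
    moreover have "wp (of_real (3 * w / 2)) = wp (of_real (w / 2))"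
    proof -
      have "wp (- of_real (w / 2) + 2 * of_real w) = wp (- of_real (w / 2))"
        by (rule wp_periodic[OF two_w_in]) (use h in simp)
      thus ?thesis by (simp only: wp_uminus) (simp add: algebra_simps)
    qed
    ultimately have "wp (of_real (w / 2)) * wp (of_real (w / 2)) = - invariant_g2 \<Omega> / 4"
      using wp_mult_shift[OF h] by simp
    hence "of_real (\<phi> (w / 2) ^ 2) = (of_real (G / 4) :: complex)"
      unfolding wp_r g2 by (simp add: power2_eq_square)
    thus ?thesis by (simp only: of_real_eq_iff)
  qed
  have "G \<noteq> 0" using g2 g2_nz by auto
  moreover have "G \<ge> 0" using mid by (metis zero_le_power2 zero_le_divide_iff zero_le_numeral not_numeral_le_zero)
  ultimately have G: "G > 0" by simp
  \<comment> \<open>A zero would annihilate the product wp(x) wp(x + w), which is the nonzero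
    constant -g2/4.\<close>
  have \<phi>_nz: "\<phi> x \<noteq> 0" if "0 < x" "x < w" for x
  proof
    assume "\<phi> x = 0"
    hence "wp (of_real x) = 0" by (simp add: wp_r)
    moreover have "wp (of_real x) * wp (of_real x + of_real w) = - invariant_g2 \<Omega> / 4"
      using real_not_in[of x] real_not_in[of "x + w"] that by (intro wp_mult_shift) auto
    ultimately show False using g2_nz by simp
  qed
  have \<phi>_cont: "continuous_on {0<..<w} \<phi>"
    by (intro continuous_at_imp_continuous_on ballI DERIV_isCont[OF D\<phi>]) auto
  \<comment> \<open>Close to 0 the term 1/x^2 dominates \<open>wp_reg\<close>, which tends to
    0.\<close>
  have "\<exists>x0\<in>{0<..<w}. \<phi> x0 > 0"
  proof -
    have "isCont wp_reg 0" by (rule DERIV_isCont[OF wp_reg_deriv]) auto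
    hence "wp_reg \<midarrow>0\<rightarrow> 0" by (simp add: isCont_def)
    hence "eventually (\<lambda>z. dist (wp_reg z) 0 < 1) (at 0)" by (rule tendstoD) simp
    then obtain d where d: "d > 0" "\<And>z. z \<noteq> 0 \<Longrightarrow> norm z < d \<Longrightarrow> norm (wp_reg z) < 1"
      by (auto simp: eventually_at)
    define x where "x = min (min (d / 2) (w / 2)) 1"
    have x: "x > 0" "x < d" "x < w" "x \<le> 1" using d w_pos by (auto simp: x_def min_def)
    have "\<phi> x = 1 / x ^ 2 + Re (wp_reg (of_real x))"
      unfolding \<phi>_def wp_eq by (simp flip: of_real_power of_real_divide)
    moreover have "\<bar>Re (wp_reg (of_real x))\<bar> < 1"
      using abs_Re_le_cmod[of "wp_reg (of_real x)"] d(2)[of "of_real x"] x by auto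
    moreover have "1 / x ^ 2 \<ge> 1" using x by (simp add: power_le_one)
    ultimately have "\<phi> x > 0" by linarith
    thus ?thesis using x by auto
  qed
  then obtain x0 where x0: "x0 \<in> {0<..<w}" "\<phi> x0 > 0" by blast
  have \<phi>_pos: "\<phi> x > 0" if "0 < x" "x < w" for x
    by (rule continuous_nonzero_pos[OF \<phi>_cont _ x0]) (use \<phi>_nz that in auto)
  have e_nz: "e x \<noteq> 0" if "0 < x" "x < w" for x
  proof -
    have "\<phi> x * (\<phi> x ^ 2 + G / 4) > 0"
      using \<phi>_pos[OF that] G by (intro mult_pos_pos add_nonneg_pos) auto
    thus ?thesis using e2[of x] that by auto
  qed
  \<comment> \<open>Here wp' = -2e. Were \<open>e\<close> negative somewhere, it would be so on the
    whole interval, and \<phi> would increase from a positive value at w/2 to 0 at w.\<close>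
  have e_pos: "e x > 0" if x: "0 < x" "x < w" for x
  proof (rule ccontr)
    assume "\<not> e x > 0"
    hence neg: "- e x > 0" using e_nz[OF x] by auto
    have c: "continuous_on {0<..<w} (\<lambda>x. - e x)"
      by (intro continuous_at_imp_continuous_on ballI continuous_minus ce) auto
    have neg': "- e y > 0" if "0 < y" "y < w" for y
      by (rule continuous_nonzero_pos[OF c, of x]) (use neg x e_nz that in auto)
    have "\<phi> (w / 2) < \<phi> w"
    proof (rule DERIV_pos_imp_increasing_open[where f = \<phi>])
      show "w / 2 < w" using w_pos by simp
      show "\<exists>y. DERIV \<phi> x :> y \<and> y > 0" if "w / 2 < x" "x < w" for x
        using D\<phi>[of x] neg'[of x] that w_pos by (intro exI[of _ "- 2 * e x"]) auto
      show "continuous_on {w / 2..w} \<phi>"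
        by (intro continuous_at_imp_continuous_on ballI DERIV_isCont[OF D\<phi>]) (use w_pos in auto)
    qed
    moreover have "\<phi> w = 0" using wp_w by (simp add: \<phi>_def)
    moreover have "\<phi> (w / 2) > 0" using w_pos by (intro \<phi>_pos) auto
    ultimately show False by simp
  qed
  define \<kappa> where "\<kappa> = sqrt (sqrt G)"
  have \<kappa>: "\<kappa> > 0" "\<kappa> ^ 2 = sqrt G" "\<kappa> ^ 4 = G"
  proof -
    show "\<kappa> > 0" "\<kappa> ^ 2 = sqrt G" using G by (simp_all add: \<kappa>_def)
    have "\<kappa> ^ 4 = (\<kappa> ^ 2) ^ 2" by (simp flip: power_mult)
    thus "\<kappa> ^ 4 = G" using G by (simp add: \<open>\<kappa> ^ 2 = sqrt G\<close>)
  qed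
  define f where "f = (\<lambda>x. Re (slc (of_real x)))"
  have f_eq: "f x = \<phi> x / e x" if "0 < x" "x < 2 * w" for x
    unfolding f_def slc_eq[OF real_not_in[OF that]] wp_r E_r by (simp flip: of_real_divide)
  have slc_r: "slc (of_real x) = of_real (f x)" if "0 < x" "x < 2 * w" for x
    unfolding f_eq[OF that] slc_eq[OF real_not_in[OF that]] wp_r E_r by simp
  have f0: "f 0 = 0" by (simp add: f_def)
  have f_pos: "f x > 0" if "0 < x" "x < w" for x
    using f_eq[of x] \<phi>_pos[OF that] e_pos[OF that] that w_pos by simp
  define df where "df = (\<lambda>x. (\<phi> x ^ 2 - G / 4) / (\<phi> x ^ 2 + G / 4))"
  have Df: "(f has_real_derivative df x) (at x)" and df2: "df x ^ 2 = 1 - (\<kappa> * f x) ^ 4"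
    and f2: "f x ^ 2 = \<phi> x / (\<phi> x ^ 2 + G / 4)" if x: "0 < x" "x < w" for x
  proof -
    have nin: "of_real x \<notin> \<Omega>" by (rule real_not_in) (use x in auto)
    have enz: "E 3 (of_real x) \<noteq> 0" using e_nz[OF x] by (simp add: E_r)
    note S = slc_deriv[OF nin enz]
    have d: "(wp (of_real x) ^ 2 + invariant_g2 \<Omega> / 4) / (wp (of_real x) ^ 2 - invariant_g2 \<Omega> / 4) = of_real (df x)"
      by (simp add: wp_r g2 df_def)
    have "((\<lambda>x. slc (of_real x)) has_vector_derivative of_real (df x)) (at x)"
      by (rule has_vector_derivative_real_field) (use S(1) d in simp)
    from has_field_derivative_Re[OF this] show "(f has_real_derivative df x) (at x)" by (simp add: f_def)
    have s: "slc (of_real x) = of_real (f x)" using x w_pos by (intro slc_r) auto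
    have "of_real (df x ^ 2) = (of_real (1 - (\<kappa> * f x) ^ 4) :: complex)"
      using S(3)[unfolded d s] unfolding g2 by (simp add: power_mult_distrib \<kappa> flip: of_real_power)
    thus "df x ^ 2 = 1 - (\<kappa> * f x) ^ 4" by (simp only: of_real_eq_iff)
    have "of_real (f x ^ 2) = (of_real (\<phi> x / (\<phi> x ^ 2 + G / 4)) :: complex)"
      using S(2) unfolding s g2 wp_r by simp
    thus "f x ^ 2 = \<phi> x / (\<phi> x ^ 2 + G / 4)" by (simp only: of_real_eq_iff)
  qed
  have \<phi>mid: "\<phi> (w / 2) = sqrt G / 2"
  proof -
    have "sqrt (\<phi> (w / 2) ^ 2) = sqrt G / 2" unfolding mid by (simp add: real_sqrt_divide)
    thus ?thesis using \<phi>_pos[of "w / 2"] w_pos by simp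
  qed
  \<comment> \<open>With \<phi>(w/2) = sqrt(G)/2 the formula for f^2 gives 1/sqrt(G) = 1/\<kappa>^2,
    so the upper limit of integration is reached at w/2.\<close>
  have fmid: "\<kappa> * f (w / 2) = 1"
  proof -
    have "f (w / 2) ^ 2 = (sqrt G / 2) / (G / 2)" using f2[of "w / 2"] w_pos mid \<phi>mid by simp
    also have "\<dots> = 1 / sqrt G" using G by (simp add: field_simps)
    finally have "(\<kappa> * f (w / 2)) ^ 2 = 1 ^ 2" using G \<kappa> by (simp add: power_mult_distrib)
    moreover have "\<kappa> * f (w / 2) > 0" using f_pos[of "w / 2"] \<kappa> w_pos by simp
    ultimately show ?thesis by (metis less_imp_le power2_eq_imp_eq zero_le_one)
  qed
  \<comment> \<open>\<phi> decreases to sqrt(G)/2 at w/2, so \<phi>^2 > G/4 before it. This selects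
    the positive square root of 1 - (\<kappa> f)^4.\<close>
  have df_pos: "df x > 0" if x: "0 < x" "x < w / 2" for x
  proof -
    have "\<phi> (w / 2) < \<phi> x"
    proof (rule DERIV_neg_imp_decreasing[OF x(2)])
      show "\<exists>y'. DERIV \<phi> y :> y' \<and> y' < 0" if "x \<le> y" "y \<le> w / 2" for y
        using D\<phi>[of y] e_pos[of y] that x w_pos by (intro exI[of _ "- 2 * e y"]) auto
    qed
    hence "\<phi> (w / 2) ^ 2 < \<phi> x ^ 2" using \<phi>_pos[of "w / 2"] w_pos by (intro power_strict_mono) auto
    thus ?thesis using mid G by (simp add: df_def)
  qed
  have \<kappa>f: "0 < \<kappa> * f x" "\<kappa> * f x < 1" if x: "0 < x" "x < w / 2" for x
  proof -
    show "0 < \<kappa> * f x" using f_pos[of x] \<kappa> x w_pos by simp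
    have "df x ^ 2 > 0" using df_pos[OF x] by simp
    hence "(\<kappa> * f x) ^ 4 < 1 ^ 4" using df2[of x] x w_pos by simp
    thus "\<kappa> * f x < 1" by (rule power_less_imp_less_base) simp
  qed
  define h where "h = (\<lambda>t::real. 1 / sqrt (1 - t ^ 4))"
  have hint: "h integrable_on {0..1}" unfolding h_def using lemniscate_has_integral by blast
  define \<Phi> where "\<Phi> = (\<lambda>y. integral {0..y} h)"
  \<comment> \<open>The difference has derivative zero inside the interval and is continuous at its
    ends, where \<open>h\<close> is singular at the value 1.\<close>
  have "\<Phi> (\<kappa> * f (w / 2)) - \<kappa> * (w / 2) = \<Phi> (\<kappa> * f 0) - \<kappa> * 0"
  proof (rule DERIV_isconst_end[where f = "\<lambda>x. \<Phi> (\<kappa> * f x) - \<kappa> * x"])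
    show "0 < w / 2" using w_pos by simp
    have cf: "continuous_on {0..w / 2} f"
    proof (rule continuous_at_imp_continuous_on, rule ballI)
      fix x assume x: "x \<in> {0..w / 2}"
      show "isCont f x"
      proof (cases "x = 0")
        case True
        have "((\<lambda>x. slc (of_real x)) has_vector_derivative 1) (at 0)"
          by (rule has_vector_derivative_real_field) (use slc_deriv_0 in simp)
        from DERIV_isCont[OF has_field_derivative_Re[OF this]] show ?thesis
          using True by (simp add: f_def)
      next
        case False
        then show ?thesis using x w_pos by (intro DERIV_isCont[OF Df]) auto
      qed
    qed
    have c\<Phi>: "continuous_on {0..1} \<Phi>"
      unfolding \<Phi>_def by (rule indefinite_integral_continuous_1[OF hint])
    have im: "\<kappa> * f x \<in> {0..1}" if x: "x \<in> {0..w / 2}" for x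
    proof -
      consider "x = 0" | "x = w / 2" | "0 < x" "x < w / 2" using x by fastforce
      thus ?thesis by cases (use f0 fmid \<kappa>f[of x] in auto)
    qed
    have "continuous_on {0..w / 2} (\<lambda>x. \<Phi> (\<kappa> * f x))"
      by (rule continuous_on_compose2[OF c\<Phi>]) (use im in \<open>auto intro!: continuous_intros cf\<close>)
    thus "continuous_on {0..w / 2} (\<lambda>x. \<Phi> (\<kappa> * f x) - \<kappa> * x)"
      by (intro continuous_intros)
    fix x assume x: "0 < x" "x < w / 2"
    note k = \<kappa>f[OF x]
    have k4: "(\<kappa> * f x) ^ 4 < 1" using k by (simp add: power_less_one_iff)
    have "(\<Phi> has_real_derivative h (\<kappa> * f x)) (at (\<kappa> * f x))"
      unfolding \<Phi>_def using k k4
      by (intro integral_has_real_derivative_interior[OF hint])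
         (auto simp: h_def intro!: continuous_intros)
    moreover have "((\<lambda>x. \<kappa> * f x) has_real_derivative \<kappa> * df x) (at x)"
      by (intro DERIV_cmult Df) (use x w_pos in auto)
    ultimately have "((\<lambda>x. \<Phi> (\<kappa> * f x)) has_real_derivative h (\<kappa> * f x) * (\<kappa> * df x)) (at x)"
      by (rule DERIV_chain2)
    moreover have "h (\<kappa> * f x) = 1 / df x"
    proof -
      have "sqrt (1 - (\<kappa> * f x) ^ 4) = sqrt (df x ^ 2)" using df2[of x] x w_pos by simp
      also have "\<dots> = df x" using df_pos[OF x] by simp
      finally show ?thesis by (simp add: h_def)
    qed
    ultimately have "((\<lambda>x. \<Phi> (\<kappa> * f x)) has_real_derivative \<kappa>) (at x)"
      using df_pos[OF x] by simp
    thus "((\<lambda>x. \<Phi> (\<kappa> * f x) - \<kappa> * x) has_real_derivative 0) (at x)"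
      by (auto intro!: derivative_eq_intros)
  qed
  hence "\<Phi> 1 = \<kappa> * w / 2" unfolding fmid f0 by (simp add: \<Phi>_def)
  hence "lemniscate_const = \<kappa> * w"
    unfolding lemniscate_const_def \<Phi>_def h_def by simp
  thus ?thesis using that[of \<kappa>] \<kappa> g2 by simp
qed

end

subsection \<open>The lemniscate sine\<close>

lemma Re_one_minus_power4_pos:
  assumes "s \<in> ball (0 :: complex) 1"
  shows "Re (1 - s ^ 4) > 0"
proof -
  have "Re (s ^ 4) \<le> norm (s ^ 4)" by (rule complex_Re_le_cmod)
  also have "\<dots> < 1" using assms by (simp add: norm_power power_less_one_iff)
  finally show ?thesis by simp
qed

text \<open>The integrand is holomorphic on the convex disc and so has a primitive there, which
  evaluates the integral along the segment.\<close>

lemma arc_sl_deriv: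
  assumes "s \<in> ball 0 1"
  shows "(arc_sl has_field_derivative 1 / csqrt (1 - s ^ 4)) (at s)"
proof -
  define F where "F = (\<lambda>t::complex. 1 / csqrt (1 - t ^ 4))"
  have np: "1 - t ^ 4 \<notin> \<real>\<^sub>\<le>\<^sub>0" if "t \<in> ball 0 1" for t :: complex
    using Re_one_minus_power4_pos[OF that] by (auto simp: complex_nonpos_Reals_iff)
  have "F holomorphic_on ball 0 1"
    unfolding F_def
  proof (intro holomorphic_intros)
    fix t :: complex assume t: "t \<in> ball 0 1"
    show "1 - t ^ 4 \<notin> \<real>\<^sub>\<le>\<^sub>0" using np[OF t] .
    show "csqrt (1 - t ^ 4) \<noteq> 0" using np[OF t] by auto
  qed
  then obtain g where g: "\<And>x. x \<in> ball 0 1 \<Longrightarrow> (g has_field_derivative F x) (at x within ball 0 1)"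
    using holomorphic_convex_primitive'[OF convex_ball open_ball] by blast
  have eq: "arc_sl x = g x - g 0" if "x \<in> ball 0 1" for x
  proof -
    have "path_image (linepath 0 x) \<subseteq> ball 0 1"
      using that convex_contains_segment[of "ball 0 1 :: complex set"] by (auto simp del: mem_ball)
    hence "(F has_contour_integral g x - g 0) (linepath 0 x)"
      using contour_integral_primitive[OF g, of "linepath 0 x"] by simp
    thus ?thesis unfolding arc_sl_def F_def by (rule contour_integral_unique)
  qed
  have "((\<lambda>x. g x - g 0) has_field_derivative F s) (at s)"
    using g[OF assms] assms by (auto simp: at_within_open[OF assms] intro!: derivative_eq_intros)
  hence "(arc_sl has_field_derivative F s) (at s)"
    by (rule has_field_derivative_transform_within_open[OF _ open_ball assms]) (use eq in auto)
  thus ?thesis by (simp add: F_def)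
qed

lemma arc_sl_0 [simp]: "arc_sl 0 = 0"
  by (simp add: arc_sl_def)

text \<open>This turns equality on a punctured neighbourhood into equality of values: a finite limit
  of the composite excludes a pole of \<open>f\<close> at \<open>c\<close>, and then
  \<open>f\<close> is continuous there.\<close>

lemma eq_limit_of_compose:
  fixes f :: "complex \<Rightarrow> complex" and g h :: "complex \<Rightarrow> complex"
  assumes f: "is_pole f c \<or> f \<midarrow>c\<rightarrow> f c" and g: "filterlim g (at c) (at z)"
    and ev: "eventually (\<lambda>t. f (g t) = h t) (at z)" and h: "(h \<longlongrightarrow> l) (at z)"
  shows "f c = l"
proof -
  have lim: "((\<lambda>t. f (g t)) \<longlongrightarrow> l) (at z)"
    using h by (rule Lim_transform_eventually) (use ev in \<open>auto elim: eventually_mono\<close>)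
  have "\<not> is_pole f c"
  proof
    assume "is_pole f c"
    hence "filterlim (\<lambda>t. f (g t)) at_infinity (at z)"
      unfolding is_pole_def using g by (rule filterlim_compose)
    thus False using lim not_tendsto_and_filterlim_at_infinity[of "at z"] by auto
  qed
  hence "f \<midarrow>c\<rightarrow> f c" using f by blast
  hence "((\<lambda>t. f (g t)) \<longlongrightarrow> f c) (at z)" using g by (rule filterlim_compose)
  thus ?thesis using lim by (intro tendsto_unique[of "at z"]) auto
qed

text \<open>A nonzero derivative keeps g(y) away from g(z) for y near z, so punctured neighbourhoods
  map into punctured ones.\<close>

lemma filterlim_at_of_deriv:
  fixes g :: "complex \<Rightarrow> complex"
  assumes "(g has_field_derivative D) (at z)" "D \<noteq> 0"
  shows "filterlim g (at (g z)) (at z)"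
proof -
  have "g \<midarrow>z\<rightarrow> g z" using DERIV_isCont[OF assms(1)] by (simp add: isCont_def)
  moreover have "(\<lambda>y. (g y - g z) / (y - z)) \<midarrow>z\<rightarrow> D"
    using assms(1) by (simp add: has_field_derivative_iff)
  hence "eventually (\<lambda>y. (g y - g z) / (y - z) \<noteq> 0) (at z)"
    using assms(2) by (rule tendsto_imp_eventually_ne)
  hence "eventually (\<lambda>y. g y \<noteq> g z) (at z)" by eventually_elim auto
  ultimately show ?thesis by (simp add: filterlim_at)
qed

text \<open>Nice meromorphy fixes every value, as 0 at a pole and as the limit elsewhere, so the
  identity theorem becomes equality of functions.\<close>

lemma nicely_meromorphic_eqI:
  assumes f: "f nicely_meromorphic_on UNIV" and g: "g nicely_meromorphic_on UNIV"
    and ev: "eventually (\<lambda>z. f z = g z) (at a)"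
  shows "f = g"
proof
  fix z
  have ev: "eventually (\<lambda>z. f z = g z) (at z)"
    by (rule meromorphic_identity[OF _ _ _ _ _ ev])
       (use f g in \<open>auto simp: nicely_meromorphic_on_def intro: connected_UNIV\<close>)
  hence pole: "is_pole f z \<longleftrightarrow> is_pole g z" by (intro is_pole_cong) auto
  have fz: "is_pole f z \<and> f z = 0 \<or> f \<midarrow>z\<rightarrow> f z" and gz: "is_pole g z \<and> g z = 0 \<or> g \<midarrow>z\<rightarrow> g z"
    using f g by (auto simp: nicely_meromorphic_on_def)
  show "f z = g z"
  proof (cases "is_pole f z")
    case True
    moreover have "\<not> f \<midarrow>z\<rightarrow> f z" "\<not> g \<midarrow>z\<rightarrow> g z"
      using True pole not_tendsto_and_filterlim_at_infinity[of "at z"] by (auto simp: is_pole_def)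
    ultimately show ?thesis using fz gz by simp
  next
    case False
    hence "f \<midarrow>z\<rightarrow> f z" "g \<midarrow>z\<rightarrow> g z" using fz gz pole by auto
    moreover have "eventually (\<lambda>z. g z = f z) (at z)" using ev by eventually_elim simp
    ultimately have "f \<midarrow>z\<rightarrow> f z" "f \<midarrow>z\<rightarrow> g z" by (auto intro: Lim_transform_eventually)
    thus ?thesis by (intro tendsto_unique[of "at z"]) auto
  qed
qed

locale lemniscate_lattice = square_lattice +
  assumes g2: "invariant_g2 \<Omega> = - 1"
begin

text \<open>Off \<Omega> the second condition says E_3(z) is nonzero, that is wp'(z) is nonzero; 0
  is included as the removed singularity.\<close>

definition slc_dom :: "complex set" where
  "slc_dom = {z \<in> - (\<Omega> - {0}). 1 + z ^ 3 * E' 3 z \<noteq> 0}"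

lemma open_slc_dom: "open slc_dom"
proof -
  have "continuous_on (- (\<Omega> - {0})) (\<lambda>z. 1 + z ^ 3 * E' 3 z)"
    by (intro continuous_intros holomorphic_on_imp_continuous_on E'_holomorphic) auto
  from continuous_open_preimage[OF this open_compl_nz, of "- {0}"] show ?thesis
    by (auto simp: slc_dom_def vimage_def Int_def)
qed

lemma zero_in_slc_dom: "0 \<in> slc_dom" by (simp add: slc_dom_def)

lemma slc_holomorphic: "slc holomorphic_on slc_dom"
  unfolding slc_def[abs_def]
  by (intro holomorphic_intros holomorphic_on_subset[OF wp_reg_holomorphic]
        holomorphic_on_subset[OF E'_holomorphic]) (auto simp: slc_dom_def)

lemma slc_ode:
  assumes "z \<in> slc_dom"
  shows "deriv slc z ^ 2 = 1 - slc z ^ 4"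
proof (cases "z = 0")
  case True
  then show ?thesis using DERIV_imp_deriv[OF slc_deriv_0] by simp
next
  case False
  hence z: "z \<notin> \<Omega>" using assms by (auto simp: slc_dom_def)
  have "E 3 z * z ^ 3 = 1 + z ^ 3 * E' 3 z" using False E_eq[OF z, of 3] by (simp add: field_simps)
  hence "E 3 z \<noteq> 0" using assms by (auto simp: slc_dom_def)
  note * = slc_deriv[OF z this]
  show ?thesis using *(3) unfolding DERIV_imp_deriv[OF *(1)] g2 by simp
qed

text \<open>By the chain rule \<open>arc_sl\<close> after \<open>slc\<close> has derivative 1 near
  0. The left inverse makes \<open>slc\<close> injective on a disc, and the open mapping theorem
  gives the inverse relation near 0.\<close>

lemma arc_sl_slc: "eventually (\<lambda>z. slc z \<in> ball 0 1 \<and> arc_sl (slc z) = z) (nhds 0)"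
  and slc_arc_sl: "eventually (\<lambda>s. slc (arc_sl s) = s) (nhds 0)"
proof -
  have "continuous_on slc_dom slc" "continuous_on slc_dom (deriv slc)"
    using slc_holomorphic open_slc_dom by (auto intro!: holomorphic_on_imp_continuous_on holomorphic_deriv)
  hence c: "isCont slc 0" "isCont (deriv slc) 0"
    using open_slc_dom zero_in_slc_dom continuous_on_eq_continuous_at by blast+
  have d0: "deriv slc 0 = 1" using DERIV_imp_deriv[OF slc_deriv_0] .
  have 1: "eventually (\<lambda>z. dist (slc z) 0 < 1) (nhds 0)"
    using tendstoD[OF c(1)[unfolded continuous_within tendsto_at_iff_tendsto_nhds], of 1] by simp
  have 2: "eventually (\<lambda>z. dist (deriv slc z) 1 < 1) (nhds 0)"
    using tendstoD[OF c(2)[unfolded continuous_within tendsto_at_iff_tendsto_nhds], of 1] by (simp add: d0)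
  have 3: "eventually (\<lambda>z. z \<in> slc_dom) (nhds 0)"
    by (rule eventually_nhds_in_open[OF open_slc_dom zero_in_slc_dom])
  from 1 2 3 have "eventually (\<lambda>z. dist (slc z) 0 < 1 \<and> dist (deriv slc z) 1 < 1 \<and> z \<in> slc_dom) (nhds 0)"
    by eventually_elim auto
  then obtain r where r: "r > 0" and ball: "\<And>z. z \<in> ball 0 r \<Longrightarrow> dist (slc z) 0 < 1 \<and> dist (deriv slc z) 1 < 1 \<and> z \<in> slc_dom"
    unfolding eventually_nhds_metric by (auto simp: dist_commute)
  have D: "((\<lambda>z. arc_sl (slc z) - z) has_field_derivative 0) (at z within ball 0 r)" if z: "z \<in> ball 0 r" for z
  proof -
    have b: "slc z \<in> ball 0 1" "z \<in> slc_dom" using ball[OF z] by (auto simp: dist_commute)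
    have "\<bar>Re (deriv slc z) - 1\<bar> < 1"
      using abs_Re_le_cmod[of "deriv slc z - 1"] ball[OF z] by (simp add: dist_norm)
    hence Re: "Re (deriv slc z) > 0" by linarith
    \<comment> \<open>The differential equation determines slc' up to sign; its positive real part
      near 0 identifies it as the principal root.\<close>
    have "csqrt (1 - slc z ^ 4) = deriv slc z"
      unfolding slc_ode[OF b(2), symmetric] using Re by (intro csqrt_square) auto
    hence "(arc_sl has_field_derivative 1 / deriv slc z) (at (slc z))"
      using arc_sl_deriv[OF b(1)] by simp
    moreover have "(slc has_field_derivative deriv slc z) (at z)"
      using slc_holomorphic open_slc_dom b(2) holomorphic_derivI by blast
    ultimately have "((\<lambda>z. arc_sl (slc z)) has_field_derivative 1 / deriv slc z * deriv slc z) (at z)"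
      by (rule DERIV_chain2)
    moreover have "deriv slc z \<noteq> 0" using Re by auto
    ultimately have "((\<lambda>z. arc_sl (slc z)) has_field_derivative 1) (at z)" by simp
    from DERIV_diff[OF this DERIV_ident] show ?thesis
      by (auto intro: has_field_derivative_at_within)
  qed
  obtain k where k: "\<And>z. z \<in> ball 0 r \<Longrightarrow> arc_sl (slc z) - z = k"
    using has_field_derivative_zero_constant[OF convex_ball D] by auto
  have "k = 0" using k[of 0] r by simp
  hence inv: "arc_sl (slc z) = z" if "z \<in> ball 0 r" for z using k[OF that] by simp
  have evr: "eventually (\<lambda>z. z \<in> ball 0 r) (nhds (0::complex))"
    by (rule eventually_nhds_in_open) (use r in auto)
  thus "eventually (\<lambda>z. slc z \<in> ball 0 1 \<and> arc_sl (slc z) = z) (nhds 0)"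
    by eventually_elim (use inv ball in \<open>auto simp: dist_commute\<close>)
  have "inj_on slc (ball 0 r)" by (rule inj_on_inverseI[of _ arc_sl]) (use inv in auto)
  moreover have "slc holomorphic_on ball 0 r"
    by (rule holomorphic_on_subset[OF slc_holomorphic]) (use ball in auto)
  ultimately have "open (slc ` ball 0 r)" by (intro open_mapping_thm3) auto
  moreover have "0 \<in> slc ` ball 0 r" using r by (auto intro!: image_eqI[of _ _ 0])
  ultimately have "eventually (\<lambda>s. s \<in> slc ` ball 0 r) (nhds 0)" by (rule eventually_nhds_in_open)
  thus "eventually (\<lambda>s. slc (arc_sl s) = s) (nhds 0)"
    by eventually_elim (use inv in auto)
qed

text \<open>The formula for \<open>slc\<close> is used near 0 only and takes meaningless values at
  nonzero lattice points. \<open>remove_sings\<close> gives the globally normalised function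
  demanded by the definition of \<open>sl\<close>.\<close>

definition slm :: "complex \<Rightarrow> complex" where
  "slm = remove_sings (\<lambda>z. - 2 * wp z / deriv wp z)"

lemma slm_nicely: "slm nicely_meromorphic_on UNIV"
  unfolding slm_def
  by (intro remove_sings_nicely_meromorphic meromorphic_intros wp_meromorphic)

lemma slm_eq_slc: "eventually (\<lambda>z. slm z = slc z) (nhds 0)"
proof -
  let ?q = "\<lambda>z. - 2 * wp z / deriv wp z"
  have q: "?q meromorphic_on UNIV" by (intro meromorphic_intros wp_meromorphic)
  have "eventually (\<lambda>z. slm z = ?q z) (at 0)"
    unfolding slm_def
    by (intro eventually_remove_sings_eq_at meromorphic_on_isolated_singularity meromorphic_on_subset[OF q]) auto
  moreover have evq: "eventually (\<lambda>z. ?q z = slc z) (at 0)"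
    using eventually_not_in_\<Omega>[of 0]
    by eventually_elim (simp add: slc_eq DERIV_imp_deriv[OF wp_deriv])
  ultimately have "eventually (\<lambda>z. slm z = slc z) (at 0)" by eventually_elim simp
  moreover have "slm 0 = slc 0"
  proof -
    have "slc \<midarrow>0\<rightarrow> slc 0" using DERIV_isCont[OF slc_deriv_0] by (simp add: isCont_def)
    hence "?q \<midarrow>0\<rightarrow> slc 0"
      by (rule Lim_transform_eventually) (use evq in \<open>auto elim: eventually_mono\<close>)
    thus ?thesis unfolding slm_def by (rule remove_sings_eqI)
  qed
  ultimately show ?thesis by (simp add: eventually_nhds_conv_at)
qed

text \<open>The identity near 0 spreads over the unit disc in punctured form. Since arc_sl'(s) is
  nonzero, it then holds at each \<open>s\<close> itself.\<close>

lemma slm_arc_sl: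
  assumes s: "s \<in> ball 0 1"
  shows "slm (arc_sl s) = s"
proof -
  have cont: "isCont arc_sl 0" by (rule DERIV_isCont[OF arc_sl_deriv]) auto
  hence "filterlim arc_sl (nhds (arc_sl 0)) (nhds 0)"
    by (simp only: isCont_def tendsto_at_iff_tendsto_nhds)
  hence "filterlim arc_sl (nhds 0) (nhds 0)" by simp
  hence "eventually (\<lambda>s. slm (arc_sl s) = slc (arc_sl s)) (nhds 0)"
    by (rule eventually_compose_filterlim[OF slm_eq_slc])
  hence "eventually (\<lambda>s. slm (arc_sl s) = s) (nhds 0)"
    using slc_arc_sl by eventually_elim simp
  hence ev0: "eventually (\<lambda>s. slm (arc_sl s) = s) (at 0)"
    by (rule filter_leD[OF at_within_le_nhds])
  have "arc_sl holomorphic_on ball 0 1"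
    unfolding holomorphic_on_open[OF open_ball] using arc_sl_deriv by blast
  hence an: "arc_sl analytic_on ball 0 1" by (simp add: analytic_on_open)
  have ev: "eventually (\<lambda>s. slm (arc_sl s) = s) (at s)"
  proof (rule meromorphic_identity[OF _ _ open_ball _ _ ev0 s])
    show "(\<lambda>s. slm (arc_sl s)) meromorphic_on ball 0 1"
      by (rule meromorphic_on_compose[OF _ an]) (use slm_nicely in \<open>auto simp: nicely_meromorphic_on_def\<close>)
  qed (auto intro: meromorphic_intros)
  have nz: "1 / csqrt (1 - s ^ 4) \<noteq> 0" using Re_one_minus_power4_pos[OF s] by auto
  have "filterlim arc_sl (at (arc_sl s)) (at s)"
    by (rule filterlim_at_of_deriv[OF arc_sl_deriv[OF s] nz])
  thus ?thesis
    by (rule eq_limit_of_compose[where h = "\<lambda>s. s", rotated])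
       (use ev slm_nicely in \<open>auto simp: nicely_meromorphic_on_def\<close>)
qed

lemma sl_eq_slm: "sl = slm"
  unfolding sl_def
proof (rule the_equality)
  show "slm nicely_meromorphic_on UNIV \<and> (\<forall>s\<in>ball 0 1. slm (arc_sl s) = s)"
    using slm_nicely slm_arc_sl by blast
next
  fix f assume f: "f nicely_meromorphic_on UNIV \<and> (\<forall>s\<in>ball 0 1. f (arc_sl s) = s)"
  \<comment> \<open>Any candidate satisfies f(z) = f(arc_sl(slc z)) = slc(z) near 0.\<close>
  have "eventually (\<lambda>z. f z = slm z) (nhds 0)"
    using arc_sl_slc slm_eq_slc by eventually_elim (use f in metis)
  hence "eventually (\<lambda>z. f z = slm z) (at 0)"
    by (rule filter_leD[OF at_within_le_nhds])
  thus "f = slm" using f slm_nicely nicely_meromorphic_eqI by blast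
qed

end

subsection \<open>The generating function\<close>

text \<open>Agreement near 0 extends over the whole disc of convergence even if \<open>f\<close>
  might have poles there: the sum of the series is finite, so a pole is excluded at each
  point.\<close>

lemma eval_T_gf_eqI:
  fixes f :: "complex \<Rightarrow> complex"
  assumes mero: "f meromorphic_on UNIV" and f: "\<And>c. is_pole f c \<or> f \<midarrow>c\<rightarrow> f c"
    and \<alpha>: "\<alpha> \<noteq> 0" and exp: "(\<lambda>z. f (\<alpha> * z + \<beta>)) has_fps_expansion T_gf"
    and z: "ereal (norm z) < fps_conv_radius T_gf"
  shows "eval_fps T_gf z = f (\<alpha> * z + \<beta>)"
proof -
  define D :: "complex set" where "D = eball 0 (fps_conv_radius T_gf)"
  have R: "fps_conv_radius T_gf > 0" and ev: "eventually (\<lambda>z. eval_fps T_gf z = f (\<alpha> * z + \<beta>)) (nhds 0)"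
    using exp by (auto simp: has_fps_expansion_def)
  have D: "z \<in> D" "0 \<in> D" using z R by (auto simp: D_def in_eball_iff zero_ereal_def)
  have an: "eval_fps T_gf analytic_on D"
    unfolding D_def by (intro analytic_intros) (auto simp: in_eball_iff)
  have "eventually (\<lambda>z. f (\<alpha> * z + \<beta>) = eval_fps T_gf z) (at z)"
  proof (rule meromorphic_identity[OF _ _ _ _ D(2) _ D(1)])
    show "(\<lambda>z. f (\<alpha> * z + \<beta>)) meromorphic_on D"
      by (rule meromorphic_on_compose[OF mero]) (auto intro!: analytic_intros)
    show "eval_fps T_gf meromorphic_on D" using an by (rule analytic_on_imp_meromorphic_on)
    show "eventually (\<lambda>z. f (\<alpha> * z + \<beta>) = eval_fps T_gf z) (at 0)"
      using filter_leD[OF at_within_le_nhds ev] by eventually_elim simp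
    show "connected D" unfolding D_def by (rule connected_eball)
  qed (auto simp: D_def)
  moreover have "((\<lambda>z. \<alpha> * z + \<beta>) has_field_derivative \<alpha>) (at z)"
    by (auto intro!: derivative_eq_intros)
  hence "filterlim (\<lambda>z. \<alpha> * z + \<beta>) (at (\<alpha> * z + \<beta>)) (at z)"
    using \<alpha> by (rule filterlim_at_of_deriv)
  moreover have "isCont (eval_fps T_gf) z"
    using an D(1) analytic_at_imp_isCont analytic_on_analytic_at by blast
  hence "eval_fps T_gf \<midarrow>z\<rightarrow> eval_fps T_gf z" by (simp add: isCont_def)
  ultimately show ?thesis using eq_limit_of_compose[OF f] by metis
qed

lemma has_fps_expansion_T_gfI:
  assumes an: "f analytic_on {0}" and init: "f 0 = 0" "deriv f 0 = 0"
    and ode: "eventually (\<lambda>z. deriv (deriv f) z = 1 + f z ^ 2) (nhds 0)"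
  shows "f has_fps_expansion T_gf"
proof -
  define F where "F = fps_expansion f 0"
  have F: "f has_fps_expansion F" unfolding F_def by (rule analytic_at_imp_has_fps_expansion_0[OF an])
  have "deriv (deriv f) has_fps_expansion fps_deriv (fps_deriv F)"
    by (intro fps_expansion_intros F)
  hence "(\<lambda>z. 1 + f z * f z) has_fps_expansion fps_deriv (fps_deriv F)"
    using ode by (subst (asm) has_fps_expansion_cong[OF _ refl]) (auto simp: power2_eq_square)
  moreover have "(\<lambda>z. 1 + f z * f z) has_fps_expansion 1 + F * F"
    by (intro fps_expansion_intros F)
  ultimately have "fps_deriv (fps_deriv F) = 1 + F * F" by (rule fps_expansion_unique_complex)
  moreover have "fps_nth F 0 = 0" "fps_nth F 1 = 0"
    using init by (simp_all add: fps_nth_fps_expansion[OF F])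
  ultimately have "F = T_gf" by (intro fps_ode_unique) (simp_all add: power2_eq_square)
  thus ?thesis using F by simp
qed

context lemniscate_lattice
begin

section \<open>The generating function in terms of wp\<close>

definition \<alpha> :: complex where "\<alpha> = of_real (3 powr (- 1 / 4))"
definition \<gamma> :: complex where "\<gamma> = of_real (6 / sqrt 3)"

text \<open>For T = \<gamma> wp(\<alpha>z + w) and wp'' = 6 wp^2 + 1/2 the equation T'' = 1 + T^2
  amounts to \<gamma>\<alpha>^2 = 2 and 6\<alpha>^2 = \<gamma>; hence \<alpha>^4 = 1/3.\<close>

lemma \<alpha>\<gamma>: "\<alpha> \<noteq> 0" "\<gamma> \<noteq> 0" "\<gamma> * \<alpha> ^ 2 = 2" "6 * \<alpha> ^ 2 = \<gamma>"
proof -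
  show "\<alpha> \<noteq> 0" "\<gamma> \<noteq> 0" by (simp_all add: \<alpha>_def \<gamma>_def)
  have "(3 powr (- 1 / 4)) ^ 2 = (3 :: real) powr (- (1 / 2))"
    by (simp add: powr_power)
  also have "\<dots> = 1 / 3 powr (1 / 2)" by (rule powr_minus_divide)
  also have "\<dots> = 1 / sqrt 3" by (simp only: powr_half_sqrt zero_le_numeral)
  finally have a: "(3 powr (- 1 / 4)) ^ 2 = 1 / sqrt (3 :: real)" .
  have "6 / sqrt 3 * (3 powr (- 1 / 4)) ^ 2 = (2 :: real)" unfolding a by (simp add: field_simps)
  hence "of_real (6 / sqrt 3 * (3 powr (- 1 / 4)) ^ 2) = (of_real 2 :: complex)" by (simp only:)
  thus "\<gamma> * \<alpha> ^ 2 = 2" by (simp add: \<alpha>_def \<gamma>_def)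
  have "6 * (3 powr (- 1 / 4)) ^ 2 = 6 / sqrt (3 :: real)" unfolding a by simp
  hence "of_real (6 * (3 powr (- 1 / 4)) ^ 2) = (of_real (6 / sqrt 3) :: complex)" by (simp only:)
  thus "6 * \<alpha> ^ 2 = \<gamma>" by (simp add: \<alpha>_def \<gamma>_def)
qed

definition Tw :: "complex \<Rightarrow> complex" where "Tw z = \<gamma> * wp (\<alpha> * z + of_real w)"

lemma Tw_fps: "Tw has_fps_expansion T_gf"
proof -
  define W where "W = (\<lambda>z. \<alpha> * z + of_real w)"
  define S where "S = W -` (- \<Omega>)"
  have S: "open S" "0 \<in> S"
    unfolding S_def W_def using w_not_in by (auto intro!: open_vimage open_compl continuous_intros)
  have DW: "(W has_field_derivative \<alpha>) (at z)" for z
    unfolding W_def by (auto intro!: derivative_eq_intros)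
  have D1: "(Tw has_field_derivative - 2 * \<gamma> * \<alpha> * E 3 (W z)) (at z)" if "z \<in> S" for z
  proof -
    have "((\<lambda>z. wp (W z)) has_field_derivative - 2 * E 3 (W z) * \<alpha>) (at z)"
      by (rule DERIV_chain2[OF wp_deriv DW]) (use that in \<open>auto simp: S_def\<close>)
    from DERIV_cmult[OF this, of \<gamma>] show ?thesis by (simp add: Tw_def[abs_def] W_def mult_ac)
  qed
  have d1: "deriv Tw z = - 2 * \<gamma> * \<alpha> * E 3 (W z)" if "z \<in> S" for z
    by (rule DERIV_imp_deriv[OF D1[OF that]])
  have D2: "(deriv Tw has_field_derivative 1 + Tw z ^ 2) (at z)" if z: "z \<in> S" for z
  proof -
    have zz: "W z \<notin> \<Omega>" using z by (auto simp: S_def)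
    have "((\<lambda>z. E 3 (W z)) has_field_derivative (- of_nat 3 * E (Suc 3) (W z)) * \<alpha>) (at z)"
      by (rule DERIV_chain2[OF E_deriv DW]) (use zz in auto)
    from DERIV_cmult[OF this, of "- 2 * \<gamma> * \<alpha>"]
    have "((\<lambda>z. - 2 * \<gamma> * \<alpha> * E 3 (W z)) has_field_derivative (\<gamma> * \<alpha> ^ 2) * (6 * E 4 (W z))) (at z)"
      by (simp add: power2_eq_square mult_ac)
    hence "(deriv Tw has_field_derivative (\<gamma> * \<alpha> ^ 2) * (6 * E 4 (W z))) (at z)"
      by (rule has_field_derivative_transform_within_open[OF _ S(1) z]) (use d1 in auto)
    also have "(\<gamma> * \<alpha> ^ 2) * (6 * E 4 (W z)) = \<gamma> * \<alpha> ^ 2 / 2 + \<gamma> * (6 * \<alpha> ^ 2) * wp (W z) ^ 2"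
      unfolding wp_ode[OF zz] g2 by (simp add: algebra_simps)
    also have "\<dots> = 1 + Tw z ^ 2"
      unfolding \<alpha>\<gamma> by (simp add: Tw_def W_def power2_eq_square)
    finally show ?thesis .
  qed
  show ?thesis
  proof (rule has_fps_expansion_T_gfI)
    have "Tw holomorphic_on S" unfolding holomorphic_on_open[OF S(1)] using D1 by blast
    thus "Tw analytic_on {0}" using S by (auto simp: analytic_at)
    show "Tw 0 = 0" by (simp add: Tw_def wp_w)
    show "deriv Tw 0 = 0" using d1[OF S(2)] by (simp add: W_def E3_w)
    show "eventually (\<lambda>z. deriv (deriv Tw) z = 1 + Tw z ^ 2) (nhds 0)"
      using eventually_nhds_in_open[OF S] by eventually_elim (rule DERIV_imp_deriv[OF D2])
  qed
qed

lemma eval_T_gf_wp: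
  assumes "ereal (norm z) < fps_conv_radius T_gf"
  shows "eval_fps T_gf z = Tw z"
proof -
  have "eval_fps T_gf z = (\<lambda>z. \<gamma> * wp z) (\<alpha> * z + of_real w)"
  proof (rule eval_T_gf_eqI[OF _ _ \<alpha>\<gamma>(1) _ assms])
    show "(\<lambda>z. \<gamma> * wp z) meromorphic_on UNIV" by (intro meromorphic_intros wp_meromorphic)
    show "(\<lambda>z. \<gamma> * wp (\<alpha> * z + of_real w)) has_fps_expansion T_gf"
      using Tw_fps by (simp add: Tw_def[abs_def])
    fix c
    show "is_pole (\<lambda>z. \<gamma> * wp z) c \<or> (\<lambda>z. \<gamma> * wp z) \<midarrow>c\<rightarrow> \<gamma> * wp c"
    proof (cases "c \<in> \<Omega>")
      case True
      then show ?thesis using \<alpha>\<gamma>(2) is_pole_wp_iff by simp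
    next
      case False
      hence "wp \<midarrow>c\<rightarrow> wp c" using DERIV_isCont[OF wp_deriv] by (simp add: isCont_def)
      thus ?thesis by (auto intro: tendsto_intros)
    qed
  qed
  thus ?thesis by (simp add: Tw_def)
qed

section \<open>The generating function in terms of the lemniscate sine\<close>

definition \<delta> :: complex where "\<delta> = 1 / (of_real (3 powr (1 / 4)) * (1 + \<i>))"

lemma one_plus_ii_nz: "1 + \<i> \<noteq> 0" by (simp add: complex_eq_iff)

text \<open>Since the second derivative of sl^2 is 2 - 6 sl^4, the function K sl(\<delta>z)^2 solves
  T'' = 1 + T^2 when K\<delta>^2 = 1/2 and 3\<delta>^2 = -K/2, here with K = \<i> sqrt 3.\<close>

lemma \<delta>: "\<delta> \<noteq> 0" "(of_real (sqrt 3) * \<i>) * \<delta> ^ 2 = 1 / 2" "3 * \<delta> ^ 2 = - (of_real (sqrt 3) * \<i>) / 2"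
proof -
  show "\<delta> \<noteq> 0" using one_plus_ii_nz by (simp add: \<delta>_def)
  have "(3 powr (1 / 4)) ^ 2 = (3 :: real) powr (1 / 2)" by (simp add: powr_power)
  also have "\<dots> = sqrt 3" by (simp add: powr_half_sqrt)
  finally have "of_real ((3 powr (1 / 4)) ^ 2) = (of_real (sqrt 3) :: complex)" by (simp only:)
  hence a: "of_real (3 powr (1 / 4)) ^ 2 = (of_real (sqrt 3) :: complex)" by simp
  have b: "(1 + \<i>) ^ 2 = 2 * \<i>" by (simp add: power2_eq_square algebra_simps)
  have d2: "\<delta> ^ 2 = 1 / (of_real (sqrt 3) * (2 * \<i>))"
    unfolding \<delta>_def by (simp only: power_divide power_mult_distrib a b power_one)
  have s: "of_real (sqrt 3) * of_real (sqrt 3) = (3 :: complex)"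
    by (simp flip: of_real_mult)
  show "(of_real (sqrt 3) * \<i>) * \<delta> ^ 2 = 1 / 2" unfolding d2 by simp
  have "3 * \<delta> ^ 2 = of_real (sqrt 3) * of_real (sqrt 3) / (of_real (sqrt 3) * (2 * \<i>))"
    unfolding s d2 by simp
  also have "\<dots> = of_real (sqrt 3) / (2 * \<i>)" by simp
  also have "\<dots> = - (of_real (sqrt 3) * \<i>) / 2" by (simp add: field_simps)
  finally show "3 * \<delta> ^ 2 = - (of_real (sqrt 3) * \<i>) / 2" .
qed

definition Ts :: "complex \<Rightarrow> complex" where "Ts z = of_real (sqrt 3) * \<i> * sl (\<delta> * z) ^ 2"

lemma Ts_fps: "Ts has_fps_expansion T_gf"
proof -
  define K :: complex where "K = of_real (sqrt 3) * \<i>"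
  define dom' where "dom' = {z \<in> slc_dom. deriv slc z \<noteq> 0}"
  have hol': "deriv slc holomorphic_on slc_dom" by (rule holomorphic_deriv[OF slc_holomorphic open_slc_dom])
  have "open dom'"
  proof -
    have "continuous_on slc_dom (deriv slc)" using hol' by (rule holomorphic_on_imp_continuous_on)
    from continuous_open_preimage[OF this open_slc_dom, of "- {0}"] show ?thesis
      by (auto simp: dom'_def vimage_def Int_def)
  qed
  have d0: "deriv slc 0 = 1" using DERIV_imp_deriv[OF slc_deriv_0] .
  have dom'0: "0 \<in> dom'" using zero_in_slc_dom d0 by (simp add: dom'_def)
  have D1: "(slc has_field_derivative deriv slc z) (at z)" if "z \<in> slc_dom" for z
    using slc_holomorphic open_slc_dom that holomorphic_derivI by blast
  \<comment> \<open>Differentiating slc'^2 = 1 - slc^4 leaves a common factor slc'; cancelling it is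
    the reason for the restriction to \<open>dom'\<close>.\<close>
  have D2: "(deriv slc has_field_derivative - 2 * slc z ^ 3) (at z)" if z: "z \<in> dom'" for z
  proof -
    have zs: "z \<in> slc_dom" and nz: "deriv slc z \<noteq> 0" using z by (auto simp: dom'_def)
    obtain D where D: "(deriv slc has_field_derivative D) (at z)"
      using hol' open_slc_dom zs holomorphic_derivI by blast
    have "((\<lambda>z. deriv slc z ^ 2) has_field_derivative 2 * deriv slc z * D) (at z)"
      using D by (auto intro!: derivative_eq_intros)
    moreover have "((\<lambda>z. 1 - slc z ^ 4) has_field_derivative - (4 * slc z ^ 3 * deriv slc z)) (at z)"
      using D1[OF zs] by (auto intro!: derivative_eq_intros)
    hence "((\<lambda>z. deriv slc z ^ 2) has_field_derivative - (4 * slc z ^ 3 * deriv slc z)) (at z)"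
      by (rule has_field_derivative_transform_within_open[OF _ open_slc_dom zs]) (use slc_ode in auto)
    ultimately have eq: "2 * deriv slc z * D = - (4 * slc z ^ 3 * deriv slc z)" by (rule DERIV_unique)
    have "deriv slc z * (2 * D) = 2 * deriv slc z * D" by (simp only: mult_ac)
    also note eq
    also have "- (4 * slc z ^ 3 * deriv slc z) = deriv slc z * (- 4 * slc z ^ 3)" by simp
    finally have D2: "2 * D = - 4 * slc z ^ 3" by (rule mult_left_cancel[OF nz, THEN iffD1])
    have "D = 2 * D / 2" by simp
    also have "\<dots> = - 2 * slc z ^ 3" unfolding D2 by simp
    finally have "D = - 2 * slc z ^ 3" .
    thus ?thesis using D by simp
  qed
  define g where "g = (\<lambda>z. K * slc (\<delta> * z) ^ 2)"
  define S where "S = (\<lambda>z. \<delta> * z) -` dom'"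
  have S: "open S" "0 \<in> S"
    unfolding S_def using dom'0 \<open>open dom'\<close> by (auto intro!: open_vimage continuous_intros)
  have Dl: "((\<lambda>z. \<delta> * z) has_field_derivative \<delta>) (at z)" for z
    by (auto intro!: derivative_eq_intros)
  have gD1: "(g has_field_derivative 2 * K * \<delta> * (slc (\<delta> * z) * deriv slc (\<delta> * z))) (at z)"
    if "z \<in> S" for z
  proof -
    have "((\<lambda>z. slc (\<delta> * z)) has_field_derivative deriv slc (\<delta> * z) * \<delta>) (at z)"
      by (rule DERIV_chain2[OF D1 Dl]) (use that in \<open>auto simp: S_def dom'_def\<close>)
    thus ?thesis unfolding g_def by (auto intro!: derivative_eq_intros)
  qed
  have d1: "deriv g z = 2 * K * \<delta> * (slc (\<delta> * z) * deriv slc (\<delta> * z))" if "z \<in> S" for z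
    by (rule DERIV_imp_deriv[OF gD1[OF that]])
  have gD2: "(deriv g has_field_derivative 1 + g z ^ 2) (at z)" if z: "z \<in> S" for z
  proof -
    let ?y = "\<delta> * z"
    have y: "?y \<in> dom'" "?y \<in> slc_dom" using z by (auto simp: S_def dom'_def)
    have A: "((\<lambda>z. slc (\<delta> * z)) has_field_derivative deriv slc ?y * \<delta>) (at z)"
      by (rule DERIV_chain2[OF D1 Dl]) (use y in auto)
    have B: "((\<lambda>z. deriv slc (\<delta> * z)) has_field_derivative (- 2 * slc ?y ^ 3) * \<delta>) (at z)"
      by (rule DERIV_chain2[OF D2 Dl]) (use y in auto)
    have "((\<lambda>z. 2 * K * \<delta> * (slc (\<delta> * z) * deriv slc (\<delta> * z))) has_field_derivative
        2 * K * \<delta> * (deriv slc ?y * \<delta> * deriv slc ?y + (- 2 * slc ?y ^ 3) * \<delta> * slc ?y)) (at z)"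
      by (intro DERIV_cmult DERIV_mult A B)
    hence "(deriv g has_field_derivative
        2 * K * \<delta> * (deriv slc ?y * \<delta> * deriv slc ?y + (- 2 * slc ?y ^ 3) * \<delta> * slc ?y)) (at z)"
      by (rule has_field_derivative_transform_within_open[OF _ S(1) z]) (use d1 in auto)
    also have "2 * K * \<delta> * (deriv slc ?y * \<delta> * deriv slc ?y + (- 2 * slc ?y ^ 3) * \<delta> * slc ?y) =
        2 * (K * \<delta> ^ 2) * deriv slc ?y ^ 2 - 4 * (K * \<delta> ^ 2) * slc ?y ^ 4"
      by (simp add: algebra_simps power2_eq_square power3_eq_cube power4_eq_xxxx)
    also have "\<dots> = 2 * (K * \<delta> ^ 2) + K * (- 2 * (3 * \<delta> ^ 2)) * slc ?y ^ 4"
      unfolding slc_ode[OF y(2)] by (simp add: algebra_simps)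
    also have "\<dots> = 1 + K * K * slc ?y ^ 4"
      unfolding \<delta>(2)[folded K_def] \<delta>(3)[folded K_def] by simp
    also have "\<dots> = 1 + g z ^ 2"
      by (simp add: g_def power2_eq_square power4_eq_xxxx mult_ac)
    finally show ?thesis .
  qed
  have "g has_fps_expansion T_gf"
  proof (rule has_fps_expansion_T_gfI)
    have "g holomorphic_on S" unfolding holomorphic_on_open[OF S(1)] using gD1 by blast
    thus "g analytic_on {0}" using S by (auto simp: analytic_at)
    show "g 0 = 0" by (simp add: g_def)
    show "deriv g 0 = 0" using d1[OF S(2)] by simp
    show "eventually (\<lambda>z. deriv (deriv g) z = 1 + g z ^ 2) (nhds 0)"
      using eventually_nhds_in_open[OF S] by eventually_elim (rule DERIV_imp_deriv[OF gD2])
  qed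
  moreover have "eventually (\<lambda>z. g z = Ts z) (nhds 0)"
  proof -
    have "filterlim (\<lambda>z. \<delta> * z) (nhds (\<delta> * 0)) (nhds 0)"
      by (intro tendsto_intros) (simp add: filterlim_ident)
    hence "filterlim (\<lambda>z. \<delta> * z) (nhds 0) (nhds 0)" by simp
    from eventually_compose_filterlim[OF slm_eq_slc this] show ?thesis
      by eventually_elim (simp add: g_def Ts_def K_def sl_eq_slm)
  qed
  ultimately show ?thesis by (subst (asm) has_fps_expansion_cong[OF _ refl]) auto
qed

lemma eval_T_gf_sl:
  assumes "ereal (norm z) < fps_conv_radius T_gf"
  shows "eval_fps T_gf z = Ts z"
proof -
  define K :: complex where "K = of_real (sqrt 3) * \<i>"
  have K: "K \<noteq> 0" by (simp add: K_def)
  have nice: "sl nicely_meromorphic_on UNIV" unfolding sl_eq_slm by (rule slm_nicely)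
  have "eval_fps T_gf z = (\<lambda>z. K * sl z ^ 2) (\<delta> * z + 0)"
  proof (rule eval_T_gf_eqI[OF _ _ \<delta>(1) _ assms])
    show "(\<lambda>z. K * sl z ^ 2) meromorphic_on UNIV"
      using nice by (intro meromorphic_intros) (auto simp: nicely_meromorphic_on_def)
    show "(\<lambda>z. K * sl (\<delta> * z + 0) ^ 2) has_fps_expansion T_gf"
      using Ts_fps by (simp add: Ts_def[abs_def] K_def)
    fix c
    have "is_pole sl c \<or> sl \<midarrow>c\<rightarrow> sl c" using nice by (auto simp: nicely_meromorphic_on_def)
    thus "is_pole (\<lambda>z. K * sl z ^ 2) c \<or> (\<lambda>z. K * sl z ^ 2) \<midarrow>c\<rightarrow> K * sl c ^ 2"
    proof
      assume "is_pole sl c"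
      hence "is_pole (\<lambda>z. sl z ^ 2) c"
        unfolding is_pole_def by (intro Limits.filterlim_power_at_infinity) auto
      thus ?thesis using K by simp
    qed (auto intro!: tendsto_intros)
  qed
  thus ?thesis by (simp add: Ts_def K_def)
qed

section \<open>The coefficients as lattice sums\<close>

lemma summable_shifted_lattice:
  assumes "k \<ge> 3"
  shows "(\<lambda>x. 1 / (of_real w + pt x) ^ k) summable_on UNIV"
    and "(\<Sum>\<^sub>\<infinity>x. 1 / (of_real w + pt x) ^ k) = (- 1) ^ k * E k (- of_real w)"
proof -
  have eq: "1 / (of_real w + x) ^ k = (- 1) ^ k * (1 / (- of_real w - x) ^ k)" for x :: complex
    using inverse_power_uminus[of "- of_real w - x" k] by (simp add: add.commute)
  have "- of_real w \<notin> \<Omega>" using w_not_in by simp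
  hence "(\<lambda>\<omega>. 1 / (- of_real w - \<omega>) ^ k) summable_on \<Omega>"
    by (intro E_on_summable) (use assms in auto)
  hence s: "(\<lambda>\<omega>. 1 / (of_real w + \<omega>) ^ k) summable_on \<Omega>"
    unfolding eq by (rule summable_on_cmult_right)
  thus "(\<lambda>x. 1 / (of_real w + pt x) ^ k) summable_on UNIV"
    unfolding \<Omega>_range by (subst (asm) summable_on_reindex) (auto simp: o_def inj_pt)
  have "(\<Sum>\<^sub>\<infinity>x. 1 / (of_real w + pt x) ^ k) = (\<Sum>\<^sub>\<infinity>\<omega>\<in>\<Omega>. 1 / (of_real w + \<omega>) ^ k)"
    unfolding \<Omega>_range by (subst infsum_reindex) (auto simp: o_def inj_pt)
  also have "\<dots> = (- 1) ^ k * E k (- of_real w)"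
    unfolding eq E_on_def by (rule infsum_cmult_right')
  finally show "(\<Sum>\<^sub>\<infinity>x. 1 / (of_real w + pt x) ^ k) = (- 1) ^ k * E k (- of_real w)" .
qed

text \<open>T_n is the derivative of order 2n at 0 of \<gamma> wp(\<alpha>z + w), namely
  \<gamma>\<alpha>^(2n) (2n+1)! E_(2n+2)(w). Pulling \<open>w\<close> out of each denominator leaves
  Gaussian integers.\<close>

lemma T_num_lattice_sum:
  assumes n: "n \<ge> 1"
  defines "s \<equiv> (\<lambda>(n1 :: int, n2 :: int).
          1 / (1 + of_int n1 + of_int n2 + \<i> * (of_int n1 - of_int n2)) ^ (2 * n + 2))"
  shows "s summable_on UNIV"
    and "of_nat (T_num n) = \<gamma> * \<alpha> ^ (2 * n) * fact (2 * n + 1) / of_real w ^ (2 * n + 2) * infsum s UNIV"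
proof -
  let ?k = "2 * n + 2"
  have w0: "of_real w \<noteq> (0 :: complex)" using w_pos by simp
  have s_eq: "s = (\<lambda>x. of_real w ^ ?k * (1 / (of_real w + pt x) ^ ?k))"
  proof
    fix x :: "int \<times> int"
    obtain a b where x: "x = (a, b)" by (cases x)
    have "of_real w + pt x = of_real w * (1 + of_int a + of_int b + \<i> * (of_int a - of_int b))"
      unfolding x pt_square by (simp add: algebra_simps)
    thus "s x = of_real w ^ ?k * (1 / (of_real w + pt x) ^ ?k)"
      using w0 unfolding s_def x by (simp add: power_mult_distrib del: power_Suc)
  qed
  have k: "?k \<ge> 3" using n by simp
  show "s summable_on UNIV"
    unfolding s_eq by (intro summable_on_cmult_right summable_shifted_lattice k)
  have "infsum s UNIV = of_real w ^ ?k * (\<Sum>\<^sub>\<infinity>x. 1 / (of_real w + pt x) ^ ?k)"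
    unfolding s_eq by (rule infsum_cmult_right')
  also have "\<dots> = of_real w ^ ?k * E ?k (of_real w)"
    unfolding summable_shifted_lattice(2)[OF k] E_uminus by simp
  finally have E: "E ?k (of_real w) = infsum s UNIV / of_real w ^ ?k" using w0 by simp
  have "fps_nth T_gf (2 * n) = (deriv ^^ (2 * n)) Tw 0 / fact (2 * n)"
    by (rule fps_nth_fps_expansion[OF Tw_fps])
  moreover have "fps_nth T_gf (2 * n) = of_nat (T_num n) / fact (2 * n)"
    by (simp add: T_gf_nth T_num_eq_bitree_count)
  ultimately have "of_nat (T_num n) = (deriv ^^ (2 * n)) Tw 0" by simp
  also have "\<dots> = \<alpha> ^ (2 * n) * (deriv ^^ (2 * n)) (\<lambda>z. \<gamma> * wp z) (\<alpha> * 0 + of_real w)"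
    unfolding Tw_def[abs_def]
  proof (rule higher_deriv_compose_linear'[where S = "(\<lambda>z. \<alpha> * z + of_real w) -` (- \<Omega>)" and T = "- \<Omega>"])
    show "(\<lambda>z. \<gamma> * wp z) holomorphic_on - \<Omega>"
      using wp_deriv by (intro holomorphic_intros) (auto simp: holomorphic_on_open[OF open_compl])
    show "open ((\<lambda>z. \<alpha> * z + complex_of_real w) -` (- \<Omega>))"
      by (intro open_vimage open_compl continuous_intros)
  qed (use open_compl w_not_in in auto)
  also have "(deriv ^^ (2 * n)) (\<lambda>z. \<gamma> * wp z) (\<alpha> * 0 + of_real w) = \<gamma> * (deriv ^^ (2 * n)) wp (of_real w)"
    using higher_deriv_cmult'[OF wp_analytic[OF w_not_in]] by simp
  also have "(deriv ^^ (2 * n)) wp (of_real w) = fact (2 * n + 1) * E ?k (of_real w)"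
  proof -
    \<comment> \<open>\<open>higher_deriv_wp\<close> starts at the first derivative, so n >= 1 is
      used here; the even order removes the sign.\<close>
    obtain j where j: "2 * n = Suc j" using n by (cases "2 * n") auto
    have "(- 1) ^ Suc j = (1 :: complex)" unfolding j[symmetric] by simp
    thus ?thesis using higher_deriv_wp[OF w_not_in, of j] unfolding j by (simp add: eval_nat_numeral)
  qed
  finally show "of_nat (T_num n) = \<gamma> * \<alpha> ^ (2 * n) * fact (2 * n + 1) / of_real w ^ (2 * n + 2) * infsum s UNIV"
    unfolding E by simp
qed

end

theorem theorem4p1:
  shows "fps_conv_radius T_gf > 0 \<and>
    (\<forall>z :: complex. ereal (norm z) < fps_conv_radius T_gf \<longrightarrow>
       eval_fps T_gf z =
         complex_of_real (6 / sqrt 3) *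
           weierstrass_wp (complex_of_real (3 powr (-1/4)) * z + complex_of_real lemniscate_const) (-1) 0 \<and>
       eval_fps T_gf z =
         complex_of_real (sqrt 3) * \<i> * (sl (z / (complex_of_real (3 powr (1/4)) * (1 + \<i>)))) ^ 2) \<and>
    T_num 1 = 1 \<and>
    (\<forall>n :: nat. n \<ge> 2 \<longrightarrow>
       T_num n = (\<Sum>k = 1..n - 2. ((2 * n - 2) choose (2 * k)) * T_num k * T_num (n - 1 - k))) \<and>
    (\<forall>n :: nat. n \<ge> 1 \<longrightarrow>
       (\<lambda>(n1 :: int, n2 :: int).
          1 / (1 + of_int n1 + of_int n2 + \<i> * (of_int n1 - of_int n2)) ^ (2 * n + 2))
         summable_on UNIV \<and>
       complex_of_real (real (T_num n)) =
         complex_of_real (fact (2 * n + 1) * 2 ^ (3 * n + 4) * pi ^ (n + 1) /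
                          (3 powr ((real n - 1) / 2) * Gamma (1/4) ^ (4 * n + 4))) *
         (\<Sum>\<^sub>\<infinity>(n1 :: int, n2 :: int)\<in>UNIV.
            1 / (1 + of_int n1 + of_int n2 + \<i> * (of_int n1 - of_int n2)) ^ (2 * n + 2)))"
proof -
  let ?w = lemniscate_const
  define \<Omega> where "\<Omega> = {of_int m * (of_real ?w * (1 + \<i>)) + of_int n * (of_real ?w * (1 - \<i>)) | m n. True}"
  have quot: "of_real ?w * (1 - \<i>) / (of_real ?w * (1 + \<i>)) = - \<i>"
  proof -
    have "(1 - \<i>) / (1 + \<i>) = - \<i>" by (simp add: complex_eq_iff Re_divide Im_divide)
    thus ?thesis using lemniscate_const_pos by simp
  qed
  interpret sq: square_lattice ?w \<Omega>
  proof
    show "of_real ?w * (1 + \<i>) \<noteq> 0" using lemniscate_const_pos by (simp add: complex_eq_iff)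
    show "of_real ?w * (1 - \<i>) / (of_real ?w * (1 + \<i>)) \<notin> \<real>"
      unfolding quot by (simp add: complex_is_Real_iff)
  qed (use \<Omega>_def lemniscate_const_pos in auto)
  interpret lemniscate_lattice ?w \<Omega>
  proof
    obtain \<kappa> where "invariant_g2 \<Omega> = - of_real (\<kappa> ^ 4)" "?w = \<kappa> * ?w"
      by (rule sq.lemniscate_period) blast
    \<comment> \<open>Cancelling the positive constant in w = \<kappa> w leaves \<kappa> =
      1.\<close>
    thus "invariant_g2 \<Omega> = - 1" using lemniscate_const_pos by simp
  qed
  have L: "lattice_of_invariants (- 1) 0 = \<Omega>"
    by (rule lattice_of_invariants_eq[OF _ g2 sq.g3_eq_0]) unfold_locales
  have R: "fps_conv_radius T_gf > 0" using Tw_fps by (simp add: has_fps_expansion_def)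
  have Tw: "complex_of_real (6 / sqrt 3) *
      weierstrass_wp (complex_of_real (3 powr (-1/4)) * z + complex_of_real ?w) (-1) 0 = Tw z" for z
    by (simp add: weierstrass_wp_def L Tw_def \<alpha>_def \<gamma>_def)
  have Ts: "complex_of_real (sqrt 3) * \<i> * (sl (z / (complex_of_real (3 powr (1/4)) * (1 + \<i>)))) ^ 2 = Ts z" for z
    by (simp add: Ts_def \<delta>_def)
  \<comment> \<open>The Gamma form of w contributes 2^(3n+3) \<pi>^(n+1) / Gamma(1/4)^(4n+4). The
    remaining factor 2 and the power of 3 come from (6/sqrt 3) 3^(-n/2) = 2 / 3^((n-1)/2).\<close>
  have coeff: "\<gamma> * \<alpha> ^ (2 * n) * fact (2 * n + 1) / of_real ?w ^ (2 * n + 2) =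
      complex_of_real (fact (2 * n + 1) * 2 ^ (3 * n + 4) * pi ^ (n + 1) /
                          (3 powr ((real n - 1) / 2) * Gamma (1/4) ^ (4 * n + 4)))" for n
  proof -
    define g :: real where "g = Gamma (1/4)"
    have g: "g > 0" unfolding g_def by (rule Gamma_real_pos) auto
    have "(2 * sqrt (2 * pi)) ^ (2 * n + 2) = ((2 * sqrt (2 * pi)) ^ 2) ^ (n + 1)"
      by (simp only: power_mult[symmetric] distrib_left mult_1_right)
    also have "(2 * sqrt (2 * pi)) ^ 2 = 2 ^ 3 * pi" by (simp add: power_mult_distrib)
    also have "(2 ^ 3 * pi) ^ (n + 1) = 2 ^ (3 * (n + 1)) * pi ^ (n + 1)"
      by (simp only: power_mult_distrib power_mult)
    finally have p: "(2 * sqrt (2 * pi)) ^ (2 * n + 2) = 2 ^ (3 * n + 3) * pi ^ (n + 1)"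
      by (simp only: distrib_left mult_1_right)
    have "?w ^ (2 * n + 2) = (g ^ 2) ^ (2 * n + 2) / (2 * sqrt (2 * pi)) ^ (2 * n + 2)"
      unfolding lemniscate_const_eq g_def by (rule power_divide)
    also have "(g ^ 2) ^ (2 * n + 2) = g ^ (2 * (2 * n + 2))" by (rule power_mult[symmetric])
    also have "2 * (2 * n + 2) = 4 * n + 4" by simp
    finally have w: "?w ^ (2 * n + 2) = g ^ (4 * n + 4) / (2 ^ (3 * n + 3) * pi ^ (n + 1))" unfolding p .
    have "(6 / sqrt 3) * (3 powr (- 1 / 4)) ^ (2 * n) = 2 * (3 powr (1 / 2) * 3 powr (- (real n / 2)))"
    proof -
      have "6 / sqrt 3 = 2 * (3 :: real) powr (1 / 2)" by (simp add: powr_half_sqrt field_simps)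
      moreover have "((3 :: real) powr (- 1 / 4)) ^ (2 * n) = 3 powr (- (real n / 2))"
        by (simp add: powr_power)
      ultimately show ?thesis by simp
    qed
    also have "\<dots> = 2 * 3 powr (- ((real n - 1) / 2))"
      by (simp only: powr_add[symmetric]) (simp add: diff_divide_distrib)
    also have "\<dots> = 2 / 3 powr ((real n - 1) / 2)" by (simp add: powr_minus_divide)
    finally have c: "(6 / sqrt 3) * (3 powr (- 1 / 4)) ^ (2 * n) = 2 / 3 powr ((real n - 1) / 2)" .
    have "2 / 3 powr ((real n - 1) / 2) * fact (2 * n + 1) / ?w ^ (2 * n + 2) =
        fact (2 * n + 1) * 2 ^ (3 * n + 4) * pi ^ (n + 1) / (3 powr ((real n - 1) / 2) * g ^ (4 * n + 4))"
    proof -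
      have two: "(2 :: real) ^ (3 * n + 4) = 2 * 2 ^ (3 * n + 3)" by (simp add: power_add)
      show ?thesis unfolding w two using g by (simp only: divide_divide_eq_right times_divide_eq_left
          times_divide_eq_right divide_divide_eq_left mult_ac)
    qed
    hence "of_real ((6 / sqrt 3) * (3 powr (- 1 / 4)) ^ (2 * n) * fact (2 * n + 1) / ?w ^ (2 * n + 2)) =
        complex_of_real (fact (2 * n + 1) * 2 ^ (3 * n + 4) * pi ^ (n + 1) / (3 powr ((real n - 1) / 2) * g ^ (4 * n + 4)))"
      unfolding c by (simp only:)
    moreover have "of_real ((6 / sqrt 3) * (3 powr (- 1 / 4)) ^ (2 * n) * fact (2 * n + 1) / ?w ^ (2 * n + 2)) =
        \<gamma> * \<alpha> ^ (2 * n) * fact (2 * n + 1) / of_real ?w ^ (2 * n + 2)"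
      unfolding \<alpha>_def \<gamma>_def
      by (simp only: of_real_mult of_real_divide of_real_power of_real_fact)
    ultimately show ?thesis by (simp only: g_def)
  qed
  show ?thesis
  proof (intro conjI allI impI)
    show "fps_conv_radius T_gf > 0" by fact
    show "T_num 1 = 1" by (rule T_num_1)
  next
    fix z :: complex assume z: "ereal (norm z) < fps_conv_radius T_gf"
    show "eval_fps T_gf z = complex_of_real (6 / sqrt 3) *
        weierstrass_wp (complex_of_real (3 powr (-1/4)) * z + complex_of_real ?w) (-1) 0"
      unfolding Tw by (rule eval_T_gf_wp[OF z])
    show "eval_fps T_gf z = complex_of_real (sqrt 3) * \<i> *
        (sl (z / (complex_of_real (3 powr (1/4)) * (1 + \<i>)))) ^ 2"
      unfolding Ts by (rule eval_T_gf_sl[OF z])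
  next
    fix n :: nat assume "n \<ge> 2"
    thus "T_num n = (\<Sum>k = 1..n - 2. ((2 * n - 2) choose (2 * k)) * T_num k * T_num (n - 1 - k))"
      by (rule T_num_rec)
  next
    fix n :: nat assume n: "n \<ge> 1"
    show "(\<lambda>(n1 :: int, n2 :: int).
          1 / (1 + of_int n1 + of_int n2 + \<i> * (of_int n1 - of_int n2)) ^ (2 * n + 2)) summable_on UNIV"
      by (rule T_num_lattice_sum[OF n])
    show "complex_of_real (real (T_num n)) =
         complex_of_real (fact (2 * n + 1) * 2 ^ (3 * n + 4) * pi ^ (n + 1) /
                          (3 powr ((real n - 1) / 2) * Gamma (1/4) ^ (4 * n + 4))) *
         (\<Sum>\<^sub>\<infinity>(n1 :: int, n2 :: int)\<in>UNIV.
            1 / (1 + of_int n1 + of_int n2 + \<i> * (of_int n1 - of_int n2)) ^ (2 * n + 2))"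
      using T_num_lattice_sum(2)[OF n] unfolding coeff by simp
  qed
qed

end
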